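(* Let $n\ge 0$ be an integer and let $\Gamma$ be a finite simplicial graph that is not a clique and that has no separating $k$-cliques for any $0\le k\le n$. Then the right-angled Artin group $A_\Gamma$ is not commensurable to any group splitting non-trivially over $\mathbb{Z}^k$, for any $0\le k\le n$.
   Context: For a finite simplicial graph $\Gamma$, the right-angled Artin group $A_\Gamma$ is the group with one generator for each vertex of $\Gamma$ and with defining relations that two generators commute if and only if the corresponding vertices span an edge. A clique is a graph in which every pair of distinct vertices spans an edge; a $k$-clique is a clique with $k$ vertices (the $0$-clique is the empty graph). A (possibly empty) induced subgraph $\Delta$ of $\Gamma$ is separating if $\Gamma\setminus\Delta$ (the induced subgraph on the vertices not in $\Delta$) is disconnected, i.e. has at least two connected components; in particular cliques have no separating cliques. Two groups are (abstractly) commensurable if they contain isomorphic finite index subgroups. A group $G$ splits non-trivially over a subgroup $C$ if $G$ decomposes as an amalgamated product $G=A*_C B$ with $G\ne A,B$ or as an HNN-extension $G=A*_C$ with $G\ne A$; it splits non-trivially over $\mathbb{Z}^k$ if it splits non-trivially over a subgroup isomorphic to $\mathbb{Z}^k$. *)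

theory Defs
  imports "HOL-Algebra.Product_Groups" "Graph_Theory.Kuratowski"
begin

section \<open>Group presentations\<close>

text \<open>A letter \<open>(x, True)\<close> stands for the generator \<open>x\<close>, and \<open>(x, False)\<close> for its inverse.\<close>

type_synonym 'x word = "('x \<times> bool) list"

abbreviation words :: "'x set \<Rightarrow> 'x word set"
  where "words X \<equiv> lists (X \<times> UNIV)"

text \<open>The congruence on the words over \<open>X\<close> generated by free cancellation and by the relations
  \<open>l = r\<close> for \<open>(l, r) \<in> R\<close>. Pairs in \<open>R\<close> that are not words over \<open>X\<close> are ignored.\<close>

inductive_set pres_rel :: "'x set \<Rightarrow> ('x word \<times> 'x word) set \<Rightarrow> ('x word \<times> 'x word) set"
  for X :: "'x set" and R :: "('x word \<times> 'x word) set"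
where
  refl: "w \<in> words X \<Longrightarrow> (w, w) \<in> pres_rel X R"
| sym: "(v, w) \<in> pres_rel X R \<Longrightarrow> (w, v) \<in> pres_rel X R"
| trans: "(u, v) \<in> pres_rel X R \<Longrightarrow> (v, w) \<in> pres_rel X R \<Longrightarrow> (u, w) \<in> pres_rel X R"
| cancel: "u \<in> words X \<Longrightarrow> v \<in> words X \<Longrightarrow> x \<in> X \<Longrightarrow>
    (u @ [(x, b), (x, \<not> b)] @ v, u @ v) \<in> pres_rel X R"
| relation: "u \<in> words X \<Longrightarrow> v \<in> words X \<Longrightarrow> (l, r) \<in> R \<Longrightarrow> l \<in> words X \<Longrightarrow> r \<in> words X \<Longrightarrow>
    (u @ l @ v, u @ r @ v) \<in> pres_rel X R"

definition presented_group :: "'x set \<Rightarrow> ('x word \<times> 'x word) set \<Rightarrow> 'x word set monoid"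
  where "presented_group X R =
    \<lparr>carrier = words X // pres_rel X R,
     monoid.mult = (\<lambda>P Q. pres_rel X R `` {u @ v | u v. u \<in> P \<and> v \<in> Q}),
     one = pres_rel X R `` {[]}\<rparr>"

definition pres_gen :: "'x set \<Rightarrow> ('x word \<times> 'x word) set \<Rightarrow> 'x \<Rightarrow> 'x word set"
  where "pres_gen X R x = pres_rel X R `` {[(x, True)]}"

lemma pres_rel_words:
  assumes "(v, w) \<in> pres_rel X R" shows "v \<in> words X \<and> w \<in> words X"
  using assms by induction auto

lemma equiv_pres_rel: "equiv (words X) (pres_rel X R)"
proof (rule equivI)
  show "pres_rel X R \<subseteq> words X \<times> words X"
    by (rule subrelI) (use pres_rel_words in blast)
  show "refl_on (words X) (pres_rel X R)"
    by (auto intro!: refl_onI pres_rel.refl)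
  show "Relation.sym (pres_rel X R)"
    by (auto intro!: symI pres_rel.sym)
  show "Relation.trans (pres_rel X R)"
    by (auto intro!: transI intro: pres_rel.trans)
qed

lemma pres_rel_context:
  assumes "(v, w) \<in> pres_rel X R" "p \<in> words X" "q \<in> words X"
  shows "(p @ v @ q, p @ w @ q) \<in> pres_rel X R"
  using assms
proof (induction)
  case (refl w)
  then show ?case by (intro pres_rel.refl) auto
next
  case (sym v w)
  then show ?case by (auto intro: pres_rel.sym)
next
  case (trans u v w)
  then show ?case by (auto intro: pres_rel.trans)
next
  case (cancel u v x b)
  then show ?case
    using pres_rel.cancel[of "p @ u" X "v @ q" x b R] by simp
next
  case (relation u v l r)
  then show ?case
    using pres_rel.relation[of "p @ u" X "v @ q" l r R] by simp
qed

lemma pres_rel_append: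
  assumes "(v, v') \<in> pres_rel X R" "(w, w') \<in> pres_rel X R"
  shows "(v @ w, v' @ w') \<in> pres_rel X R"
proof -
  have "(v @ w, v' @ w) \<in> pres_rel X R"
    using pres_rel_context[OF assms(1), of "[]" w] pres_rel_words[OF assms(2)] by auto
  moreover have "(v' @ w, v' @ w') \<in> pres_rel X R"
    using pres_rel_context[OF assms(2), of v' "[]"] pres_rel_words[OF assms(1)] by auto
  ultimately show ?thesis by (rule pres_rel.trans)
qed

lemma presented_group_mult:
  assumes "v \<in> words X" "w \<in> words X"
  shows "pres_rel X R `` {v} \<otimes>\<^bsub>presented_group X R\<^esub> pres_rel X R `` {w} = pres_rel X R `` {v @ w}"
proof -
  have "(v, v) \<in> pres_rel X R" "(w, w) \<in> pres_rel X R"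
    using assms by (auto intro: pres_rel.refl)
  then show ?thesis
    unfolding presented_group_def
    by (auto intro: pres_rel.trans pres_rel_append)
qed

lemma words_inverse:
  "w \<in> words X \<Longrightarrow> rev (map (\<lambda>(x, b). (x, \<not> b)) w) \<in> words X"
  by (induction w) auto

lemma pres_rel_inverse:
  assumes "w \<in> words X"
  shows "(rev (map (\<lambda>(x, b). (x, \<not> b)) w) @ w, []) \<in> pres_rel X R"
  using assms
proof (induction w rule: list.induct)
  case Nil
  then show ?case by (auto intro: pres_rel.refl)
next
  case (Cons y w)
  obtain x b where y: "y = (x, b)" by force
  let ?i = "rev (map (\<lambda>(x, b). (x, \<not> b)) w)"
  have "?i \<in> words X" using Cons.prems by (intro words_inverse) simp
  then have "(?i @ [(x, \<not> b), (x, \<not> \<not> b)] @ w, ?i @ w) \<in> pres_rel X R"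
    using Cons.prems y by (intro pres_rel.cancel) auto
  then show ?case
    using Cons y by (auto intro: pres_rel.trans)
qed

lemma group_presented_group: "group (presented_group X R)"
proof -
  let ?G = "presented_group X R"
  have rep: "\<exists>w\<in>words X. P = pres_rel X R `` {w}" if "P \<in> carrier ?G" for P
    using that by (auto simp: presented_group_def elim!: quotientE)
  have cl: "pres_rel X R `` {w} \<in> carrier ?G" if "w \<in> words X" for w
    using that by (auto simp: presented_group_def intro!: quotientI)
  have one: "\<one>\<^bsub>?G\<^esub> = pres_rel X R `` {[]}"
    by (simp add: presented_group_def)
  have nil: "[] \<in> words X" by simp
  have app: "v @ w \<in> words X" if "v \<in> words X" "w \<in> words X" for v w :: "'a word"
    using that by simp
  show ?thesis
  proof (rule groupI)
    fix P Q assume "P \<in> carrier ?G" "Q \<in> carrier ?G"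
    then obtain v w where "v \<in> words X" "w \<in> words X"
      "P = pres_rel X R `` {v}" "Q = pres_rel X R `` {w}"
      using rep by meson
    then show "P \<otimes>\<^bsub>?G\<^esub> Q \<in> carrier ?G"
      using cl[OF app] by (simp only: presented_group_mult)
  next
    show "\<one>\<^bsub>?G\<^esub> \<in> carrier ?G" using cl[OF nil] one by simp
  next
    fix P Q S assume "P \<in> carrier ?G" "Q \<in> carrier ?G" "S \<in> carrier ?G"
    then obtain u v w where "u \<in> words X" "v \<in> words X" "w \<in> words X"
      "P = pres_rel X R `` {u}" "Q = pres_rel X R `` {v}" "S = pres_rel X R `` {w}"
      using rep by meson
    then show "P \<otimes>\<^bsub>?G\<^esub> Q \<otimes>\<^bsub>?G\<^esub> S = P \<otimes>\<^bsub>?G\<^esub> (Q \<otimes>\<^bsub>?G\<^esub> S)"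
      by (simp only: presented_group_mult app append_assoc)
  next
    fix P assume "P \<in> carrier ?G"
    then obtain w where "w \<in> words X" "P = pres_rel X R `` {w}"
      using rep by meson
    then show "\<one>\<^bsub>?G\<^esub> \<otimes>\<^bsub>?G\<^esub> P = P"
      by (simp only: one presented_group_mult nil append_Nil)
  next
    fix P assume "P \<in> carrier ?G"
    then obtain w where w: "w \<in> words X" "P = pres_rel X R `` {w}"
      using rep by meson
    let ?i = "rev (map (\<lambda>(x, b). (x, \<not> b)) w)"
    have i: "?i \<in> words X" using w by (intro words_inverse)
    have "pres_rel X R `` {?i} \<otimes>\<^bsub>?G\<^esub> P = \<one>\<^bsub>?G\<^esub>"
      using equiv_class_eq[OF equiv_pres_rel pres_rel_inverse[OF w(1)]]
      by (simp only: one presented_group_mult w i)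
    then show "\<exists>Q\<in>carrier ?G. Q \<otimes>\<^bsub>?G\<^esub> P = \<one>\<^bsub>?G\<^esub>"
      using cl[OF i] by blast
  qed
qed


section \<open>Right-angled Artin groups\<close>

text \<open>Finite simplicial graphs are represented by the locale \<^locale>\<open>graph\<close>: each edge is a pair of
  opposite arcs.\<close>

definition raag :: "('v, 'e) pre_digraph \<Rightarrow> 'v word set monoid"
  where "raag \<Gamma> = presented_group (verts \<Gamma>)
    {([(u, True), (v, True)], [(v, True), (u, True)]) | u v. u \<rightarrow>\<^bsub>\<Gamma>\<^esub> v}"

definition clique :: "('v, 'e) pre_digraph \<Rightarrow> bool"
  where "clique \<Gamma> \<longleftrightarrow> (\<exists>k. K\<^bsub>k\<^esub> \<Gamma>)"

text \<open>In a symmetric digraph the strongly connected components are the connected components.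
  The predicate \<^const>\<open>Digraph_Component.connected\<close> is not used because it is false for the empty graph, which
  has no component and is therefore not disconnected.\<close>

definition disconnected :: "('v, 'e) pre_digraph \<Rightarrow> bool"
  where "disconnected \<Gamma> \<longleftrightarrow> 2 \<le> card (pre_digraph.sccs \<Gamma>)"

definition separating_clique :: "('v, 'e) pre_digraph \<Rightarrow> nat \<Rightarrow> 'v set \<Rightarrow> bool"
  where "separating_clique \<Gamma> k S \<longleftrightarrow>
    S \<subseteq> verts \<Gamma> \<and> K\<^bsub>k\<^esub> (\<Gamma> \<restriction> S) \<and> disconnected (\<Gamma> \<restriction> (verts \<Gamma> - S))"


section \<open>Commensurability\<close>

definition finite_index_subgroup :: "'a set \<Rightarrow> ('a, 'm) monoid_scheme \<Rightarrow> bool"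
  where "finite_index_subgroup H G \<longleftrightarrow> subgroup H G \<and> finite (rcosets\<^bsub>G\<^esub> H)"

definition commensurable :: "('a, 'm) monoid_scheme \<Rightarrow> ('b, 'n) monoid_scheme \<Rightarrow> bool"
  where "commensurable G G' \<longleftrightarrow> (\<exists>H H'. finite_index_subgroup H G \<and> finite_index_subgroup H' G' \<and>
    G\<lparr>carrier := H\<rparr> \<cong> G'\<lparr>carrier := H'\<rparr>)"


section \<open>Amalgamated products, HNN-extensions and splittings\<close>

definition mult_table :: "('a \<Rightarrow> 'x) \<Rightarrow> ('a, 'm) monoid_scheme \<Rightarrow> ('x word \<times> 'x word) set"
  where "mult_table \<iota> A =
    {([(\<iota> a, True), (\<iota> a', True)], [(\<iota> (a \<otimes>\<^bsub>A\<^esub> a'), True)]) | a a'. a \<in> carrier A \<and> a' \<in> carrier A}"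

text \<open>The amalgamated product of \<open>A\<close> and \<open>B\<close> over \<open>C\<close>, along homomorphisms \<open>f : C \<rightarrow> A\<close> and
  \<open>g : C \<rightarrow> B\<close>, is generated by the disjoint union of \<open>A\<close> and \<open>B\<close> subject to the multiplication
  tables of \<open>A\<close> and \<open>B\<close> and to \<open>f c = g c\<close> for \<open>c \<in> C\<close>.\<close>

abbreviation amalgam_gens :: "('a, 'm) monoid_scheme \<Rightarrow> ('b, 'n) monoid_scheme \<Rightarrow> ('a + 'b) set"
  where "amalgam_gens A B \<equiv> carrier A <+> carrier B"

definition amalgam_rels :: "('a, 'm) monoid_scheme \<Rightarrow> ('b, 'n) monoid_scheme \<Rightarrow> ('c, 'k) monoid_scheme \<Rightarrow>
    ('c \<Rightarrow> 'a) \<Rightarrow> ('c \<Rightarrow> 'b) \<Rightarrow> (('a + 'b) word \<times> ('a + 'b) word) set"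
  where "amalgam_rels A B C f g = mult_table Inl A \<union> mult_table Inr B \<union>
    {([(Inl (f c), True)], [(Inr (g c), True)]) | c. c \<in> carrier C}"

abbreviation amalgamated_product :: "('a, 'm) monoid_scheme \<Rightarrow> ('b, 'n) monoid_scheme \<Rightarrow>
    ('c, 'k) monoid_scheme \<Rightarrow> ('c \<Rightarrow> 'a) \<Rightarrow> ('c \<Rightarrow> 'b) \<Rightarrow> ('a + 'b) word set monoid"
  where "amalgamated_product A B C f g \<equiv> presented_group (amalgam_gens A B) (amalgam_rels A B C f g)"

text \<open>The HNN-extension of \<open>A\<close> along homomorphisms \<open>f, g : C \<rightarrow> A\<close> is generated by \<open>A\<close> and a stable
  letter \<open>t\<close>, represented by \<^const>\<open>None\<close>, subject to the multiplication table of \<open>A\<close> and to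
  \<open>t (f c) = (g c) t\<close> for \<open>c \<in> C\<close>.\<close>

abbreviation hnn_gens :: "('a, 'm) monoid_scheme \<Rightarrow> 'a option set"
  where "hnn_gens A \<equiv> insert None (Some ` carrier A)"

definition hnn_rels :: "('a, 'm) monoid_scheme \<Rightarrow> ('c, 'k) monoid_scheme \<Rightarrow>
    ('c \<Rightarrow> 'a) \<Rightarrow> ('c \<Rightarrow> 'a) \<Rightarrow> ('a option word \<times> 'a option word) set"
  where "hnn_rels A C f g = mult_table Some A \<union>
    {([(None, True), (Some (f c), True)], [(Some (g c), True), (None, True)]) | c. c \<in> carrier C}"

abbreviation hnn_extension :: "('a, 'm) monoid_scheme \<Rightarrow> ('c, 'k) monoid_scheme \<Rightarrow>
    ('c \<Rightarrow> 'a) \<Rightarrow> ('c \<Rightarrow> 'a) \<Rightarrow> 'a option word set monoid"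
  where "hnn_extension A C f g \<equiv> presented_group (hnn_gens A) (hnn_rels A C f g)"

text \<open>A decomposition \<open>G = A *\<^sub>C B\<close> is read internally: \<open>A\<close>, \<open>B\<close> and \<open>C\<close> are subgroups of \<open>G\<close>, the
  amalgamation is along the inclusions, and the canonical homomorphism from the amalgamated product
  to \<open>G\<close>, the identity on \<open>A\<close> and on \<open>B\<close>, is an isomorphism.\<close>

definition amalgam_decomposition :: "('a, 'm) monoid_scheme \<Rightarrow> 'a set \<Rightarrow> 'a set \<Rightarrow> 'a set \<Rightarrow> bool"
  where "amalgam_decomposition G A B C \<longleftrightarrow>
    subgroup A G \<and> subgroup B G \<and> subgroup C G \<and> C \<subseteq> A \<and> C \<subseteq> B \<and>
    (let A' = G\<lparr>carrier := A\<rparr>; B' = G\<lparr>carrier := B\<rparr>; C' = G\<lparr>carrier := C\<rparr>;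
         \<gamma> = pres_gen (amalgam_gens A' B') (amalgam_rels A' B' C' id id)
     in \<exists>\<phi> \<in> iso (amalgamated_product A' B' C' id id) G.
          (\<forall>a\<in>A. \<phi> (\<gamma> (Inl a)) = a) \<and> (\<forall>b\<in>B. \<phi> (\<gamma> (Inr b)) = b))"

text \<open>Similarly for \<open>G = A *\<^sub>C\<close>: here \<open>C \<subseteq> A\<close> are subgroups of \<open>G\<close>, one of the two embeddings of \<open>C\<close>
  into \<open>A\<close> is the inclusion and the other one is an arbitrary monomorphism \<open>f\<close>.\<close>

definition hnn_decomposition :: "('a, 'm) monoid_scheme \<Rightarrow> 'a set \<Rightarrow> 'a set \<Rightarrow> bool"
  where "hnn_decomposition G A C \<longleftrightarrow>
    subgroup A G \<and> subgroup C G \<and> C \<subseteq> A \<and>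
    (let A' = G\<lparr>carrier := A\<rparr>; C' = G\<lparr>carrier := C\<rparr>
     in \<exists>f \<in> mon C' A'. \<exists>\<phi> \<in> iso (hnn_extension A' C' id f) G.
          \<forall>a\<in>A. \<phi> (pres_gen (hnn_gens A') (hnn_rels A' C' id f) (Some a)) = a)"

definition splits_nontrivially_over :: "('a, 'm) monoid_scheme \<Rightarrow> 'a set \<Rightarrow> bool"
  where "splits_nontrivially_over G C \<longleftrightarrow>
    (\<exists>A B. amalgam_decomposition G A B C \<and> carrier G \<noteq> A \<and> carrier G \<noteq> B) \<or>
    (\<exists>A. hnn_decomposition G A C \<and> carrier G \<noteq> A)"

definition splits_nontrivially_over_Z_power :: "('a, 'm) monoid_scheme \<Rightarrow> nat \<Rightarrow> bool"
  where "splits_nontrivially_over_Z_power G k \<longleftrightarrow>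
    (\<exists>C. subgroup C G \<and> G\<lparr>carrier := C\<rparr> \<cong> product_group {..<k} (\<lambda>_. integer_group) \<and>
         splits_nontrivially_over G C)"

end

theory Submission
  imports Defs
begin

text \<open>The Bass-Serre tree of a splitting of \<open>G\<close> is replaced by its nested system of half-spaces. Let
  \<open>H\<close> be a finite index subgroup of \<open>A\<^sub>\<Gamma>\<close> embedded in \<open>G\<close> with finite index, and \<open>N\<close> an exponent
  with \<open>x\<^sup>N \<in> H\<close> for all \<open>x \<in> A\<^sub>\<Gamma>\<close>. The elements \<open>g v\<^sup>N g\<inverse>\<close> act on the tree for all \<open>g \<in> A\<^sub>\<Gamma>\<close> and
  all vertices \<open>v\<close>.

  If one of them is hyperbolic, then its centralizer acts on its axis by translations, with the
  kernel contained in an edge stabilizer, which has rank at most \<open>k\<close>. This forces the link of \<open>v\<close> to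
  be a clique with at most \<open>k\<close> vertices, and this clique separates \<open>\<Gamma>\<close>.

  If all of them are elliptic, fix an edge \<open>e\<close> and \<open>g\<close>. The vertices \<open>v\<close> such that \<open>g v\<^sup>N g\<inverse>\<close> fixes
  \<open>e\<close> form a clique with at most \<open>k\<close> vertices, which does not separate \<open>\<Gamma>\<close>, and fixed sets of commuting
  elliptic elements are not separated by \<open>e\<close>. Hence the fixed sets of all other \<open>g v\<^sup>N g\<inverse>\<close> lie on
  the same side of \<open>e\<close>, and this side does not depend on \<open>g\<close> because the families for \<open>g\<close> and \<open>g v\<close>
  agree on the star of \<open>v\<close>. So \<open>H\<close> fixes a vertex or an end of the tree. The former
  is impossible as \<open>H\<close> contains hyperbolic elements, and the latter because it makes all \<open>v\<^sup>N\<close> commute.\<close>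

section \<open>Groups\<close>

lemma (in group) hom_nat_pow':
  assumes "\<theta> \<in> hom G K" "group K" "x \<in> carrier G"
  shows "\<theta> (x [^] (n::nat)) = \<theta> x [^]\<^bsub>K\<^esub> n"
  using hom_nat_pow[OF assms(1,3)] assms(2) is_group by simp

text \<open>The maps \<open>\<theta> i\<close> embed \<open>K\<close> in Z^k, so this is a rank
  bound, proved by Gaussian elimination. Passing to the kernel of the last \<open>\<theta>\<close>
  costs at most one element \<open>w\<close> of \<open>F\<close>; the other \<open>s v\<close> are
  corrected by powers of \<open>s w\<close>, which multiplies the remaining diagonal matrix by the
  nonzero factor \<open>\<theta> k (s w)\<close>.\<close>

lemma (in group) diagonal_characters_card_le:
  fixes \<theta> :: "nat \<Rightarrow> 'a \<Rightarrow> int" and \<chi> :: "'v \<Rightarrow> 'a \<Rightarrow> int"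
  assumes "finite F" and "subgroup K G"
    and "\<And>i. i < k \<Longrightarrow> \<theta> i \<in> hom (G\<lparr>carrier := K\<rparr>) integer_group"
    and "\<And>x. x \<in> K \<Longrightarrow> (\<And>i. i < k \<Longrightarrow> \<theta> i x = 0) \<Longrightarrow> x = \<one>"
    and "\<And>v. v \<in> F \<Longrightarrow> \<chi> v \<in> hom (G\<lparr>carrier := K\<rparr>) integer_group"
    and "\<And>v. v \<in> F \<Longrightarrow> s v \<in> K"
    and "\<And>u v. u \<in> F \<Longrightarrow> v \<in> F \<Longrightarrow> \<chi> u (s v) = 0 \<longleftrightarrow> u \<noteq> v"
  shows "card F \<le> k"
  using assms
proof (induction k arbitrary: F K s)
  case 0
  have "F = {}"
  proof (rule ccontr)
    assume "F \<noteq> {}"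
    then obtain v where v: "v \<in> F" by auto
    then have "s v = \<one>" using 0 by auto
    moreover have "\<chi> v \<one> = 0"
      using hom_one[OF 0(5)[OF v]] subgroup.subgroup_is_group[OF 0(2)] is_group by simp
    ultimately show False using 0(7)[OF v v] by simp
  qed
  then show ?case by simp
next
  case (Suc k)
  interpret K: group "G\<lparr>carrier := K\<rparr>"
    by (rule subgroup.subgroup_is_group[OF Suc.prems(2) is_group])
  have mult: "f (x \<otimes> y) = f x + f y"
    if "f \<in> hom (G\<lparr>carrier := K\<rparr>) integer_group" "x \<in> K" "y \<in> K" for f :: "'a \<Rightarrow> int" and x y
    using hom_mult[OF that(1), of x y] that by simp
  have pow: "f (x [^] n) = n * f x"
    if "f \<in> hom (G\<lparr>carrier := K\<rparr>) integer_group" "x \<in> K" for f :: "'a \<Rightarrow> int" and x and n :: int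
    using hom_int_pow[OF that(1) _ K.is_group group_integer_group, of x n] that
      int_pow_consistent[OF Suc.prems(2) that(2)] by simp
  have clos: "x \<otimes> y \<in> K" if "x \<in> K" "y \<in> K" for x y
    using that subgroup.m_closed[OF Suc.prems(2)] by simp
  have clos_pow: "x [^] n \<in> K" if "x \<in> K" for x and n :: int
    using that K.int_pow_closed[of x n] int_pow_consistent[OF Suc.prems(2), of x n] by simp
  let ?K = "{x \<in> K. \<theta> k x = 0}"
  have \<theta>k: "\<theta> k \<in> hom (G\<lparr>carrier := K\<rparr>) integer_group" using Suc.prems(3) by simp
  have sub: "subgroup ?K G"
  proof -
    have 1: "\<theta> k \<one> = 0" using mult[OF \<theta>k, of \<one> \<one>] subgroup.one_closed[OF Suc.prems(2)] by simp
    show ?thesis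
    proof (rule subgroupI)
      show "?K \<subseteq> carrier G" using subgroup.subset[OF Suc.prems(2)] by auto
      show "?K \<noteq> {}" using 1 subgroup.one_closed[OF Suc.prems(2)] by auto
      fix x assume x: "x \<in> ?K"
      then have "x \<in> carrier G" using subgroup.subset[OF Suc.prems(2)] by auto
      moreover have "inv x \<in> K" using x subgroup.m_inv_closed[OF Suc.prems(2)] by auto
      ultimately show "inv x \<in> ?K" using mult[OF \<theta>k, of x "inv x"] x 1 by auto
    next
      fix x y assume "x \<in> ?K" "y \<in> ?K"
      then show "x \<otimes> y \<in> ?K" using mult[OF \<theta>k] clos by auto
    qed
  qed
  have restr: "f \<in> hom (G\<lparr>carrier := ?K\<rparr>) integer_group"
    if "f \<in> hom (G\<lparr>carrier := K\<rparr>) integer_group" for f :: "'a \<Rightarrow> int"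
    using that by (auto simp: hom_def)
  have triv: "x = \<one>" if "x \<in> ?K" "\<And>i. i < k \<Longrightarrow> \<theta> i x = 0" for x
    using Suc.prems(4)[of x] that by (auto simp: less_Suc_eq)
  show ?case
  proof (cases "\<exists>w\<in>F. \<theta> k (s w) \<noteq> 0")
    case False
    then have "card F \<le> k"
      using Suc.prems sub restr triv by (intro Suc.IH[of F ?K s]) auto
    then show ?thesis by simp
  next
    case True
    then obtain w where w: "w \<in> F" "\<theta> k (s w) \<noteq> 0" by auto
    let ?s = "\<lambda>v. s v [^] \<theta> k (s w) \<otimes> s w [^] (- \<theta> k (s v))"
    have val: "f (?s v) = \<theta> k (s w) * f (s v) - \<theta> k (s v) * f (s w)"
      if "f \<in> hom (G\<lparr>carrier := K\<rparr>) integer_group" "v \<in> F" for f :: "'a \<Rightarrow> int" and v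
      using that Suc.prems(6) w clos clos_pow by (simp add: mult pow)
    have "card (F - {w}) \<le> k"
    proof (rule Suc.IH[of "F - {w}" ?K ?s])
      show "?s v \<in> ?K" if "v \<in> F - {w}" for v
        using that val[OF \<theta>k, of v] Suc.prems(6) clos clos_pow w by auto
      show "(\<chi> u (?s v) = 0) = (u \<noteq> v)" if "u \<in> F - {w}" "v \<in> F - {w}" for u v
        using that val[OF Suc.prems(5), of u v] Suc.prems(7)[of u v] Suc.prems(7)[of u w] w by auto
      show "\<theta> i \<in> hom (G\<lparr>carrier := ?K\<rparr>) integer_group" if "i < k" for i
        using that Suc.prems(3)[of i] by (intro restr) simp
      show "\<chi> v \<in> hom (G\<lparr>carrier := ?K\<rparr>) integer_group" if "v \<in> F - {w}" for v
        using that Suc.prems(5)[of v] by (intro restr) simp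
    qed (use Suc.prems(1) sub triv in simp_all)
    then show ?thesis using w(1) Suc.prems(1) by simp
  qed
qed

lemma (in group) commute_inv:
  assumes "x \<in> carrier G" "y \<in> carrier G" "x \<otimes> y = y \<otimes> x"
  shows "inv x \<otimes> y = y \<otimes> inv x"
  using assms by (metis inv_closed inv_solve_left' inv_solve_right' m_assoc m_closed)

lemma (in group) commute_int_pow:
  assumes "x \<in> carrier G" "y \<in> carrier G" "x \<otimes> y = y \<otimes> x"
  shows "x [^] (n::int) \<otimes> y = y \<otimes> x [^] n"
proof (cases n)
  case (nonneg m)
  then show ?thesis using assms group_commutes_pow[of x y m] by (simp add: int_pow_int)
next
  case (neg m)
  then show ?thesis
    using assms commute_inv[of "x [^] Suc m" y] group_commutes_pow[of x y "Suc m"]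
    by (simp add: int_pow_neg_int del: nat_pow_Suc of_nat_Suc)
qed

lemma (in group) conj_nat_pow:
  assumes "g \<in> carrier G" "x \<in> carrier G"
  shows "(g \<otimes> x \<otimes> inv g) [^] (n::nat) = g \<otimes> x [^] n \<otimes> inv g"
proof (induction n)
  case (Suc n)
  have "inv g \<otimes> (g \<otimes> (x \<otimes> inv g)) = x \<otimes> inv g" using assms by (simp add: m_assoc[symmetric])
  then show ?case using assms Suc by (simp add: m_assoc)
qed (use assms in simp)

lemma (in group) conj_commute_iff:
  assumes "g \<in> carrier G" "x \<in> carrier G" "y \<in> carrier G"
  shows "(g \<otimes> x \<otimes> inv g) \<otimes> (g \<otimes> y \<otimes> inv g) = (g \<otimes> y \<otimes> inv g) \<otimes> (g \<otimes> x \<otimes> inv g) \<longleftrightarrow>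
    x \<otimes> y = y \<otimes> x"
proof -
  have "(g \<otimes> x \<otimes> inv g) \<otimes> (g \<otimes> y \<otimes> inv g) = g \<otimes> (x \<otimes> y) \<otimes> inv g"
    if "x \<in> carrier G" "y \<in> carrier G" for x y
  proof -
    have "inv g \<otimes> (g \<otimes> (y \<otimes> inv g)) = y \<otimes> inv g" using assms that by (simp add: m_assoc[symmetric])
    then show ?thesis using assms that by (simp add: m_assoc)
  qed
  then show ?thesis using assms by simp
qed

text \<open>By the pigeonhole principle two of the cosets of \<open>g [^] 0\<close>, ...,
  \<open>g [^] m\<close> agree, where \<open>m\<close> is the index, so \<open>g [^] d\<close> lies
  in \<open>H\<close> for some \<open>d\<close> between 1 and \<open>m\<close>. The factorial of
  \<open>m\<close> is a multiple of every such \<open>d\<close>, hence a common exponent for all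
  \<open>g\<close>.\<close>

lemma (in group) finite_index_power:
  assumes "finite_index_subgroup H G"
  shows "\<exists>N>0. \<forall>g\<in>carrier G. g [^] (N::nat) \<in> H"
proof -
  have H: "subgroup H G" and fin: "finite (rcosets H)"
    using assms by (auto simp: finite_index_subgroup_def)
  let ?m = "card (rcosets H)"
  have "g [^] (fact ?m :: nat) \<in> H" if g: "g \<in> carrier G" for g
  proof -
    let ?f = "\<lambda>i::nat. H #> g [^] i"
    have "?f ` {..?m} \<subseteq> rcosets H"
      using g subgroup.subset[OF H] by (auto intro: rcosetsI)
    then have "card (?f ` {..?m}) \<le> ?m" by (rule card_mono[OF fin])
    then have "\<not> inj_on ?f {..?m}" using card_image by fastforce
    then obtain i j where ij: "i < j" "j \<le> ?m" "?f i = ?f j"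
      unfolding inj_on_def by (metis atMost_iff linorder_neqE_nat)
    have "g [^] j \<in> H #> g [^] i"
      using ij(3) rcos_self[OF _ H, of "g [^] j"] g by simp
    then obtain x where x: "x \<in> H" "g [^] j = x \<otimes> g [^] i" by (auto simp: r_coset_def)
    have "g [^] (j - i) \<otimes> g [^] i = g [^] j" using g ij by (simp add: nat_pow_mult)
    then have "g [^] (j - i) = x"
      using x g subgroup.mem_carrier[OF H x(1)] by (metis nat_pow_closed right_cancel)
    then have d: "g [^] (j - i) \<in> H" using x by simp
    have "(j - i) dvd fact ?m" using ij by (intro dvd_fact) auto
    then obtain l where l: "fact ?m = (j - i) * l" by blast
    have pow: "y [^] n \<in> H" if "y \<in> H" for y and n :: nat
      using that subgroup.one_closed[OF H] subgroup.m_closed[OF H] by (induction n) auto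
    show ?thesis unfolding l using pow[OF d, of l] g by (simp add: nat_pow_pow)
  qed
  moreover have "(0::nat) < fact ?m" by simp
  ultimately show ?thesis by blast
qed

section \<open>Actions on nested half-spaces\<close>

text \<open>A half-space stands for one side of an edge of a tree, and complementation for the
  reversal of the edge. The group acts on half-spaces rather than on points.
  \<open>finite_interval\<close> expresses that only finitely many edges lie between two given
  ones.\<close>

locale halfspace_action = group G for G (structure) +
  fixes V :: "'p set" and HS :: "'p set set" and act :: "'a \<Rightarrow> 'p set \<Rightarrow> 'p set" (infixr \<open>\<odot>\<close> 72)
  assumes subset: "h \<in> HS \<Longrightarrow> h \<subseteq> V"
    and compl: "h \<in> HS \<Longrightarrow> V - h \<in> HS"
    and act_closed: "g \<in> carrier G \<Longrightarrow> h \<in> HS \<Longrightarrow> g \<odot> h \<in> HS"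
    and act_one: "h \<in> HS \<Longrightarrow> \<one> \<odot> h = h"
    and act_mult: "g \<in> carrier G \<Longrightarrow> g' \<in> carrier G \<Longrightarrow> h \<in> HS \<Longrightarrow> (g \<otimes> g') \<odot> h = g \<odot> g' \<odot> h"
    and act_mono: "g \<in> carrier G \<Longrightarrow> h \<in> HS \<Longrightarrow> k \<in> HS \<Longrightarrow> h \<subseteq> k \<Longrightarrow> g \<odot> h \<subseteq> g \<odot> k"
    and act_compl: "g \<in> carrier G \<Longrightarrow> h \<in> HS \<Longrightarrow> g \<odot> (V - h) = V - g \<odot> h"
    and nested: "g \<in> carrier G \<Longrightarrow> h \<in> HS \<Longrightarrow>
      g \<odot> h \<subseteq> h \<or> h \<subseteq> g \<odot> h \<or> g \<odot> h \<subseteq> V - h \<or> V - h \<subseteq> g \<odot> h"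
    and finite_interval: "h \<in> HS \<Longrightarrow> k \<in> HS \<Longrightarrow> finite {l \<in> HS. h \<subseteq> l \<and> l \<subseteq> k}"
    and no_inversion: "g \<in> carrier G \<Longrightarrow> h \<in> HS \<Longrightarrow> g \<odot> h \<noteq> V - h"
begin

lemma compl_compl: "h \<in> HS \<Longrightarrow> V - (V - h) = h"
  using subset by blast

lemma subset_compl_swap: "h \<in> HS \<Longrightarrow> k \<in> HS \<Longrightarrow> h \<subseteq> V - k \<longleftrightarrow> k \<subseteq> V - h"
  using subset by blast

lemma compl_subset_compl: "h \<in> HS \<Longrightarrow> k \<in> HS \<Longrightarrow> V - h \<subseteq> V - k \<longleftrightarrow> k \<subseteq> h"
  using subset by blast

lemma act_inv_act: "g \<in> carrier G \<Longrightarrow> h \<in> HS \<Longrightarrow> inv g \<odot> g \<odot> h = h"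
  by (simp add: act_mult[symmetric] act_one)

lemma act_act_inv: "g \<in> carrier G \<Longrightarrow> h \<in> HS \<Longrightarrow> g \<odot> inv g \<odot> h = h"
  by (simp add: act_mult[symmetric] act_one)

lemma act_subset_iff: "g \<in> carrier G \<Longrightarrow> h \<in> HS \<Longrightarrow> k \<in> HS \<Longrightarrow> g \<odot> h \<subseteq> g \<odot> k \<longleftrightarrow> h \<subseteq> k"
  by (metis act_closed act_inv_act act_mono inv_closed)

lemma act_eq_iff: "g \<in> carrier G \<Longrightarrow> h \<in> HS \<Longrightarrow> k \<in> HS \<Longrightarrow> g \<odot> h = g \<odot> k \<longleftrightarrow> h = k"
  by (metis act_inv_act)

lemma act_psubset_iff: "g \<in> carrier G \<Longrightarrow> h \<in> HS \<Longrightarrow> k \<in> HS \<Longrightarrow> g \<odot> h \<subset> g \<odot> k \<longleftrightarrow> h \<subset> k"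
  by (metis act_subset_iff act_eq_iff psubset_eq)

lemma act_inv_subset: "g \<in> carrier G \<Longrightarrow> h \<in> HS \<Longrightarrow> k \<in> HS \<Longrightarrow> inv g \<odot> h \<subseteq> k \<longleftrightarrow> h \<subseteq> g \<odot> k"
  by (metis act_closed act_act_inv act_subset_iff inv_closed)

lemma act_inv_psubset:
  "g \<in> carrier G \<Longrightarrow> h \<in> HS \<Longrightarrow> k \<in> HS \<Longrightarrow> inv g \<odot> h \<subset> k \<longleftrightarrow> h \<subset> g \<odot> k"
  by (metis act_act_inv act_closed act_psubset_iff inv_closed)

lemma subset_act_inv: "g \<in> carrier G \<Longrightarrow> h \<in> HS \<Longrightarrow> k \<in> HS \<Longrightarrow> h \<subseteq> inv g \<odot> k \<longleftrightarrow> g \<odot> h \<subseteq> k"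
  by (metis act_closed act_act_inv act_subset_iff inv_closed)

definition stab :: "'p set \<Rightarrow> 'a set"
  where "stab h = {g \<in> carrier G. g \<odot> h = h}"

lemma subgroup_stab: "h \<in> HS \<Longrightarrow> subgroup (stab h) G"
proof (rule subgroupI)
  assume h: "h \<in> HS"
  show "stab h \<noteq> {}" using h act_one by (auto simp: stab_def)
  show "inv g \<in> stab h" if "g \<in> stab h" for g
    using that h act_inv_act[of g h] by (auto simp: stab_def)
  show "g \<otimes> g' \<in> stab h" if "g \<in> stab h" "g' \<in> stab h" for g g'
    using that h by (auto simp: stab_def act_mult)
qed (auto simp: stab_def)

section \<open>Hyperbolic elements and their centralizers\<close>

lemma pow_strict_antimono:
  assumes "x \<in> carrier G" "h \<in> HS" "x \<odot> h \<subset> h" "m < (n::nat)"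
  shows "x [^] n \<odot> h \<subset> x [^] m \<odot> h"
  using \<open>m < n\<close>
proof (induction rule: strict_inc_induct)
  case (base i)
  then show ?case
    using act_psubset_iff[of "x [^] i" "x \<odot> h" h] assms by (simp add: act_mult act_closed)
next
  case (step i)
  moreover have "x [^] Suc i \<odot> h \<subset> x [^] i \<odot> h"
    using act_psubset_iff[of "x [^] i" "x \<odot> h" h] assms by (simp add: act_mult act_closed)
  ultimately show ?case by simp
qed

lemma pow_antimono:
  assumes "x \<in> carrier G" "h \<in> HS" "x \<odot> h \<subset> h" "m \<le> (n::nat)"
  shows "x [^] n \<odot> h \<subseteq> x [^] m \<odot> h"
  using pow_strict_antimono[OF assms(1-3), of m n] assms(4)
  by (metis nless_le order_refl psubset_imp_subset)

text \<open>Otherwise the infinitely many different translates \<open>x [^] n \<odot> h\<close>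
  would all lie in the interval from \<open>k\<close> to \<open>h\<close>.\<close>

lemma descending_escapes:
  assumes x: "x \<in> carrier G" "h \<in> HS" "x \<odot> h \<subset> h" and k: "k \<in> HS"
  shows "\<exists>n::nat. \<not> k \<subseteq> x [^] n \<odot> h"
proof (rule ccontr)
  assume "\<not> ?thesis"
  then have "k \<subseteq> x [^] n \<odot> h" for n :: nat by simp
  then have "range (\<lambda>n::nat. x [^] n \<odot> h) \<subseteq> {l \<in> HS. k \<subseteq> l \<and> l \<subseteq> h}"
    using pow_antimono[OF x, of 0] x by (auto simp: act_one act_closed)
  moreover have "inj (\<lambda>n::nat. x [^] n \<odot> h)"
    by (rule linorder_injI) (use pow_strict_antimono[OF x] in blast)
  ultimately show False
    using finite_interval[OF k x(2)] finite_subset range_inj_infinite by blast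
qed

text \<open>Dual to \<open>descending_escapes\<close>, because the complement of \<open>h\<close>
  descends under \<open>x\<close>.\<close>

lemma ascending_escapes:
  assumes x: "x \<in> carrier G" "h \<in> HS" "h \<subset> x \<odot> h" and k: "k \<in> HS"
  shows "\<exists>n::nat. \<not> x [^] n \<odot> h \<subseteq> k"
proof -
  have "x \<odot> (V - h) \<subset> V - h"
    using x subset[OF x(2)] subset[OF act_closed[OF x(1,2)]] by (auto simp: act_compl)
  then obtain n :: nat where "\<not> V - k \<subseteq> x [^] n \<odot> (V - h)"
    using descending_escapes[OF x(1) compl[OF x(2)] _ compl[OF k]] by auto
  then show ?thesis
    using x k by (metis act_closed act_compl compl_subset_compl nat_pow_closed)
qed

text \<open>An element \<open>x\<close> with \<open>x \<odot> h \<subset> h\<close> is hyperbolic with \<open>h\<close> crossing its axis; its centralizer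
  preserves the axis with its direction.\<close>

lemma hyperbolic_centralizer_comparable:
  assumes x: "x \<in> carrier G" "h \<in> HS" "x \<odot> h \<subset> h" and y: "y \<in> carrier G" "x \<otimes> y = y \<otimes> x"
  shows "y \<odot> h \<subseteq> h \<or> h \<subseteq> y \<odot> h"
proof -
  have yh: "y \<odot> h \<in> HS" using x y by (simp add: act_closed)
  consider "y \<odot> h \<subseteq> h" | "h \<subseteq> y \<odot> h" | "y \<odot> h \<subseteq> V - h" | "V - h \<subseteq> y \<odot> h"
    using nested[OF y(1) x(2)] by auto
  then show ?thesis
  proof cases
    case 3
    \<comment> \<open>As \<open>y\<close> commutes with the powers of \<open>x\<close>, every member
      of the growing chain \<open>inv x [^] n \<odot> h\<close> would stay disjoint from
      \<open>y \<odot> h\<close>.\<close>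
    have inc: "h \<subset> inv x \<odot> h"
      using x by (metis act_inv_act act_psubset_iff act_closed inv_closed)
    have "inv x [^] n \<odot> h \<subseteq> V - y \<odot> h" for n :: nat
    proof -
      let ?w = "inv x [^] n"
      have w: "?w \<in> carrier G" "?w \<otimes> y = y \<otimes> ?w"
        using x y commute_inv group_commutes_pow by auto
      have "h \<subseteq> ?w \<odot> h"
      proof (induction n)
        case 0 show ?case using x by (simp add: act_one)
      next
        case (Suc n)
        have "inv x [^] n \<odot> h \<subseteq> inv x [^] n \<odot> inv x \<odot> h"
          using inc x by (intro act_mono) (auto simp: act_closed)
        then show ?case using Suc x by (simp add: act_mult)
      qed
      then have "y \<odot> h \<subseteq> y \<odot> ?w \<odot> h" using x y w by (intro act_mono) (auto simp: act_closed)
      also have "\<dots> = ?w \<odot> y \<odot> h" using x y w by (metis act_mult)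
      also have "\<dots> \<subseteq> ?w \<odot> (V - h)" using 3 x y w yh by (intro act_mono compl) auto
      also have "\<dots> = V - ?w \<odot> h" using x w by (simp add: act_compl)
      finally show ?thesis using yh x w by (metis act_closed subset_compl_swap)
    qed
    then show ?thesis
      using ascending_escapes[OF _ x(2) inc compl[OF yh]] x by auto
  next
    case 4
    \<comment> \<open>Dually, every member of the shrinking chain \<open>x [^] n \<odot> h\<close>
      would contain the complement of \<open>y \<odot> h\<close>.\<close>
    have "V - y \<odot> h \<subseteq> x [^] n \<odot> h" for n :: nat
    proof -
      let ?w = "x [^] n"
      have w: "?w \<in> carrier G" "?w \<otimes> y = y \<otimes> ?w"
        using x y by (auto intro!: group_commutes_pow)
      have "V - ?w \<odot> h = ?w \<odot> (V - h)" using x w by (simp add: act_compl)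
      also have "\<dots> \<subseteq> ?w \<odot> y \<odot> h" using 4 x y w yh by (intro act_mono compl) auto
      also have "\<dots> = y \<odot> ?w \<odot> h" using x y w by (metis act_mult)
      also have "\<dots> \<subseteq> y \<odot> h"
        using pow_antimono[OF x, of 0 n] x y w by (intro act_mono) (auto simp: act_closed act_one)
      finally show ?thesis using subset[OF yh] subset[OF x(2)] by blast
    qed
    then show ?thesis
      using descending_escapes[OF x compl[OF yh]] by auto
  qed auto
qed

text \<open>\<open>y\<close> translates along the axis of \<open>x\<close>, and the half-spaces from
  \<open>x \<odot> h\<close> to \<open>h\<close> make up one period of this axis. The exponent is
  found in two steps: a large power of \<open>x\<close> pushes \<open>y \<odot> h\<close> into
  \<open>h\<close>, and then as many factors \<open>x\<close> as possible are taken back.\<close>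

lemma hyperbolic_centralizer_shift:
  assumes x: "x \<in> carrier G" "h \<in> HS" "x \<odot> h \<subset> h" and y: "y \<in> carrier G" "x \<otimes> y = y \<otimes> x"
  shows "\<exists>a::int. x \<odot> h \<subseteq> (x [^] a \<otimes> y) \<odot> h \<and> (x [^] a \<otimes> y) \<odot> h \<subseteq> h"
proof -
  have comm: "x \<otimes> (x [^] (a::int) \<otimes> y) = (x [^] a \<otimes> y) \<otimes> x" for a
  proof -
    have "x \<otimes> (x [^] a \<otimes> y) = x [^] a \<otimes> (x \<otimes> y)"
      using x y(1) commute_int_pow[of x x a] by (simp add: m_assoc[symmetric])
    then show ?thesis using x y by (simp add: m_assoc)
  qed
  have cmp: "(x [^] (a::int) \<otimes> y) \<odot> h \<subseteq> h \<or> h \<subseteq> (x [^] a \<otimes> y) \<odot> h" for a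
    using hyperbolic_centralizer_comparable[OF x _ comm] x y by simp
  obtain n :: nat where "\<not> inv y \<odot> h \<subseteq> x [^] n \<odot> h"
    using descending_escapes[OF x, of "inv y \<odot> h"] x y by (auto simp: act_closed)
  then have "\<not> h \<subseteq> (y \<otimes> x [^] n) \<odot> h"
    using x y by (simp add: act_mult act_inv_subset act_closed)
  moreover have "y \<otimes> x [^] n = x [^] (int n) \<otimes> y"
    using group_commutes_pow[OF y(2) x(1) y(1), of n] by (simp add: int_pow_int)
  ultimately have n: "(x [^] (int n) \<otimes> y) \<odot> h \<subseteq> h" using cmp[of "int n"] by auto
  let ?y = "x [^] (int n) \<otimes> y"
  have y': "?y \<in> carrier G" using x y by auto
  have ex: "\<exists>m::nat. \<not> ?y \<odot> h \<subseteq> x [^] m \<odot> h"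
    using descending_escapes[OF x, of "?y \<odot> h"] x y by (auto simp: act_closed)
  \<comment> \<open>\<open>m\<close> is the first depth that is not reached. Its predecessor
    \<open>l\<close> gives the upper inclusion, and failure at \<open>m\<close> gives the lower one
    by comparability.\<close>
  define m where "m = (LEAST m::nat. \<not> ?y \<odot> h \<subseteq> x [^] m \<odot> h)"
  have m: "\<not> ?y \<odot> h \<subseteq> x [^] m \<odot> h" unfolding m_def by (rule LeastI_ex[OF ex])
  have "m \<noteq> 0" using m n x by (auto simp: act_one)
  then obtain l where l: "m = Suc l" by (cases m) auto
  then have le: "?y \<odot> h \<subseteq> x [^] l \<odot> h"
    using not_less_Least[of l "\<lambda>m. \<not> ?y \<odot> h \<subseteq> x [^] m \<odot> h"] unfolding m_def[symmetric] by auto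
  have shift: "(x [^] (int n - int j) \<otimes> y) \<odot> h = inv (x [^] j) \<odot> ?y \<odot> h" for j :: nat
  proof -
    have "x [^] (int n - int j) = inv (x [^] j) \<otimes> x [^] (int n)"
      using int_pow_mult[OF x(1), of "- int j" "int n"] x(1) by (simp add: int_pow_neg_int)
    then show ?thesis using x y y' by (simp add: act_mult m_assoc act_closed)
  qed
  have "(x [^] (int n - int l) \<otimes> y) \<odot> h \<subseteq> h"
    using le x y by (simp add: shift act_inv_subset act_closed)
  moreover have "h \<subseteq> (x [^] (int n - int m) \<otimes> y) \<odot> h"
    using cmp[of "int n - int m"] m x y by (auto simp: shift act_inv_subset act_closed)
  then have "x [^] m \<odot> h \<subseteq> ?y \<odot> h"
    using x y by (simp add: shift subset_act_inv act_closed)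
  then have "x \<odot> h \<subseteq> (x [^] (int n - int l) \<otimes> y) \<odot> h"
    using x y l by (simp add: shift subset_act_inv act_closed act_mult)
  ultimately show ?thesis by blast
qed

text \<open>Each power of \<open>y\<close> is brought by a power of \<open>x\<close> into the finite
  interval from \<open>x \<odot> h\<close> to \<open>h\<close>. Two of the resulting half-spaces
  agree, and the quotient of the two elements fixes \<open>h\<close>.\<close>

lemma hyperbolic_centralizer_stab:
  assumes x: "x \<in> carrier G" "h \<in> HS" "x \<odot> h \<subset> h" and y: "y \<in> carrier G" "x \<otimes> y = y \<otimes> x"
  shows "\<exists>(a::int) (c::nat). 0 < c \<and> x [^] a \<otimes> y [^] c \<in> stab h"
proof -
  have "\<exists>a::int. x \<odot> h \<subseteq> (x [^] a \<otimes> y [^] j) \<odot> h \<and> (x [^] a \<otimes> y [^] j) \<odot> h \<subseteq> h" for j :: nat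
    using x y group_commutes_pow[OF y(2)[symmetric] y(1) x(1), of j]
    by (intro hyperbolic_centralizer_shift) auto
  then obtain a :: "nat \<Rightarrow> int" where
    a: "\<And>j. x \<odot> h \<subseteq> (x [^] a j \<otimes> y [^] j) \<odot> h \<and> (x [^] a j \<otimes> y [^] j) \<odot> h \<subseteq> h" by metis
  let ?f = "\<lambda>j. (x [^] a j \<otimes> y [^] j) \<odot> h"
  have "range ?f \<subseteq> {l \<in> HS. x \<odot> h \<subseteq> l \<and> l \<subseteq> h}"
    using a x y by (auto simp: act_closed)
  then have "finite (range ?f)"
    using finite_interval[OF act_closed[OF x(1,2)] x(2)] finite_subset by blast
  then have "\<not> inj ?f" using range_inj_infinite by blast
  then obtain i j where ij: "i < j" "?f i = ?f j" using linorder_injI[of ?f] by blast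
  have split: "x [^] a j \<otimes> y [^] j = (x [^] a i \<otimes> y [^] i) \<otimes> (x [^] (a j - a i) \<otimes> y [^] (j - i))"
  proof -
    have yx: "y [^] i \<otimes> x [^] b = x [^] b \<otimes> y [^] i" for b :: int
      using x y commute_int_pow[of x "y [^] i" b] group_commutes_pow[OF y(2)[symmetric] y(1) x(1), of i]
      by simp
    have "(x [^] a i \<otimes> y [^] i) \<otimes> (x [^] (a j - a i) \<otimes> y [^] (j - i)) =
      x [^] a i \<otimes> (y [^] i \<otimes> x [^] (a j - a i)) \<otimes> y [^] (j - i)"
      using x y by (simp add: m_assoc)
    also have "\<dots> = x [^] a i \<otimes> (x [^] (a j - a i) \<otimes> y [^] i) \<otimes> y [^] (j - i)" by (simp only: yx)
    also have "\<dots> = (x [^] a i \<otimes> x [^] (a j - a i)) \<otimes> (y [^] i \<otimes> y [^] (j - i))"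
      using x y by (simp add: m_assoc)
    also have "\<dots> = x [^] a j \<otimes> y [^] j"
      using int_pow_mult[OF x(1), of "a i" "a j - a i"] nat_pow_mult[OF y(1), of i "j - i"] ij by simp
    finally show ?thesis by simp
  qed
  let ?z = "x [^] (a j - a i) \<otimes> y [^] (j - i)"
  have "(x [^] a i \<otimes> y [^] i) \<odot> ?z \<odot> h = (x [^] a i \<otimes> y [^] i) \<odot> h"
    using ij(2) split x y by (simp add: act_mult)
  then have "?z \<odot> h = h"
    using x y by (subst (asm) act_eq_iff) (auto simp: act_closed)
  then show ?thesis
    using ij x y by (intro exI[of _ "a j - a i"] exI[of _ "j - i"]) (auto simp: stab_def)
qed

section \<open>Elliptic elements and the position of their fixed trees\<close>

text \<open>For an elliptic \<open>x\<close> this says that the fixed subtree of \<open>x\<close> lies outside of \<open>h\<close>.\<close>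

definition out :: "'a \<Rightarrow> 'p set \<Rightarrow> bool"
  where "out x h \<longleftrightarrow> x \<odot> h \<subseteq> V - h"

lemma out_mono:
  assumes "x \<in> carrier G" "h \<in> HS" "k \<in> HS" "k \<subseteq> h" "out x h"
  shows "out x k"
  using act_mono[OF assms(1,3,2,4)] assms unfolding out_def by blast

lemma out_act:
  assumes "g \<in> carrier G" "x \<in> carrier G" "h \<in> HS" "out x h"
  shows "out (g \<otimes> x \<otimes> inv g) (g \<odot> h)"
proof -
  have "(g \<otimes> x \<otimes> inv g) \<odot> g \<odot> h = g \<odot> x \<odot> h"
    using assms by (simp add: act_mult act_inv_act act_closed)
  also have "\<dots> \<subseteq> g \<odot> (V - h)"
    using assms unfolding out_def by (intro act_mono) (auto simp: act_closed compl)
  finally show ?thesis unfolding out_def using assms by (simp add: act_compl)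
qed

text \<open>If the edge separated the two fixed trees, then \<open>h \<subseteq> x \<odot> y \<odot>
  h = y \<odot> x \<odot> h \<subseteq> y \<odot> (V - h) \<subseteq> h\<close>, so \<open>y\<close>
  would invert the edge.\<close>

lemma not_out_compl_of_commute:
  assumes "x \<in> carrier G" "y \<in> carrier G" "x \<otimes> y = y \<otimes> x" "h \<in> HS" "out x h"
  shows "\<not> out y (V - h)"
proof
  assume "out y (V - h)"
  then have y: "V - h \<subseteq> y \<odot> h"
    using assms subset[OF assms(4)] subset[OF act_closed[OF assms(2,4)]]
    by (auto simp: out_def act_compl)
  have x: "x \<odot> h \<subseteq> V - h" using assms by (simp add: out_def)
  have mem: "x \<odot> h \<in> HS" "y \<odot> h \<in> HS" "x \<odot> y \<odot> h \<in> HS" "V - h \<in> HS"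
    using assms by (auto simp: act_closed compl)
  have "h \<subseteq> V - x \<odot> h" using x mem assms subset_compl_swap by blast
  also have "\<dots> = x \<odot> (V - h)" using assms by (simp add: act_compl)
  also have "\<dots> \<subseteq> x \<odot> y \<odot> h" using y assms mem by (intro act_mono) auto
  also have "\<dots> = y \<odot> x \<odot> h" using assms by (metis act_mult)
  finally have "h \<subseteq> y \<odot> x \<odot> h" .
  moreover have "y \<odot> x \<odot> h \<subseteq> y \<odot> (V - h)" using x assms mem by (intro act_mono) auto
  moreover have "y \<odot> (V - h) \<subseteq> h"
    using y assms subset[OF assms(4)] by (auto simp: act_compl)
  ultimately have "y \<odot> (V - h) = h" by blast
  then show False
    using no_inversion[OF assms(2) compl[OF assms(4)]] compl_compl assms by auto
qed

text \<open>Ellipticity, applied to \<open>h\<close> and to \<open>V - h\<close>, turns an inclusion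
  between \<open>h\<close> and \<open>x \<odot> h\<close> into an equality. The other two cases of
  \<open>nested\<close> are the two alternatives with \<open>out\<close>.\<close>

lemma elliptic_trichotomy:
  assumes "x \<in> carrier G" "h \<in> HS" and ell: "\<And>h. h \<in> HS \<Longrightarrow> \<not> x \<odot> h \<subset> h"
  shows "x \<odot> h = h \<or> out x h \<or> out x (V - h)"
proof -
  have xh: "x \<odot> h \<in> HS" using assms by (simp add: act_closed)
  consider "x \<odot> h \<subseteq> h" | "h \<subseteq> x \<odot> h" | "x \<odot> h \<subseteq> V - h" | "V - h \<subseteq> x \<odot> h"
    using nested[OF assms(1,2)] by auto
  then show ?thesis
  proof cases
    case 1 then show ?thesis using ell[OF assms(2)] by auto
  next
    case 2
    then have "V - x \<odot> h \<subseteq> V - h" by auto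
    then have "V - x \<odot> h = V - h"
      using ell[OF compl[OF assms(2)]] assms by (auto simp: act_compl)
    then show ?thesis using compl_compl[OF xh] compl_compl[OF assms(2)] by auto
  next
    case 3 then show ?thesis by (simp add: out_def)
  next
    case 4
    then have "V - x \<odot> h \<subseteq> V - (V - h)" by auto
    then show ?thesis using assms by (simp add: out_def act_compl)
  qed
qed

end

text \<open>An encoding of a Bass-Serre tree with a single orbit of edges. The vertices are the
  classes of points generated by the links \<open>L\<close>; the edge of \<open>g\<close> joins the
  translates of \<open>p\<^sub>0\<close> and \<open>q\<^sub>0\<close>, and edges are counted by the
  cosets \<open>g C\<close>. \<open>connected\<close> makes the graph connected, and
  \<open>S\<close>, which is crossed by the edge of the coset \<open>C\<close> alone, makes this
  edge and all its translates separating.\<close>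

locale edge_cut = group G for G (structure) +
  fixes V :: "'p set" and mv :: "'a \<Rightarrow> 'p \<Rightarrow> 'p" and L :: "'p rel" and p\<^sub>0 q\<^sub>0 :: 'p
    and C :: "'a set" and S :: "'p set"
  assumes mv_closed: "g \<in> carrier G \<Longrightarrow> p \<in> V \<Longrightarrow> mv g p \<in> V"
    and mv_one: "p \<in> V \<Longrightarrow> mv \<one> p = p"
    and mv_mult: "g \<in> carrier G \<Longrightarrow> g' \<in> carrier G \<Longrightarrow> p \<in> V \<Longrightarrow> mv (g \<otimes> g') p = mv g (mv g' p)"
    and link_V: "(p, q) \<in> L \<Longrightarrow> p \<in> V \<and> q \<in> V"
    and link_mv: "g \<in> carrier G \<Longrightarrow> (p, q) \<in> L \<Longrightarrow> (mv g p, mv g q) \<in> L"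
    and base: "p\<^sub>0 \<in> V" "q\<^sub>0 \<in> V"
    and C: "subgroup C G"
    and C_link: "c \<in> C \<Longrightarrow> (p\<^sub>0, mv c p\<^sub>0) \<in> L"
    and connected: "D \<subseteq> V \<Longrightarrow> p \<in> D \<Longrightarrow> (\<And>p q. (p, q) \<in> L \<Longrightarrow> p \<in> D \<longleftrightarrow> q \<in> D) \<Longrightarrow>
      (\<And>g. g \<in> carrier G \<Longrightarrow> mv g p\<^sub>0 \<in> D \<longleftrightarrow> mv g q\<^sub>0 \<in> D) \<Longrightarrow> D = V"
    and S: "S \<subseteq> V"
    and link_S: "(p, q) \<in> L \<Longrightarrow> p \<in> S \<longleftrightarrow> q \<in> S"
    and edge_S: "g \<in> carrier G \<Longrightarrow> (mv g p\<^sub>0 \<in> S \<longleftrightarrow> mv g q\<^sub>0 \<in> S) \<longleftrightarrow> g \<notin> C"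
begin

text \<open>These are the half-spaces bounded by the edge of the coset \<open>x C\<close>.\<close>

definition side :: "'a \<Rightarrow> 'p set \<Rightarrow> bool"
  where "side x Y \<longleftrightarrow> Y \<subseteq> V \<and> (\<forall>p q. (p, q) \<in> L \<longrightarrow> (p \<in> Y \<longleftrightarrow> q \<in> Y)) \<and>
    (\<forall>g\<in>carrier G. (mv g p\<^sub>0 \<in> Y \<longleftrightarrow> mv g q\<^sub>0 \<in> Y) \<longleftrightarrow> inv x \<otimes> g \<notin> C)"

definition sides :: "'p set set"
  where "sides = {Y. \<exists>x\<in>carrier G. side x Y}"

lemma sideD:
  assumes "side x Y"
  shows "Y \<subseteq> V" and "(p, q) \<in> L \<Longrightarrow> p \<in> Y \<longleftrightarrow> q \<in> Y"
    and "g \<in> carrier G \<Longrightarrow> (mv g p\<^sub>0 \<in> Y \<longleftrightarrow> mv g q\<^sub>0 \<in> Y) \<longleftrightarrow> inv x \<otimes> g \<notin> C"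
  using assms unfolding side_def by auto

lemma mv_inv: "g \<in> carrier G \<Longrightarrow> p \<in> V \<Longrightarrow> mv (inv g) (mv g p) = p"
  "g \<in> carrier G \<Longrightarrow> p \<in> V \<Longrightarrow> mv g (mv (inv g) p) = p"
  by (simp_all add: mv_mult[symmetric] mv_one)

lemma mem_image_mv:
  assumes "g \<in> carrier G" "Y \<subseteq> V" "p \<in> V"
  shows "p \<in> mv g ` Y \<longleftrightarrow> mv (inv g) p \<in> Y"
proof
  assume "p \<in> mv g ` Y"
  then show "mv (inv g) p \<in> Y" using assms mv_inv(1) by auto
next
  assume "mv (inv g) p \<in> Y"
  then show "p \<in> mv g ` Y" using assms mv_inv(2)[of g p] by (metis image_eqI)
qed

lemma image_mv_subset: "g \<in> carrier G \<Longrightarrow> Y \<subseteq> V \<Longrightarrow> mv g ` Y \<subseteq> V"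
  using mv_closed by auto

lemma side_S: "side \<one> S"
  using S link_S edge_S by (auto simp: side_def)

lemma side_compl: "side x Y \<Longrightarrow> side x (V - Y)"
  using link_V mv_closed base unfolding side_def by (auto; blast)

lemma side_mv:
  assumes "g \<in> carrier G" "x \<in> carrier G" "side x Y"
  shows "side (g \<otimes> x) (mv g ` Y)"
proof -
  note Y = sideD[OF assms(3)]
  show ?thesis unfolding side_def
  proof (intro conjI allI impI ballI)
    show "mv g ` Y \<subseteq> V" by (rule image_mv_subset[OF assms(1) Y(1)])
  next
    fix p q assume pq: "(p, q) \<in> L"
    then have "(mv (inv g) p, mv (inv g) q) \<in> L" using assms by (intro link_mv) auto
    then show "p \<in> mv g ` Y \<longleftrightarrow> q \<in> mv g ` Y"
      using link_V[OF pq] Y(1) assms(1) Y(2) by (simp add: mem_image_mv)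
  next
    fix k assume k: "k \<in> carrier G"
    have "inv (g \<otimes> x) \<otimes> k = inv x \<otimes> (inv g \<otimes> k)"
      using assms k by (simp add: inv_mult_group m_assoc)
    then show "(mv k p\<^sub>0 \<in> mv g ` Y \<longleftrightarrow> mv k q\<^sub>0 \<in> mv g ` Y) \<longleftrightarrow> inv (g \<otimes> x) \<otimes> k \<notin> C"
      using Y(3)[of "inv g \<otimes> k"] Y(1) assms k base by (simp add: mem_image_mv mv_closed mv_mult)
  qed
qed

lemma coset_cong:
  assumes "x \<in> carrier G" "y \<in> carrier G" "inv x \<otimes> y \<in> C" "g \<in> carrier G"
  shows "inv x \<otimes> g \<in> C \<longleftrightarrow> inv y \<otimes> g \<in> C"
proof -
  have 1: "inv x \<otimes> g = (inv x \<otimes> y) \<otimes> (inv y \<otimes> g)"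
    using assms by (metis inv_closed m_assoc m_closed r_inv r_one)
  have 2: "inv y \<otimes> g = inv (inv x \<otimes> y) \<otimes> (inv x \<otimes> g)"
    using assms by (metis 1 inv_closed inv_solve_left m_closed)
  show ?thesis
    using 1 2 assms(3) subgroup.m_closed[OF C] subgroup.m_inv_closed[OF C] by metis
qed

lemma side_cong:
  assumes "x \<in> carrier G" "y \<in> carrier G" "inv x \<otimes> y \<in> C" "side y Y"
  shows "side x Y"
  using assms(4) coset_cong[OF assms(1-3)] unfolding side_def by blast

text \<open>No link and no edge leads out of the symmetric difference of \<open>Y\<close> and
  \<open>Z\<close>, as each edge crosses both or neither. So the difference is empty or
  everything.\<close>

lemma side_unique:
  assumes "x \<in> carrier G" "side x Y" "side x Z"
  shows "Z = Y \<or> Z = V - Y"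
proof -
  let ?D = "(Y - Z) \<union> (Z - Y)"
  note Y = sideD[OF assms(2)] and Z = sideD[OF assms(3)]
  have "?D = V" if "p \<in> ?D" for p
  proof (rule connected[OF _ that])
    show "?D \<subseteq> V" using Y(1) Z(1) by auto
    show "(p \<in> ?D) = (q \<in> ?D)" if "(p, q) \<in> L" for p q
      using Y(2)[OF that] Z(2)[OF that] by auto
    show "(mv g p\<^sub>0 \<in> ?D) = (mv g q\<^sub>0 \<in> ?D)" if "g \<in> carrier G" for g
      using Y(3)[OF that] Z(3)[OF that] by blast
  qed
  then show ?thesis using Y(1) Z(1) by blast
qed

text \<open>The quadrant cut out by two different edges that contains neither of them is empty, because
  no link and no edge leads out of it.\<close>

lemma quadrant_empty:
  assumes x: "x \<in> carrier G" "side x Y" "mv x p\<^sub>0 \<notin> Z"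
    and y: "y \<in> carrier G" "side y Z" "mv y p\<^sub>0 \<notin> Y"
    and xy: "inv x \<otimes> y \<notin> C"
  shows "Y \<inter> Z = {}"
proof (rule ccontr)
  note Y = sideD[OF x(2)] and Z = sideD[OF y(2)]
  \<comment> \<open>The points \<open>mv g p\<^sub>0\<close> with \<open>g\<close> in
    \<open>z C\<close> are all linked to \<open>mv z p\<^sub>0\<close>, so they lie outside of
    \<open>Z'\<close>; since \<open>z C\<close> is not the bounding edge of \<open>Z'\<close>, the
    other endpoints lie outside as well.\<close>
  have far: "mv g p\<^sub>0 \<notin> Z'" "mv g q\<^sub>0 \<notin> Z'"
    if "z \<in> carrier G" "w \<in> carrier G" "side w Z'" "mv z p\<^sub>0 \<notin> Z'" "inv w \<otimes> z \<notin> C"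
      "g \<in> carrier G" "inv z \<otimes> g \<in> C" for g z w Z'
  proof -
    have "(mv z p\<^sub>0, mv z (mv (inv z \<otimes> g) p\<^sub>0)) \<in> L"
      using that by (intro link_mv C_link)
    moreover have "mv z (mv (inv z \<otimes> g) p\<^sub>0) = mv g p\<^sub>0"
      using that base by (simp add: mv_mult mv_inv mv_closed)
    ultimately show p: "mv g p\<^sub>0 \<notin> Z'" using sideD(2)[OF that(3)] that(4) by metis
    have "inv w \<otimes> g \<notin> C"
    proof
      assume "inv w \<otimes> g \<in> C"
      then have "inv g \<otimes> z \<in> C \<longleftrightarrow> inv w \<otimes> z \<in> C"
        using coset_cong[of w g z] that by auto
      moreover have "inv g \<otimes> z \<in> C"
        using subgroup.m_inv_closed[OF C that(7)] that by (simp add: inv_mult_group)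
      ultimately show False using that(5) by simp
    qed
    then show "mv g q\<^sub>0 \<notin> Z'" using sideD(3)[OF that(3), of g] that(6) p by auto
  qed
  have yx: "inv y \<otimes> x \<notin> C"
    using xy subgroup.m_inv_closed[OF C, of "inv y \<otimes> x"] x y by (auto simp: inv_mult_group)
  assume "Y \<inter> Z \<noteq> {}"
  then obtain p where p: "p \<in> Y \<inter> Z" by auto
  have "Y \<inter> Z = V"
  proof (rule connected[OF _ p])
    show "Y \<inter> Z \<subseteq> V" using Y(1) by auto
    show "(p \<in> Y \<inter> Z) = (q \<in> Y \<inter> Z)" if "(p, q) \<in> L" for p q
      using Y(2)[OF that] Z(2)[OF that] by auto
    \<comment> \<open>Only edges of \<open>x C\<close> cross \<open>Y\<close> and only edges of
      \<open>y C\<close> cross \<open>Z\<close>. By \<open>far\<close> the former miss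
      \<open>Z\<close> and the latter miss \<open>Y\<close>.\<close>
    show "(mv g p\<^sub>0 \<in> Y \<inter> Z) = (mv g q\<^sub>0 \<in> Y \<inter> Z)" if g: "g \<in> carrier G" for g
    proof (cases "inv x \<otimes> g \<in> C")
      case True
      then show ?thesis using far[OF x(1) y(1,2) x(3) yx g] by auto
    next
      case False
      show ?thesis
      proof (cases "inv y \<otimes> g \<in> C")
        case True
        then show ?thesis using far[OF y(1) x(1,2) y(3) xy g] by auto
      qed (use False Y(3)[OF g] Z(3)[OF g] in auto)
    qed
  qed
  then show False using x base mv_closed by blast
qed

text \<open>Each of two different edges has a side that does not contain the other edge, and these
  two sides are disjoint by \<open>quadrant_empty\<close>. For the same edge the sides agree up to
  complement.\<close>

lemma sides_nested:
  assumes "x \<in> carrier G" "side x Y" "y \<in> carrier G" "side y Z"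
  shows "Z \<subseteq> Y \<or> Y \<subseteq> Z \<or> Z \<subseteq> V - Y \<or> V - Y \<subseteq> Z"
proof (cases "inv x \<otimes> y \<in> C")
  case True
  then show ?thesis using side_unique[OF assms(1,2)] side_cong[OF assms(1,3) _ assms(4)] by blast
next
  case False
  note Q = quadrant_empty[OF assms(1) _ _ assms(3) _ _ False]
  have V: "mv x p\<^sub>0 \<in> V" "mv y p\<^sub>0 \<in> V" using assms base mv_closed by auto
  have sub: "Y \<subseteq> V" "Z \<subseteq> V" using sideD(1) assms by auto
  consider "mv x p\<^sub>0 \<notin> Z" "mv y p\<^sub>0 \<notin> Y" | "mv x p\<^sub>0 \<notin> V - Z" "mv y p\<^sub>0 \<notin> Y"
    | "mv x p\<^sub>0 \<notin> Z" "mv y p\<^sub>0 \<notin> V - Y" | "mv x p\<^sub>0 \<notin> V - Z" "mv y p\<^sub>0 \<notin> V - Y"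
    by blast
  then show ?thesis
  proof cases
    case 1 then show ?thesis using Q[OF assms(2) _ assms(4)] sub by blast
  next
    case 2 then show ?thesis using Q[OF assms(2) _ side_compl[OF assms(4)]] sub by blast
  next
    case 3 then show ?thesis using Q[OF side_compl[OF assms(2)] _ assms(4)] sub by blast
  next
    case 4
    then show ?thesis using Q[OF side_compl[OF assms(2)] _ side_compl[OF assms(4)]] sub by blast
  qed
qed

lemma side_edge:
  assumes "x \<in> carrier G" "side x Y"
  shows "mv x p\<^sub>0 \<in> Y \<longleftrightarrow> mv x q\<^sub>0 \<notin> Y"
  using sideD(3)[OF assms(2,1)] assms(1) subgroup.one_closed[OF C] by auto

text \<open>The edge of \<open>g \<otimes> x\<close> crosses the image of \<open>Y\<close> under
  \<open>mv g\<close>, whereas a side of \<open>x\<close> is crossed only by edges of the coset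
  \<open>x C\<close>.\<close>

lemma image_mv_eq_imp:
  assumes "g \<in> carrier G" "x \<in> carrier G" "side x Y" "side x (mv g ` Y)"
  shows "inv x \<otimes> g \<otimes> x \<in> C"
proof -
  have "\<not> (mv (g \<otimes> x) p\<^sub>0 \<in> mv g ` Y \<longleftrightarrow> mv (g \<otimes> x) q\<^sub>0 \<in> mv g ` Y)"
    using side_edge[OF _ side_mv[OF assms(1-3)]] assms by auto
  then show ?thesis
    using sideD(3)[OF assms(4), of "g \<otimes> x"] assms by (auto simp: m_assoc)
qed

text \<open>Exchanging the two sides forces \<open>inv x \<otimes> g \<otimes> x\<close> into
  \<open>C\<close>. Then \<open>C_link\<close> links \<open>mv x p\<^sub>0\<close> to its image
  under \<open>g\<close>, so both points lie on the same side.\<close>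

lemma no_inversion_side:
  assumes "g \<in> carrier G" "x \<in> carrier G" "side x Y"
  shows "mv g ` Y \<noteq> V - Y"
proof
  assume eq: "mv g ` Y = V - Y"
  then have "inv x \<otimes> g \<otimes> x \<in> C"
    using image_mv_eq_imp[OF assms] side_compl[OF assms(3)] by simp
  then have "(mv x p\<^sub>0, mv x (mv (inv x \<otimes> g \<otimes> x) p\<^sub>0)) \<in> L"
    using assms by (intro link_mv C_link) auto
  moreover have "mv x (mv (inv x \<otimes> g \<otimes> x) p\<^sub>0) = mv g (mv x p\<^sub>0)"
    using assms base by (simp add: mv_mult mv_inv mv_closed m_assoc)
  ultimately have "mv x p\<^sub>0 \<in> Y \<longleftrightarrow> mv g (mv x p\<^sub>0) \<in> Y" using sideD(2)[OF assms(3)] by metis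
  moreover have "mv x p\<^sub>0 \<in> Y \<longleftrightarrow> mv g (mv x p\<^sub>0) \<in> mv g ` Y"
    using assms base sideD(1)[OF assms(3)] by (simp add: mem_image_mv mv_closed mv_inv)
  moreover have "mv g (mv x p\<^sub>0) \<in> V" using assms base by (simp add: mv_closed)
  ultimately show False using eq by auto
qed

text \<open>The points that finitely many sides separate from \<open>p\<close> form a set closed
  under links, which no side crosses, and under edges, each of which is crossed by at most two
  sides.\<close>

lemma finite_separating:
  assumes "p \<in> V" "q \<in> V"
  shows "finite {Y \<in> sides. p \<in> Y \<longleftrightarrow> q \<notin> Y}"
proof -
  let ?sep = "\<lambda>p q. {Y \<in> sides. p \<in> Y \<longleftrightarrow> q \<notin> Y}"
  let ?D = "{q \<in> V. finite (?sep p q)}"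
  have "?D = V"
  proof (rule connected)
    show "p \<in> ?D" using assms by simp
    show "(q \<in> ?D) = (r \<in> ?D)" if "(q, r) \<in> L" for q r
    proof -
      have "?sep p q = ?sep p r" using that sideD(2) unfolding sides_def by blast
      then show ?thesis using link_V[OF that] by simp
    qed
    show "(mv g p\<^sub>0 \<in> ?D) = (mv g q\<^sub>0 \<in> ?D)" if g: "g \<in> carrier G" for g
    proof -
      let ?F = "{Y. side g Y}"
      have "finite ?F"
      proof (cases "?F = {}")
        case False
        then obtain Y where "side g Y" by auto
        then have "?F \<subseteq> {Y, V - Y}" using side_unique[OF g] by auto
        then show ?thesis by (rule finite_subset) simp
      qed simp
      have cross: "Y \<in> ?F" if "Y \<in> sides" "mv g p\<^sub>0 \<in> Y \<longleftrightarrow> mv g q\<^sub>0 \<notin> Y" for Y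
      proof -
        obtain x where x: "x \<in> carrier G" "side x Y" using \<open>Y \<in> sides\<close> unfolding sides_def by auto
        then have "inv x \<otimes> g \<in> C" using sideD(3)[OF x(2) g] that by blast
        then have "inv g \<otimes> x \<in> C"
          using subgroup.m_inv_closed[OF C, of "inv x \<otimes> g"] x g by (simp add: inv_mult_group)
        then show ?thesis using side_cong[OF g x(1) _ x(2)] by simp
      qed
      have 1: "?sep p (mv g q\<^sub>0) \<subseteq> ?sep p (mv g p\<^sub>0) \<union> ?F"
        and 2: "?sep p (mv g p\<^sub>0) \<subseteq> ?sep p (mv g q\<^sub>0) \<union> ?F"
        using cross by blast+
      have "finite (?sep p (mv g p\<^sub>0)) \<longleftrightarrow> finite (?sep p (mv g q\<^sub>0))"
        using finite_subset[OF 1] finite_subset[OF 2] \<open>finite ?F\<close> by blast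
      then show ?thesis using base g by (simp add: mv_closed)
    qed
  qed auto
  then show ?thesis using assms(2) by blast
qed

sublocale halfspace_action G V sides "\<lambda>g. image (mv g)"
proof
  fix h assume "h \<in> sides"
  then obtain x where x: "x \<in> carrier G" "side x h" by (auto simp: sides_def)
  note sub = sideD(1)[OF x(2)]
  show "h \<subseteq> V" by (rule sub)
  show "V - h \<in> sides" using x side_compl by (auto simp: sides_def)
  show "mv \<one> ` h = h" using sub mv_one by force
  fix g assume g: "g \<in> carrier G"
  show "mv g ` h \<in> sides" using side_mv[OF g x] x g by (auto simp: sides_def)
  show "mv g ` (V - h) = V - mv g ` h"
    using g sub by (auto simp: mem_image_mv mv_closed intro: image_mv_subset[THEN subsetD])
      (metis mem_image_mv mv_closed mv_inv(2) image_eqI DiffI inv_closed)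
  show "mv g ` h \<subseteq> h \<or> h \<subseteq> mv g ` h \<or> mv g ` h \<subseteq> V - h \<or> V - h \<subseteq> mv g ` h"
    using sides_nested[OF x _ side_mv[OF g x]] g x by auto
  show "mv g ` h \<noteq> V - h" by (rule no_inversion_side[OF g x])
next
  fix g g' h assume "g \<in> carrier G" "g' \<in> carrier G" "h \<in> sides"
  moreover have "h \<subseteq> V" using \<open>h \<in> sides\<close> sideD(1) by (auto simp: sides_def)
  ultimately show "mv (g \<otimes> g') ` h = mv g ` mv g' ` h"
    unfolding image_image by (intro image_cong) (auto intro: mv_mult)
next
  fix h k assume "h \<in> sides" "k \<in> sides"
  then obtain x y where xy: "x \<in> carrier G" "side x h" "y \<in> carrier G" "side y k"
    by (auto simp: sides_def)
  \<comment> \<open>Every half-space between \<open>h\<close> and \<open>k\<close> separates a point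
    of \<open>h\<close> from a point outside of \<open>k\<close>.\<close>
  obtain p where p: "p \<in> h" using side_edge[OF xy(1,2)] by auto
  obtain q where q: "q \<in> V" "q \<notin> k" using side_edge[OF xy(3,4)] xy(3) base mv_closed by metis
  have "{l \<in> sides. h \<subseteq> l \<and> l \<subseteq> k} \<subseteq> {Y \<in> sides. p \<in> Y \<longleftrightarrow> q \<notin> Y}" using p q by auto
  moreover have "p \<in> V" using sideD(1)[OF xy(2)] p by auto
  ultimately show "finite {l \<in> sides. h \<subseteq> l \<and> l \<subseteq> k}"
    using finite_separating q(1) finite_subset by blast
qed auto

lemma S_in_sides: "S \<in> sides"
  using side_S by (auto simp: sides_def)

lemma stab_conj_C:
  assumes "h \<in> sides"
  shows "\<exists>x\<in>carrier G. \<forall>g\<in>stab h. inv x \<otimes> g \<otimes> x \<in> C"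
proof -
  obtain x where x: "x \<in> carrier G" "side x h" using assms by (auto simp: sides_def)
  then have "inv x \<otimes> g \<otimes> x \<in> C" if "g \<in> stab h" for g
    using image_mv_eq_imp[OF _ x] that by (auto simp: stab_def)
  then show ?thesis using x(1) by blast
qed

end

section \<open>Presented groups\<close>

text \<open>Words act from the left through \<open>foldr\<close>. Checking the relators themselves
  suffices, because the words around them are absorbed by letting \<open>p\<close> vary over the
  invariant set \<open>P\<close>.\<close>

lemma pres_rel_action:
  assumes "(v, w) \<in> pres_rel X R"
    and closed: "\<And>y p. y \<in> X \<times> UNIV \<Longrightarrow> p \<in> P \<Longrightarrow> act y p \<in> P"
    and cancel: "\<And>x b p. x \<in> X \<Longrightarrow> p \<in> P \<Longrightarrow> act (x, b) (act (x, \<not> b) p) = p"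
    and rel: "\<And>l r p. (l, r) \<in> R \<Longrightarrow> l \<in> words X \<Longrightarrow> r \<in> words X \<Longrightarrow> p \<in> P \<Longrightarrow>
      foldr act l p = foldr act r p"
    and "p \<in> P"
  shows "foldr act v p = foldr act w p"
proof -
  have clos: "foldr act w p \<in> P" if "w \<in> words X" "p \<in> P" for w p
    using that by (induction w) (auto intro!: closed)
  show ?thesis
    using assms(1,5)
    by (induction arbitrary: p) (auto simp: cancel rel clos)
qed

definition letter_val :: "('a, 'm) monoid_scheme \<Rightarrow> ('x \<Rightarrow> 'a) \<Rightarrow> 'x \<times> bool \<Rightarrow> 'a"
  where "letter_val G \<gamma> y = (if snd y then \<gamma> (fst y) else inv\<^bsub>G\<^esub> \<gamma> (fst y))"

definition word_val :: "('a, 'm) monoid_scheme \<Rightarrow> ('x \<Rightarrow> 'a) \<Rightarrow> 'x word \<Rightarrow> 'a"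
  where "word_val G \<gamma> w = foldr (\<lambda>y g. letter_val G \<gamma> y \<otimes>\<^bsub>G\<^esub> g) w \<one>\<^bsub>G\<^esub>"

lemma word_val_Nil [simp]: "word_val G \<gamma> [] = \<one>\<^bsub>G\<^esub>"
  by (simp add: word_val_def)

lemma word_val_Cons [simp]: "word_val G \<gamma> (y # w) = letter_val G \<gamma> y \<otimes>\<^bsub>G\<^esub> word_val G \<gamma> w"
  by (simp add: word_val_def)

context group
begin

lemma letter_val_closed: "\<gamma> \<in> X \<rightarrow> carrier G \<Longrightarrow> y \<in> X \<times> UNIV \<Longrightarrow> letter_val G \<gamma> y \<in> carrier G"
  by (auto simp: letter_val_def)

lemma word_val_closed: "\<gamma> \<in> X \<rightarrow> carrier G \<Longrightarrow> w \<in> words X \<Longrightarrow> word_val G \<gamma> w \<in> carrier G"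
  by (induction w) (auto simp: letter_val_closed)

lemma foldr_letter_val:
  assumes "\<gamma> \<in> X \<rightarrow> carrier G" "w \<in> words X" "g \<in> carrier G"
  shows "foldr (\<lambda>y g. letter_val G \<gamma> y \<otimes> g) w g = word_val G \<gamma> w \<otimes> g"
  using assms(2) by (induction w) (use assms in \<open>auto simp: m_assoc letter_val_closed word_val_closed\<close>)

lemma word_val_append:
  assumes "\<gamma> \<in> X \<rightarrow> carrier G" "v \<in> words X" "w \<in> words X"
  shows "word_val G \<gamma> (v @ w) = word_val G \<gamma> v \<otimes> word_val G \<gamma> w"
  using foldr_letter_val[OF assms(1,2) word_val_closed[OF assms(1,3)]] by (simp add: word_val_def)

text \<open>\<open>G\<close> acts on itself by left multiplication with the values of letters, so
  \<open>pres_rel_action\<close> applies.\<close>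

lemma word_val_pres_rel:
  assumes "(v, w) \<in> pres_rel X R" and \<gamma>: "\<gamma> \<in> X \<rightarrow> carrier G"
    and rel: "\<And>l r. (l, r) \<in> R \<Longrightarrow> l \<in> words X \<Longrightarrow> r \<in> words X \<Longrightarrow> word_val G \<gamma> l = word_val G \<gamma> r"
  shows "word_val G \<gamma> v = word_val G \<gamma> w"
  unfolding word_val_def
proof (rule pres_rel_action[OF assms(1), where P = "carrier G"])
  show "foldr (\<lambda>y g. letter_val G \<gamma> y \<otimes> g) l p = foldr (\<lambda>y g. letter_val G \<gamma> y \<otimes> g) r p"
    if "(l, r) \<in> R" "l \<in> words X" "r \<in> words X" "p \<in> carrier G" for l r p
    using that rel[of l r] by (simp add: foldr_letter_val[OF \<gamma>])
  show "letter_val G \<gamma> (x, b) \<otimes> (letter_val G \<gamma> (x, \<not> b) \<otimes> p) = p"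
    if "x \<in> X" "p \<in> carrier G" for x b p
  proof -
    have "\<gamma> x \<in> carrier G" using that \<gamma> by auto
    then show ?thesis using that by (simp add: letter_val_def m_assoc[symmetric])
  qed
qed (auto simp: letter_val_closed[OF \<gamma>])

text \<open>This is von Dyck's theorem. The value of a class is read off from a chosen
  representative, which is well defined by \<open>word_val_pres_rel\<close>.\<close>

lemma presented_group_hom:
  assumes \<gamma>: "\<gamma> \<in> X \<rightarrow> carrier G"
    and rel: "\<And>l r. (l, r) \<in> R \<Longrightarrow> l \<in> words X \<Longrightarrow> r \<in> words X \<Longrightarrow> word_val G \<gamma> l = word_val G \<gamma> r"
  shows "\<exists>\<theta> \<in> hom (presented_group X R) G. \<forall>x\<in>X. \<theta> (pres_gen X R x) = \<gamma> x"
proof -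
  let ?\<theta> = "\<lambda>P. word_val G \<gamma> (SOME w. w \<in> P)"
  have val: "?\<theta> (pres_rel X R `` {w}) = word_val G \<gamma> w" if "w \<in> words X" for w
  proof -
    have "w \<in> pres_rel X R `` {w}" using that by (auto intro: pres_rel.refl)
    then have "(SOME v. v \<in> pres_rel X R `` {w}) \<in> pres_rel X R `` {w}" by (rule someI)
    then show ?thesis using word_val_pres_rel[OF _ \<gamma> rel] by auto
  qed
  have rep: "\<exists>w\<in>words X. P = pres_rel X R `` {w}" if "P \<in> carrier (presented_group X R)" for P
    using that by (auto simp: presented_group_def elim!: quotientE)
  have hom: "?\<theta> \<in> hom (presented_group X R) G"
  proof (rule homI)
    fix P assume "P \<in> carrier (presented_group X R)"
    then obtain v where "v \<in> words X" "P = pres_rel X R `` {v}" using rep by meson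
    then show "?\<theta> P \<in> carrier G" using word_val_closed[OF \<gamma>] by (simp only: val)
  next
    fix P Q assume "P \<in> carrier (presented_group X R)" "Q \<in> carrier (presented_group X R)"
    then obtain v w where vw: "v \<in> words X" "w \<in> words X"
      "P = pres_rel X R `` {v}" "Q = pres_rel X R `` {w}" using rep by meson
    then have "v @ w \<in> words X" by simp
    then show "?\<theta> (P \<otimes>\<^bsub>presented_group X R\<^esub> Q) = ?\<theta> P \<otimes> ?\<theta> Q"
      using vw word_val_append[OF \<gamma> vw(1,2)] by (simp only: presented_group_mult val)
  qed
  have "?\<theta> (pres_gen X R x) = \<gamma> x" if "x \<in> X" for x
  proof -
    have "\<gamma> x \<in> carrier G" using that \<gamma> by auto
    then show ?thesis
      using that val[of "[(x, True)]"] unfolding pres_gen_def by (simp add: letter_val_def)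
  qed
  then show ?thesis by (intro bexI[OF _ hom] ballI)
qed

end

lemma presented_group_carrierE:
  assumes "P \<in> carrier (presented_group X R)"
  obtains w where "w \<in> words X" "P = pres_rel X R `` {w}"
  using assms by (auto simp: presented_group_def elim!: quotientE)

lemma class_in_presented_group: "w \<in> words X \<Longrightarrow> pres_rel X R `` {w} \<in> carrier (presented_group X R)"
  by (auto simp: presented_group_def intro!: quotientI)

lemma class_Cons:
  assumes "x \<in> X" "w \<in> words X"
  shows "pres_rel X R `` {(x, b) # w} =
    letter_val (presented_group X R) (pres_gen X R) (x, b) \<otimes>\<^bsub>presented_group X R\<^esub> pres_rel X R `` {w}"
proof -
  let ?P = "presented_group X R"
  interpret P: group ?P by (rule group_presented_group)
  have w: "[(x, b)] \<in> words X" for b using assms by auto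
  have one: "\<one>\<^bsub>?P\<^esub> = pres_rel X R `` {[]}" by (simp add: presented_group_def)
  have "pres_rel X R `` {[(x, False)]} \<otimes>\<^bsub>?P\<^esub> pres_gen X R x = pres_rel X R `` {[(x, False), (x, True)]}"
    using presented_group_mult[OF w[of False] w[of True], of R] unfolding pres_gen_def by simp
  also have "\<dots> = \<one>\<^bsub>?P\<^esub>"
    unfolding one using pres_rel.cancel[of "[]" X "[]" x False R] assms
    by (intro equiv_class_eq[OF equiv_pres_rel]) auto
  finally have "inv\<^bsub>?P\<^esub> (pres_gen X R x) = pres_rel X R `` {[(x, False)]}"
    using class_in_presented_group[OF w] unfolding pres_gen_def by (intro P.inv_equality) auto
  then have "letter_val ?P (pres_gen X R) (x, b) = pres_rel X R `` {[(x, b)]}"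
    by (cases b) (auto simp: letter_val_def pres_gen_def)
  then show ?thesis using presented_group_mult[OF w[of b] assms(2), of R] by simp
qed

lemma pres_gen_closed: "x \<in> X \<Longrightarrow> pres_gen X R x \<in> carrier (presented_group X R)"
  unfolding pres_gen_def by (intro class_in_presented_group) auto

lemma presented_group_induct [consumes 1, case_names one gen inv_gen]:
  assumes "P \<in> carrier (presented_group X R)"
    and one: "Q \<one>\<^bsub>presented_group X R\<^esub>"
    and gen: "\<And>x P. x \<in> X \<Longrightarrow> P \<in> carrier (presented_group X R) \<Longrightarrow> Q P \<Longrightarrow>
      Q (pres_gen X R x \<otimes>\<^bsub>presented_group X R\<^esub> P)"
    and inv_gen: "\<And>x P. x \<in> X \<Longrightarrow> P \<in> carrier (presented_group X R) \<Longrightarrow> Q P \<Longrightarrow>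
      Q (inv\<^bsub>presented_group X R\<^esub> (pres_gen X R x) \<otimes>\<^bsub>presented_group X R\<^esub> P)"
  shows "Q P"
proof -
  have "Q (pres_rel X R `` {w})" if "w \<in> words X" for w
    using that
  proof (induction w rule: list.induct)
    case Nil
    then show ?case using one by (simp add: presented_group_def)
  next
    case (Cons y w)
    obtain x b where y: "y = (x, b)" by force
    show ?case
      using Cons gen[of x] inv_gen[of x] class_in_presented_group[of w X R] unfolding y
      by (cases b) (auto simp: class_Cons letter_val_def)
  qed
  moreover obtain w where "w \<in> words X" "P = pres_rel X R `` {w}"
    using assms(1) by (rule presented_group_carrierE)
  ultimately show ?thesis by simp
qed

locale presentation = group G for G (structure) +
  fixes X :: "'x set" and R :: "('x word \<times> 'x word) set" and \<phi> :: "'x word set \<Rightarrow> 'a"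
  assumes iso: "\<phi> \<in> iso (presented_group X R) G"
begin

abbreviation \<gamma> :: "'x \<Rightarrow> 'a" where "\<gamma> x \<equiv> \<phi> (pres_gen X R x)"

sublocale \<phi>: group_hom "presented_group X R" G \<phi>
  using iso is_group group_presented_group by (simp add: group_hom_def group_hom_axioms_def iso_def)

lemma bij_\<phi>: "bij_betw \<phi> (carrier (presented_group X R)) (carrier G)"
  using iso by (simp add: iso_def)

lemma \<gamma>_closed: "x \<in> X \<Longrightarrow> \<gamma> x \<in> carrier G"
  by (simp add: pres_gen_closed)

lemma induct_gens [consumes 1, case_names one gen inv_gen]:
  assumes "g \<in> carrier G"
    and "Q \<one>"
    and "\<And>x g. x \<in> X \<Longrightarrow> g \<in> carrier G \<Longrightarrow> Q g \<Longrightarrow> Q (\<gamma> x \<otimes> g)"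
    and "\<And>x g. x \<in> X \<Longrightarrow> g \<in> carrier G \<Longrightarrow> Q g \<Longrightarrow> Q (inv (\<gamma> x) \<otimes> g)"
  shows "Q g"
proof -
  obtain P where P: "P \<in> carrier (presented_group X R)" "g = \<phi> P"
    using assms(1) bij_\<phi> by (metis bij_betw_imp_surj_on imageE)
  have "Q (\<phi> P)"
    using P(1) by (induction rule: presented_group_induct) (simp_all add: assms(2-) pres_gen_closed)
  then show ?thesis using P by simp
qed

text \<open>\<open>F\<close> sends \<open>g\<close> to the result of applying a chosen word for
  \<open>g\<close> to \<open>p\<close>. Two words for \<open>g\<close> are congruent by injectivity
  of \<open>\<phi>\<close>, so \<open>pres_rel_action\<close> gives independence of the
  choice.\<close>

lemma orbit_map:
  assumes closed: "\<And>y p. y \<in> X \<times> UNIV \<Longrightarrow> p \<in> P \<Longrightarrow> act y p \<in> P"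
    and cancel: "\<And>x b p. x \<in> X \<Longrightarrow> p \<in> P \<Longrightarrow> act (x, b) (act (x, \<not> b) p) = p"
    and rel: "\<And>l r p. (l, r) \<in> R \<Longrightarrow> l \<in> words X \<Longrightarrow> r \<in> words X \<Longrightarrow> p \<in> P \<Longrightarrow>
      foldr act l p = foldr act r p"
    and p: "p \<in> P"
  shows "\<exists>F. F \<one> = p \<and> (\<forall>x\<in>X. \<forall>g\<in>carrier G. F (\<gamma> x \<otimes> g) = act (x, True) (F g)) \<and> F \<in> carrier G \<rightarrow> P"
proof -
  define F where "F g = foldr act (SOME w. w \<in> words X \<and> \<phi> (pres_rel X R `` {w}) = g) p" for g
  have val: "F (\<phi> (pres_rel X R `` {w})) = foldr act w p" if w: "w \<in> words X" for w
  proof -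
    let ?P = "\<lambda>v. v \<in> words X \<and> \<phi> (pres_rel X R `` {v}) = \<phi> (pres_rel X R `` {w})"
    obtain v where v: "v = (SOME v. ?P v)" by simp
    have Pv: "?P v" unfolding v by (rule someI[of ?P w]) (simp add: w)
    have "pres_rel X R `` {v} = pres_rel X R `` {w}"
      using Pv w bij_\<phi> by (intro inj_onD[of \<phi> "carrier (presented_group X R)"])
        (auto simp: bij_betw_def intro!: class_in_presented_group)
    then have "(v, w) \<in> pres_rel X R"
      using eq_equiv_class[OF _ equiv_pres_rel w] by simp
    then have "foldr act v p = foldr act w p"
      using pres_rel_action[where act = act and P = P, OF _ closed cancel rel p] by blast
    then show ?thesis unfolding F_def v .
  qed
  have clos: "foldr act w p \<in> P" if "w \<in> words X" for w
    using that by (induction w) (auto intro!: closed p)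
  have rep: "\<exists>w\<in>words X. g = \<phi> (pres_rel X R `` {w})" if g: "g \<in> carrier G" for g
  proof -
    obtain P where P: "P \<in> carrier (presented_group X R)" "g = \<phi> P"
      using g unfolding bij_betw_imp_surj_on[OF bij_\<phi>, symmetric] by auto
    obtain w where "w \<in> words X" "P = pres_rel X R `` {w}"
      using P(1) by (rule presented_group_carrierE)
    then show ?thesis using P(2) by auto
  qed
  have "F \<one> = p"
    using val[of "[]"] \<phi>.hom_one by (simp add: presented_group_def)
  moreover have "F (\<gamma> x \<otimes> g) = act (x, True) (F g)" if x: "x \<in> X" and g: "g \<in> carrier G" for x g
  proof -
    obtain w where w: "w \<in> words X" "g = \<phi> (pres_rel X R `` {w})" using rep[OF g] by auto
    have "\<gamma> x \<otimes> g = \<phi> (pres_rel X R `` {(x, True) # w})"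
      using x w by (simp add: class_Cons letter_val_def class_in_presented_group pres_gen_closed)
    then show ?thesis using val[of "(x, True) # w"] val[OF w(1)] w x by simp
  qed
  moreover have "F \<in> carrier G \<rightarrow> P"
  proof
    fix g assume "g \<in> carrier G"
    then obtain w where w: "w \<in> words X" "g = \<phi> (pres_rel X R `` {w})" using rep by auto
    then show "F g \<in> P" using val[OF w(1)] clos[OF w(1)] by simp
  qed
  ultimately show ?thesis by blast
qed

end

section \<open>Half-spaces of a splitting\<close>

text \<open>The common interface of the two kinds of splittings. Edge stabilizers are conjugate into
  \<open>C\<close>, and \<open>hyperbolic\<close> rules out a vertex of the tree fixed by all of
  \<open>G\<close>.\<close>

locale splitting_action = halfspace_action +
  fixes C
  assumes stab_conj: "h \<in> HS \<Longrightarrow> \<exists>x\<in>carrier G. \<forall>g\<in>stab h. inv x \<otimes> g \<otimes> x \<in> C"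
    and hyperbolic: "\<exists>g\<in>carrier G. \<exists>h\<in>HS. g \<odot> h \<subset> h"

lemma (in edge_cut) splitting_actionI:
  assumes "g \<in> carrier G" "h \<in> sides" "h \<subset> mv g ` h"
  shows "splitting_action G V sides (\<lambda>g. image (mv g)) C"
proof
  show "\<exists>x\<in>carrier G. \<forall>g\<in>stab h. inv x \<otimes> g \<otimes> x \<in> C" if "h \<in> sides" for h
    using that by (rule stab_conj_C)
  have "mv (inv g) ` h \<subset> h" using assms by (simp add: act_inv_psubset)
  then show "\<exists>g\<in>carrier G. \<exists>h\<in>sides. mv g ` h \<subset> h"
    using assms by (intro bexI[of _ "inv g"] bexI[of _ h]) auto
qed

text \<open>The path from the base vertex of the Bass-Serre tree to its translate by \<open>g\<inverse>\<close> crosses the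
  base edge an odd number of times if and only if \<open>\<sigma> g\<close>. Writing \<open>\<lambda>\<^sub>g\<close> for left multiplication on
  \<open>G \<times> bool\<close> and \<open>\<kappa>\<close> for the involution that flips the second component over \<open>C\<close>, the map
  \<open>g \<mapsto> (g, \<sigma> g)\<close> is an orbit map of the action in which \<open>a \<in> A\<close> acts by \<open>\<lambda>\<^sub>a\<close> and \<open>b \<in> B\<close>
  by \<open>\<kappa> \<lambda>\<^sub>b \<kappa>\<close>.\<close>

lemma (in group) amalgam_cocycle:
  assumes "amalgam_decomposition G A B C"
  shows amalgam_induct: "\<And>Q g. g \<in> carrier G \<Longrightarrow> Q \<one> \<Longrightarrow>
      (\<And>x g. x \<in> A \<union> B \<Longrightarrow> g \<in> carrier G \<Longrightarrow> Q g \<Longrightarrow> Q (x \<otimes> g)) \<Longrightarrow> Q g"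
    and "\<exists>\<sigma>. \<not> \<sigma> \<one> \<and> (\<forall>a\<in>A. \<forall>g\<in>carrier G. \<sigma> (a \<otimes> g) = \<sigma> g) \<and>
      (\<forall>b\<in>B. \<forall>g\<in>carrier G. (\<sigma> (b \<otimes> g) \<noteq> (b \<otimes> g \<in> C)) = (\<sigma> g \<noteq> (g \<in> C)))"
proof -
  let ?A = "G\<lparr>carrier := A\<rparr>" and ?B = "G\<lparr>carrier := B\<rparr>" and ?C = "G\<lparr>carrier := C\<rparr>"
  define X where "X = A <+> B"
  define R where "R = amalgam_rels ?A ?B ?C id id"
  have A: "subgroup A G" and B: "subgroup B G" and C: "subgroup C G" and CAB: "C \<subseteq> A" "C \<subseteq> B"
    using assms by (auto simp: amalgam_decomposition_def)
  obtain \<phi> where iso: "\<phi> \<in> iso (presented_group X R) G"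
    and \<phi>A: "\<And>a. a \<in> A \<Longrightarrow> \<phi> (pres_gen X R (Inl a)) = a"
    and \<phi>B: "\<And>b. b \<in> B \<Longrightarrow> \<phi> (pres_gen X R (Inr b)) = b"
    using assms unfolding amalgam_decomposition_def Let_def X_def R_def by auto
  have X_mem: "x \<in> X \<longleftrightarrow> (\<exists>a\<in>A. x = Inl a) \<or> (\<exists>b\<in>B. x = Inr b)" for x
    by (auto simp: X_def)
  interpret presentation G X R \<phi> by unfold_locales (rule iso)
  have mem: "g \<in> carrier G" if "g \<in> A \<or> g \<in> B" for g
    using that subgroup.mem_carrier[OF A] subgroup.mem_carrier[OF B] by blast
  have inv_mem: "a \<in> A \<Longrightarrow> inv a \<in> A" "b \<in> B \<Longrightarrow> inv b \<in> B" for a b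
    using subgroup.m_inv_closed[OF A] subgroup.m_inv_closed[OF B] by blast+
  show ind: "Q g" if "g \<in> carrier G" "Q \<one>"
    "\<And>x g. x \<in> A \<union> B \<Longrightarrow> g \<in> carrier G \<Longrightarrow> Q g \<Longrightarrow> Q (x \<otimes> g)" for Q g
    using that(1)
  proof (induction rule: induct_gens)
    case (gen x g)
    then show ?case using that(3) by (auto simp: X_mem \<phi>A \<phi>B)
  next
    case (inv_gen x g)
    then show ?case using that(3) inv_mem by (auto simp: X_mem \<phi>A \<phi>B)
  qed (rule that(2))
  \<comment> \<open>For \<open>Inr b\<close> the two flips in
    \<open>\<kappa> \<lambda>\<^sub>b \<kappa>\<close> are merged: the second component changes when
    exactly one of the old and the new first component lies in \<open>C\<close>.\<close>
  define act :: "('a + 'a) \<times> bool \<Rightarrow> 'a \<times> bool \<Rightarrow> 'a \<times> bool" where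
    "act y p = (case fst y of
       Inl a \<Rightarrow> ((if snd y then a else inv a) \<otimes> fst p, snd p)
     | Inr b \<Rightarrow> let g = (if snd y then b else inv b) \<otimes> fst p in (g, snd p \<noteq> ((fst p \<in> C) \<noteq> (g \<in> C))))"
    for y p
  \<comment> \<open>For \<open>c\<close> in \<open>C\<close> the two flips cancel, so that
    \<open>Inl c\<close> and \<open>Inr c\<close> act alike.\<close>
  have Cmult: "c \<otimes> g \<in> C \<longleftrightarrow> g \<in> C" if "c \<in> C" "g \<in> carrier G" for c g
  proof
    assume "c \<otimes> g \<in> C"
    then have "inv c \<otimes> (c \<otimes> g) \<in> C"
      using that subgroup.m_closed[OF C] subgroup.m_inv_closed[OF C] by blast
    then show "g \<in> C" using that CAB mem[of c] by (auto simp: m_assoc[symmetric])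
  qed (use that subgroup.m_closed[OF C] in blast)
  have "\<exists>F. F \<one> = (\<one>, False) \<and> (\<forall>x\<in>X. \<forall>g\<in>carrier G. F (\<gamma> x \<otimes> g) = act (x, True) (F g)) \<and>
    F \<in> carrier G \<rightarrow> carrier G \<times> UNIV"
  proof (rule orbit_map)
    show "act y p \<in> carrier G \<times> UNIV" if "y \<in> X \<times> UNIV" "p \<in> carrier G \<times> UNIV" for y p
      using that mem inv_mem by (auto simp: X_mem act_def Let_def split: sum.splits)
    show "act (x, b) (act (x, \<not> b) p) = p" if "x \<in> X" "p \<in> carrier G \<times> UNIV" for x b p
      using that mem by (cases p) (auto simp: X_mem act_def Let_def m_assoc[symmetric])
    show "foldr act l p = foldr act r p" if "(l, r) \<in> R" "p \<in> carrier G \<times> UNIV" for l r p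
    proof -
      have "fst p \<in> carrier G" using that by auto
      then show ?thesis using that(1) mem CAB Cmult
        by (auto simp: R_def amalgam_rels_def mult_table_def act_def Let_def m_assoc subset_eq)
    qed
  qed simp
  then obtain F where F: "F \<one> = (\<one>, False)"
    "\<And>x g. x \<in> X \<Longrightarrow> g \<in> carrier G \<Longrightarrow> F (\<gamma> x \<otimes> g) = act (x, True) (F g)" by blast
  have FA: "F (a \<otimes> g) = (a \<otimes> fst (F g), snd (F g))" if "a \<in> A" "g \<in> carrier G" for a g
    using F(2)[of "Inl a" g] that by (simp add: X_mem \<phi>A act_def)
  have FB: "F (b \<otimes> g) = (b \<otimes> fst (F g), snd (F g) \<noteq> ((fst (F g) \<in> C) \<noteq> (b \<otimes> fst (F g) \<in> C)))"
    if "b \<in> B" "g \<in> carrier G" for b g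
    using F(2)[of "Inr b" g] that by (simp add: X_mem \<phi>B act_def Let_def)
  have fst: "fst (F g) = g" if "g \<in> carrier G" for g
    using that by (induction rule: ind[consumes 1]) (auto simp: F(1) FA FB)
  show "\<exists>\<sigma>. \<not> \<sigma> \<one> \<and> (\<forall>a\<in>A. \<forall>g\<in>carrier G. \<sigma> (a \<otimes> g) = \<sigma> g) \<and>
      (\<forall>b\<in>B. \<forall>g\<in>carrier G. (\<sigma> (b \<otimes> g) \<noteq> (b \<otimes> g \<in> C)) = (\<sigma> g \<noteq> (g \<in> C)))"
    by (rule exI[of _ "\<lambda>g. snd (F g)"]) (auto simp: F(1) FA FB fst)
qed

text \<open>The points \<open>(g, False)\<close> and \<open>(g, True)\<close> represent the vertices
  \<open>g A\<close> and \<open>g B\<close> of the Bass-Serre tree, with right multiplication by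
  \<open>A\<close> and by \<open>B\<close> as links, and the edge of \<open>g\<close> joins these
  two points. The cocycle is invariant under left multiplication by \<open>A\<close>, whereas the
  vertices are left cosets; hence \<open>\<sigma>\<close> is evaluated at inverses.\<close>

lemma (in group) amalgam_splitting_action:
  assumes dec: "amalgam_decomposition G A B C" and "carrier G \<noteq> A" "carrier G \<noteq> B"
  shows "\<exists>(V :: ('a \<times> bool) set) HS act. splitting_action G V HS act C"
proof -
  have A: "subgroup A G" and B: "subgroup B G" and C: "subgroup C G" and CAB: "C \<subseteq> A" "C \<subseteq> B"
    using assms by (auto simp: amalgam_decomposition_def)
  note ind = amalgam_induct[OF dec, consumes 1]
  obtain \<sigma> where \<sigma>': "\<not> \<sigma> \<one>" "\<forall>a\<in>A. \<forall>g\<in>carrier G. \<sigma> (a \<otimes> g) = \<sigma> g"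
    "\<forall>b\<in>B. \<forall>g\<in>carrier G. (\<sigma> (b \<otimes> g) \<noteq> (b \<otimes> g \<in> C)) = (\<sigma> g \<noteq> (g \<in> C))"
    using amalgam_cocycle(2)[OF dec] by (elim exE conjE)
  note \<sigma> = \<sigma>'(1) \<sigma>'(2,3)[rule_format]
  have memA: "a \<in> A \<Longrightarrow> a \<in> carrier G" and memB: "b \<in> B \<Longrightarrow> b \<in> carrier G" for a b
    using subgroup.mem_carrier[OF A] subgroup.mem_carrier[OF B] by blast+
  have invA: "a \<in> A \<Longrightarrow> inv a \<in> A" and invB: "b \<in> B \<Longrightarrow> inv b \<in> B" for a b
    using subgroup.m_inv_closed[OF A] subgroup.m_inv_closed[OF B] by blast+
  have invC: "inv g \<in> C \<longleftrightarrow> g \<in> C" if "g \<in> carrier G" for g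
    using that subgroup.m_inv_closed[OF C] by (metis inv_inv)
  let ?V = "carrier G \<times> (UNIV :: bool set)" and ?mv = "\<lambda>g p. (g \<otimes> fst p, snd p :: bool)"
  let ?L = "{((g, i), (g \<otimes> x, i)) | g x i. g \<in> carrier G \<and> x \<in> (if i then B else A)}"
  let ?S = "{(g, i). g \<in> carrier G \<and> (\<sigma> (inv g) \<noteq> (i \<and> g \<in> C))}"
  interpret edge_cut G ?V ?mv ?L "(\<one>, False)" "(\<one>, True)" C ?S
  proof
    fix c assume "c \<in> C"
    then show "((\<one>, False), (c \<otimes> fst (\<one>, False), snd (\<one>, False))) \<in> ?L"
      using CAB memA by (auto intro!: exI[of _ c] simp: subset_eq)
  next
    fix D p assume D: "D \<subseteq> ?V" "p \<in> D" "\<And>p q. (p, q) \<in> ?L \<Longrightarrow> (p \<in> D) = (q \<in> D)"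
      "\<And>g. g \<in> carrier G \<Longrightarrow> ((g \<otimes> fst (\<one>, False), snd (\<one>, False)) \<in> D) =
        ((g \<otimes> fst (\<one>, True), snd (\<one>, True)) \<in> D)"
    have level: "(g, i) \<in> D \<longleftrightarrow> (g, False) \<in> D" if "g \<in> carrier G" for g i
      using D(4)[OF that] that by (cases i) auto
    have step: "(g \<otimes> x, False) \<in> D \<longleftrightarrow> (g, False) \<in> D" if "g \<in> carrier G" "x \<in> A \<union> B" for g x
    proof -
      obtain i where "x \<in> (if i then B else A)" using \<open>x \<in> A \<union> B\<close> by (metis Un_iff)
      then have "(g, i) \<in> D \<longleftrightarrow> (g \<otimes> x, i) \<in> D" using that by (intro D(3)) auto
      then show ?thesis using level that memA memB by (metis Un_iff m_closed)
    qed
    have all: "\<forall>g\<in>carrier G. (g \<otimes> h, False) \<in> D \<longleftrightarrow> (g, False) \<in> D" if "h \<in> carrier G" for h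
      using that
    proof (induction rule: ind)
      case (2 x h)
      then have x: "x \<in> carrier G" using memA memB by auto
      have "(g \<otimes> (x \<otimes> h), False) \<in> D \<longleftrightarrow> (g, False) \<in> D" if "g \<in> carrier G" for g
        using 2 x that step[OF that 2(1)] by (metis m_assoc m_closed)
      then show ?case by blast
    qed simp
    have base: "(g, False) \<in> D \<longleftrightarrow> (\<one>, False) \<in> D" if "g \<in> carrier G" for g
      using all[OF that] that by (metis l_one one_closed)
    obtain g i where p: "p = (g, i)" "g \<in> carrier G" using D(1,2) by auto
    then have "(\<one>, False) \<in> D" using D(2) level base by blast
    then have "(h, j) \<in> D" if "h \<in> carrier G" for h j using level[OF that] base[OF that] by blast
    then show "D = ?V" using D(1) by auto
  next
    fix p q assume "(p, q) \<in> ?L"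
    then obtain g x i where gx: "p = (g, i)" "q = (g \<otimes> x, i)" "g \<in> carrier G" "x \<in> (if i then B else A)"
      by blast
    then have x: "x \<in> carrier G" using memA memB by (auto split: if_splits)
    show "p \<in> ?S \<longleftrightarrow> q \<in> ?S"
    proof (cases i)
      case False
      then show ?thesis using gx x \<sigma>(2)[of "inv x" "inv g"] invA by (auto simp: inv_mult_group)
    next
      case True
      then have "(\<sigma> (inv (g \<otimes> x)) \<noteq> (inv (g \<otimes> x) \<in> C)) = (\<sigma> (inv g) \<noteq> (inv g \<in> C))"
        using gx x \<sigma>(3)[of "inv x" "inv g"] invB by (auto simp: inv_mult_group)
      then show ?thesis using gx x True invC by auto
    qed
  next
    fix k p q assume k: "k \<in> carrier G" and "(p, q) \<in> ?L"
    then obtain g x i where gx: "p = (g, i)" "q = (g \<otimes> x, i)" "g \<in> carrier G" "x \<in> (if i then B else A)"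
      by blast
    then have "x \<in> carrier G" using memA memB by (auto split: if_splits)
    then have "k \<otimes> (g \<otimes> x) = k \<otimes> g \<otimes> x" using k gx by (simp add: m_assoc)
    then show "((k \<otimes> fst p, snd p), (k \<otimes> fst q, snd q)) \<in> ?L" using k gx by auto
  qed (use subgroup.mem_carrier[OF C] subgroup.m_closed[OF C] subgroup.one_closed[OF C]
    subgroup.m_inv_closed[OF C] in \<open>auto simp: m_assoc split: if_splits intro: memA memB\<close>)
  have \<sigma>A: "\<not> \<sigma> a" if "a \<in> A" for a using \<sigma>(2)[OF that, of \<one>] \<sigma>(1) that memA by simp
  \<comment> \<open>\<open>A\<close> and \<open>B\<close> generate \<open>G\<close>, so
    \<open>C = A\<close> would give \<open>G = B\<close>, and \<open>C = B\<close> would give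
    \<open>G = A\<close>.\<close>
  have gen: "carrier G \<subseteq> D" if D: "subgroup D G" "A \<subseteq> D" "B \<subseteq> D" for D
  proof
    fix g assume "g \<in> carrier G"
    then show "g \<in> D"
      by (induction rule: ind) (use D subgroup.one_closed[OF D(1)] subgroup.m_closed[OF D(1)] in auto)
  qed
  have "C \<noteq> A" using gen[OF B] CAB assms(3) memB by blast
  then obtain a where a: "a \<in> A" "a \<notin> C" using CAB by auto
  have "C \<noteq> B" using gen[OF A] CAB assms(2) memA by blast
  then obtain b where b: "b \<in> B" "b \<notin> C" using CAB by auto
  have \<sigma>B: "\<sigma> b" if "b \<in> B" "b \<notin> C" for b
    using \<sigma>(3)[OF that(1), of \<one>] \<sigma>(1) that memB subgroup.one_closed[OF C] by auto
  have carr: "a \<in> carrier G" "b \<in> carrier G" using a b memA memB by auto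
  have ab: "inv a \<in> A" "inv b \<in> B" "inv b \<notin> C" "\<sigma> b" "\<sigma> (inv b)" "\<not> \<sigma> a" "\<not> \<sigma> (inv a)"
    using a b invA invB invC carr \<sigma>A \<sigma>B by auto
  note SS = side_S
  have sa: "side a (?mv a ` ?S)" and sb: "side b (?mv b ` (?V - ?S))"
    using side_mv[OF _ one_closed SS, of a] side_mv[OF _ one_closed side_compl[OF SS], of b] carr
    by auto
  have base_in: "(g, False) \<in> ?mv k ` ?S \<longleftrightarrow> \<sigma> (inv g \<otimes> k)"
    if "g \<in> carrier G" "k \<in> carrier G" for g k
    using that by (subst mem_image_mv) (auto simp: inv_mult_group)
  have dj: "Y \<subseteq> W - X" if "X \<inter> Y = {}" "Y \<subseteq> W" for X Y W :: "('a \<times> bool) set"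
    using that by blast
  have dj': "Y \<subseteq> X" if "(W - X) \<inter> Y = {}" "Y \<subseteq> W" for X Y W :: "('a \<times> bool) set"
    using that by blast
  \<comment> \<open>\<open>?S\<close> is the side of the vertex \<open>B\<close>. The element
    \<open>a\<close> fixes the vertex \<open>A\<close> but not the base edge, so it moves
    \<open>?S\<close> off itself; \<open>b\<close> does the same with the complement of
    \<open>?S\<close>.\<close>
  have 1: "?S \<inter> ?mv a ` ?S = {}"
    using carr a ab base_in[of \<one> a]
    by (intro quadrant_empty[OF one_closed SS _ carr(1) sa]) (auto simp: \<sigma>(1))
  have 2: "(?V - ?S) \<inter> ?mv b ` (?V - ?S) = {}"
  proof (rule quadrant_empty[OF one_closed side_compl[OF SS] _ carr(2) sb])
    have "?mv b ` (?V - ?S) = ?V - ?mv b ` ?S" using act_compl[OF carr(2) S_in_sides] .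
    then show "(\<one> \<otimes> fst (\<one>, False), snd (\<one>, False)) \<notin> ?mv b ` (?V - ?S)"
      using base_in[of \<one> b] carr ab by auto
  qed (use b ab carr in auto)
  have disj: "?mv a ` ?S \<subseteq> ?V - ?S" "?mv b ` (?V - ?S) \<subseteq> ?S"
    using dj[OF 1 subset[OF act_closed[OF carr(1) S_in_sides]]]
      dj'[OF 2 subset[OF act_closed[OF carr(2) compl[OF S_in_sides]]]] by simp_all
  \<comment> \<open>Together, \<open>a \<otimes> b\<close> moves the complement of \<open>?S\<close>
    into itself and therefore enlarges \<open>?S\<close>.\<close>
  have "?V - ?mv (a \<otimes> b) ` ?S = ?mv (a \<otimes> b) ` (?V - ?S)"
    using carr by (intro act_compl[symmetric] S_in_sides) auto
  also have "\<dots> = ?mv a ` ?mv b ` (?V - ?S)"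
    using carr by (intro act_mult compl[OF S_in_sides])
  also have "\<dots> \<subseteq> ?mv a ` ?S" using disj(2) by (rule image_mono)
  also have "\<dots> \<subseteq> ?V - ?S" by (rule disj(1))
  finally have "?S \<subseteq> ?mv (a \<otimes> b) ` ?S"
    using compl_subset_compl S_in_sides act_closed carr by (meson m_closed)
  moreover have "?S \<noteq> ?mv (a \<otimes> b) ` ?S"
  proof
    assume "?S = ?mv (a \<otimes> b) ` ?S"
    then have "side \<one> (?mv (a \<otimes> b) ` ?S)" using SS by simp
    then have "a \<otimes> b \<in> C"
      using image_mv_eq_imp[OF _ one_closed SS, of "a \<otimes> b"] carr by simp
    then have "inv a \<otimes> (a \<otimes> b) \<in> A" using subgroup.m_closed[OF A ab(1)] CAB by blast
    then have "b \<in> A" using carr by (simp add: m_assoc[symmetric])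
    then show False using \<sigma>A ab by blast
  qed
  ultimately have "?S \<subset> ?mv (a \<otimes> b) ` ?S" by (rule psubsetI)
  then have "splitting_action G ?V sides (\<lambda>g. (`) (?mv g)) C"
    using S_in_sides carr by (intro splitting_actionI) auto
  then show ?thesis by blast
qed

text \<open>For an HNN-extension with stable letter \<open>t\<close>, the letter acts by \<open>\<lambda>\<^sub>t \<kappa>\<close>.\<close>

lemma (in group) hnn_cocycle:
  assumes "hnn_decomposition G A C"
  shows "\<exists>t \<sigma>. t \<in> carrier G \<and>
    (\<forall>D. \<one> \<in> D \<longrightarrow> (\<forall>x\<in>A \<union> {t, inv t}. \<forall>g\<in>carrier G. g \<in> D \<longrightarrow> x \<otimes> g \<in> D) \<longrightarrow> carrier G \<subseteq> D) \<and>
    \<not> \<sigma> \<one> \<and> (\<forall>a\<in>A. \<forall>g\<in>carrier G. \<sigma> (a \<otimes> g) = \<sigma> g) \<and>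
    (\<forall>g\<in>carrier G. \<sigma> (t \<otimes> g) = (\<sigma> g \<noteq> (g \<in> C)))"
proof -
  let ?A = "G\<lparr>carrier := A\<rparr>" and ?C = "G\<lparr>carrier := C\<rparr>"
  have A: "subgroup A G" and C: "subgroup C G" and CA: "C \<subseteq> A"
    using assms by (auto simp: hnn_decomposition_def)
  obtain f where f: "f \<in> mon ?C ?A" and ex: "\<exists>\<phi> \<in> iso (hnn_extension ?A ?C id f) G.
      \<forall>a\<in>A. \<phi> (pres_gen (hnn_gens ?A) (hnn_rels ?A ?C id f) (Some a)) = a"
    using assms unfolding hnn_decomposition_def Let_def by blast
  define X where "X = insert None (Some ` A)"
  define R where "R = hnn_rels ?A ?C id f"
  obtain \<phi> where iso: "\<phi> \<in> iso (presented_group X R) G"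
    and \<phi>A: "\<And>a. a \<in> A \<Longrightarrow> \<phi> (pres_gen X R (Some a)) = a"
    using ex unfolding X_def R_def by auto
  have X_mem: "x \<in> X \<longleftrightarrow> x = None \<or> (\<exists>a\<in>A. x = Some a)" for x
    by (auto simp: X_def)
  interpret presentation G X R \<phi> by unfold_locales (rule iso)
  define t where "t = \<gamma> None"
  have t: "t \<in> carrier G" unfolding t_def by (intro \<gamma>_closed) (simp add: X_mem)
  have mem: "g \<in> carrier G" if "g \<in> A" for g
    using that subgroup.mem_carrier[OF A] by blast
  have inv_mem: "a \<in> A \<Longrightarrow> inv a \<in> A" for a
    using subgroup.m_inv_closed[OF A] by blast
  have fA: "f c \<in> A" if "c \<in> C" for c
    using f that by (auto simp: mon_def hom_def)
  have tc: "t \<otimes> c = f c \<otimes> t" if c: "c \<in> C" for c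
  proof -
    have w: "[] \<in> words X" "[(Some c, True)] \<in> words X" "[(None, True)] \<in> words X"
      using c CA by (auto simp: X_mem)
    have "([(None, True), (Some c, True)], [(Some (f c), True), (None, True)]) \<in> pres_rel X R"
      using pres_rel.relation[of "[]" X "[]" "[(None, True), (Some c, True)]"
          "[(Some (f c), True), (None, True)]" R] c CA fA[OF c]
      by (auto simp: X_mem R_def hnn_rels_def)
    then have "\<phi> (pres_rel X R `` {[(None, True), (Some c, True)]}) =
        \<phi> (pres_rel X R `` {[(Some (f c), True), (None, True)]})"
      using equiv_class_eq[OF equiv_pres_rel] by metis
    moreover have "pres_rel X R `` {[]} = \<one>\<^bsub>presented_group X R\<^esub>"
      by (simp add: presented_group_def)
    ultimately show ?thesis
      using w c CA fA[OF c] t mem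
      by (simp add: class_Cons X_mem letter_val_def pres_gen_closed \<phi>A subset_eq t_def[symmetric]
        \<phi>.G.is_group)
  qed
  have ind: "Q g" if "g \<in> carrier G" "Q \<one>"
    "\<And>x g. x \<in> A \<union> {t, inv t} \<Longrightarrow> g \<in> carrier G \<Longrightarrow> Q g \<Longrightarrow> Q (x \<otimes> g)" for Q g
    using that(1)
  proof (induction rule: induct_gens)
    case (gen x g)
    then show ?case using that(3) by (auto simp: X_mem \<phi>A t_def)
  next
    case (inv_gen x g)
    then show ?case using that(3) inv_mem by (auto simp: X_mem \<phi>A t_def)
  qed (rule that(2))
  \<comment> \<open>The inverse of \<open>\<lambda>\<^sub>t \<kappa>\<close> flips last, so for the
    inverse letter membership in \<open>C\<close> is tested on
    \<open>inv t \<otimes> fst p\<close>.\<close>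
  define act :: "'a option \<times> bool \<Rightarrow> 'a \<times> bool \<Rightarrow> 'a \<times> bool" where
    "act y p = (case fst y of
       Some a \<Rightarrow> ((if snd y then a else inv a) \<otimes> fst p, snd p)
     | None \<Rightarrow> if snd y then (t \<otimes> fst p, snd p \<noteq> (fst p \<in> C))
         else (inv t \<otimes> fst p, snd p \<noteq> (inv t \<otimes> fst p \<in> C)))"
    for y p
  have Cmult: "c \<otimes> g \<in> C \<longleftrightarrow> g \<in> C" if "c \<in> C" "g \<in> carrier G" for c g
  proof
    assume "c \<otimes> g \<in> C"
    then have "inv c \<otimes> (c \<otimes> g) \<in> C"
      using that subgroup.m_closed[OF C] subgroup.m_inv_closed[OF C] by blast
    then show "g \<in> C" using that CA mem[of c] by (auto simp: m_assoc[symmetric])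
  qed (use that subgroup.m_closed[OF C] in blast)
  have "\<exists>F. F \<one> = (\<one>, False) \<and> (\<forall>x\<in>X. \<forall>g\<in>carrier G. F (\<gamma> x \<otimes> g) = act (x, True) (F g)) \<and>
    F \<in> carrier G \<rightarrow> carrier G \<times> UNIV"
  proof (rule orbit_map)
    show "act y p \<in> carrier G \<times> UNIV" if "y \<in> X \<times> UNIV" "p \<in> carrier G \<times> UNIV" for y p
      using that mem inv_mem t by (auto simp: X_mem act_def split: option.splits)
    show "act (x, b) (act (x, \<not> b) p) = p" if "x \<in> X" "p \<in> carrier G \<times> UNIV" for x b p
      using that mem t by (cases p) (auto simp: X_mem act_def m_assoc[symmetric])
    show "foldr act l p = foldr act r p" if "(l, r) \<in> R" "p \<in> carrier G \<times> UNIV" for l r p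
    proof -
      have p: "fst p \<in> carrier G" using that by auto
      have "t \<otimes> (c \<otimes> fst p) = f c \<otimes> (t \<otimes> fst p)" if "c \<in> C" for c
        using tc[OF that] p t mem fA[OF that] CA that by (simp add: m_assoc[symmetric] subset_eq)
      then show ?thesis using that(1) p mem CA Cmult
        by (auto simp: R_def hnn_rels_def mult_table_def act_def m_assoc subset_eq)
    qed
  qed simp
  then obtain F where F: "F \<one> = (\<one>, False)"
    "\<And>x g. x \<in> X \<Longrightarrow> g \<in> carrier G \<Longrightarrow> F (\<gamma> x \<otimes> g) = act (x, True) (F g)"
    and F_closed: "\<And>g. g \<in> carrier G \<Longrightarrow> fst (F g) \<in> carrier G"
    by (auto simp: Pi_iff mem_Times_iff)
  have FA: "F (a \<otimes> g) = (a \<otimes> fst (F g), snd (F g))" if "a \<in> A" "g \<in> carrier G" for a g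
    using F(2)[of "Some a" g] that by (simp add: X_mem \<phi>A act_def)
  have Ft: "F (t \<otimes> g) = (t \<otimes> fst (F g), snd (F g) \<noteq> (fst (F g) \<in> C))" if "g \<in> carrier G" for g
    using F(2)[of None g] that by (simp add: X_mem act_def t_def)
  have fst: "fst (F g) = g" if "g \<in> carrier G" for g
    using that
  proof (induction rule: ind[consumes 1])
    case (2 x g)
    consider "x \<in> A" | "x = t" | "x = inv t" using 2 by auto
    then show ?case
    proof cases
      case 3
      \<comment> \<open>\<open>Ft\<close> describes left multiplication by \<open>t\<close>; the
        case of \<open>inv t\<close> follows by cancelling \<open>t\<close>.\<close>
      have "t \<otimes> fst (F (inv t \<otimes> g)) = fst (F g)"
        using Ft[of "inv t \<otimes> g"] 2(2) t by (simp add: m_assoc[symmetric])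
      then have "fst (F (inv t \<otimes> g)) = inv t \<otimes> g"
        using 2 t F_closed[of "inv t \<otimes> g"] by (simp add: inv_solve_left)
      then show ?thesis using 3 by simp
    qed (use 2 in \<open>simp_all add: FA Ft\<close>)
  qed (simp add: F(1))
  have "\<forall>D. \<one> \<in> D \<longrightarrow> (\<forall>x\<in>A \<union> {t, inv t}. \<forall>g\<in>carrier G. g \<in> D \<longrightarrow> x \<otimes> g \<in> D) \<longrightarrow> carrier G \<subseteq> D"
    using ind[of _ "\<lambda>g. g \<in> D" for D] by (intro allI impI subsetI) blast
  then show ?thesis
    by (intro exI[of _ t] exI[of _ "\<lambda>g. snd (F g)"]) (simp add: t F(1) FA Ft fst)
qed

text \<open>The vertices form a single orbit of cosets \<open>g A\<close>, so \<open>G\<close>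
  itself serves as the set of points, with right multiplication by \<open>A\<close> as links; the
  edge of \<open>g\<close> joins \<open>g\<close> to \<open>g \<otimes> inv t\<close>.\<close>

lemma (in group) hnn_splitting_action:
  assumes dec: "hnn_decomposition G A C"
  shows "\<exists>(V :: 'a set) HS act. splitting_action G V HS act C"
proof -
  have A: "subgroup A G" and C: "subgroup C G" and CA: "C \<subseteq> A"
    using assms by (auto simp: hnn_decomposition_def)
  obtain t \<sigma> where t: "t \<in> carrier G" and gen: "\<forall>D. \<one> \<in> D \<longrightarrow>
      (\<forall>x\<in>A \<union> {t, inv t}. \<forall>g\<in>carrier G. g \<in> D \<longrightarrow> x \<otimes> g \<in> D) \<longrightarrow> carrier G \<subseteq> D"
    and \<sigma>': "\<not> \<sigma> \<one>" "\<forall>a\<in>A. \<forall>g\<in>carrier G. \<sigma> (a \<otimes> g) = \<sigma> g"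
      "\<forall>g\<in>carrier G. \<sigma> (t \<otimes> g) = (\<sigma> g \<noteq> (g \<in> C))"
    using hnn_cocycle[OF dec] by (elim exE conjE)
  note \<sigma> = \<sigma>'(1) \<sigma>'(2,3)[rule_format]
  have memA: "a \<in> A \<Longrightarrow> a \<in> carrier G" and invA: "a \<in> A \<Longrightarrow> inv a \<in> A" for a
    using subgroup.mem_carrier[OF A] subgroup.m_inv_closed[OF A] by blast+
  have invC: "inv g \<in> C \<longleftrightarrow> g \<in> C" if "g \<in> carrier G" for g
    using that subgroup.m_inv_closed[OF C] by (metis inv_inv)
  let ?L = "{(g, g \<otimes> a) | g a. g \<in> carrier G \<and> a \<in> A}"
  let ?S = "{g \<in> carrier G. \<sigma> (inv g)}"
  interpret edge_cut G "carrier G" "(\<otimes>)" ?L \<one> "inv t" C ?S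
  proof
    fix c assume "c \<in> C"
    then show "(\<one>, c \<otimes> \<one>) \<in> ?L"
      using CA memA by (auto intro!: exI[of _ c] simp: subset_eq)
  next
    fix D p assume D: "D \<subseteq> carrier G" "p \<in> D" "\<And>p q. (p, q) \<in> ?L \<Longrightarrow> (p \<in> D) = (q \<in> D)"
      "\<And>g. g \<in> carrier G \<Longrightarrow> (g \<otimes> \<one> \<in> D) = (g \<otimes> inv t \<in> D)"
    have step: "g \<otimes> x \<in> D \<longleftrightarrow> g \<in> D" if g: "g \<in> carrier G" and x: "x \<in> A \<union> {t, inv t}" for g x
    proof -
      consider "x \<in> A" | "x = t" | "x = inv t" using x by auto
      then show ?thesis
      proof cases
        case 1
        then have "(g, g \<otimes> x) \<in> ?L" using g by blast
        then show ?thesis using D(3) by blast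
      next
        case 2
        then show ?thesis using D(4)[of "g \<otimes> t"] g t by (simp add: m_assoc)
      next
        case 3
        then show ?thesis using D(4)[OF g] g by simp
      qed
    qed
    let ?E = "{h \<in> carrier G. \<forall>g\<in>carrier G. g \<otimes> h \<in> D \<longleftrightarrow> g \<in> D}"
    have "x \<otimes> h \<in> ?E" if x: "x \<in> A \<union> {t, inv t}" and h: "h \<in> ?E" for x h
    proof -
      have x': "x \<in> carrier G" using x memA t by auto
      have "g \<otimes> (x \<otimes> h) \<in> D \<longleftrightarrow> g \<in> D" if g: "g \<in> carrier G" for g
        using h x' g step[OF g x] by (simp add: m_assoc[symmetric])
      then show ?thesis using x' h by simp
    qed
    then have "carrier G \<subseteq> ?E" using gen[rule_format, of ?E] by simp
    then have all: "g \<otimes> h \<in> D \<longleftrightarrow> g \<in> D" if "h \<in> carrier G" "g \<in> carrier G" for g h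
      using that by blast
    have base: "g \<in> D \<longleftrightarrow> \<one> \<in> D" if "g \<in> carrier G" for g
      using all[OF that one_closed] that by simp
    then show "D = carrier G" using D(1,2) by blast
  next
    fix p q assume "(p, q) \<in> ?L"
    then obtain g x where gx: "q = p \<otimes> x" "p \<in> carrier G" "x \<in> A" by blast
    then show "p \<in> ?S \<longleftrightarrow> q \<in> ?S"
      using \<sigma>(2)[of "inv x" "inv p"] invA memA by (auto simp: inv_mult_group)
  next
    fix k p q assume k: "k \<in> carrier G" and "(p, q) \<in> ?L"
    then obtain x where gx: "q = p \<otimes> x" "p \<in> carrier G" "x \<in> A" by blast
    then have "k \<otimes> (p \<otimes> x) = k \<otimes> p \<otimes> x" using k memA by (simp add: m_assoc)
    then show "(k \<otimes> p, k \<otimes> q) \<in> ?L" using k gx by auto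
  next
    fix g assume "g \<in> carrier G"
    then show "((g \<otimes> \<one> \<in> ?S) = (g \<otimes> inv t \<in> ?S)) = (g \<notin> C)"
      using \<sigma>(3)[of "inv g"] invC t by (auto simp: inv_mult_group)
  qed (use subgroup.mem_carrier[OF C] subgroup.m_closed[OF C] subgroup.one_closed[OF C]
    subgroup.m_inv_closed[OF C] t in \<open>auto simp: m_assoc intro: memA\<close>)
  \<comment> \<open>\<open>\<sigma>\<close> vanishes on \<open>A\<close>, hence on \<open>C\<close>,
    but not at \<open>t\<close>.\<close>
  have "\<sigma> t" using \<sigma>(3)[of \<one>] \<sigma>(1) t subgroup.one_closed[OF C] by simp
  have "t \<notin> C"
  proof
    assume "t \<in> C"
    then have "\<not> \<sigma> t" using \<sigma>(2)[of t \<one>] \<sigma>(1) t CA by auto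
    then show False using \<open>\<sigma> t\<close> by simp
  qed
  then have "inv t \<notin> C" using invC t by simp
  then have "\<not> \<sigma> (inv t)" using \<sigma>(3)[of "inv t"] \<sigma>(1) t by simp
  note SS = side_S
  have si: "side (inv t) ((\<otimes>) (inv t) ` ?S)"
    using side_mv[OF _ one_closed SS, of "inv t"] t by simp
  \<comment> \<open>The quadrant between the complement of \<open>?S\<close> and the translate of
    \<open>?S\<close> by \<open>inv t\<close> contains neither bounding edge. Its emptiness makes
    \<open>inv t\<close> shrink \<open>?S\<close>.\<close>
  have "(carrier G - ?S) \<inter> (\<otimes>) (inv t) ` ?S = {}"
  proof (rule quadrant_empty[OF one_closed side_compl[OF SS] _ _ si])
    have "\<one> \<notin> (\<otimes>) (inv t) ` ?S"
      using t \<open>\<not> \<sigma> (inv t)\<close> by (subst mem_image_mv) auto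
    then show "\<one> \<otimes> \<one> \<notin> (\<otimes>) (inv t) ` ?S" by simp
  qed (use t \<open>\<sigma> t\<close> \<open>inv t \<notin> C\<close> in auto)
  moreover have "(\<otimes>) (inv t) ` ?S \<subseteq> carrier G"
    using subset[OF act_closed[OF _ S_in_sides, of "inv t"]] t by simp
  ultimately have "(\<otimes>) (inv t) ` ?S \<subseteq> ?S" by blast
  moreover have "(\<otimes>) (inv t) ` ?S \<noteq> ?S"
    using image_mv_eq_imp[OF _ one_closed SS, of "inv t"] SS \<open>inv t \<notin> C\<close> t by auto
  ultimately have "(\<otimes>) (inv t) ` ?S \<subset> ?S" by (rule psubsetI)
  then have "?S \<subset> (\<otimes>) t ` ?S" using act_inv_psubset[OF t S_in_sides S_in_sides] by simp
  then have "splitting_action G (carrier G) sides (\<lambda>g. (`) ((\<otimes>) g)) C"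
    using S_in_sides t by (intro splitting_actionI) auto
  then show ?thesis by blast
qed

section \<open>Graphs and right-angled Artin groups\<close>

lemma arcs_ends_induce_subgraph:
  "arcs_ends (G \<restriction> S) = {(u, v). u \<in> S \<and> v \<in> S \<and> u \<rightarrow>\<^bsub>G\<^esub> v}"
  by (auto simp: arcs_ends_conv)

context graph
begin

lemma graph_induce:
  assumes "S \<subseteq> verts G"
  shows "graph (G \<restriction> S)"
proof -
  have ind: "induced_subgraph (G \<restriction> S) G" using assms by (rule induced_induce)
  interpret D: digraph "G \<restriction> S" by (rule digraphI_induced[OF ind])
  show ?thesis by (rule D.graphI[OF induced_graph_imp_symmetric[OF sym_arcs ind]])
qed

lemma finite_sccs: "finite sccs"
proof -
  have "finite (verts ` sccs)" using finite_sccs_verts by (simp add: sccs_verts_conv)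
  then show ?thesis using inj_on_verts_sccs by (rule finite_imageD)
qed

lemma not_disconnected_imp_reachable:
  assumes "\<not> disconnected G" "u \<in> verts G" "v \<in> verts G"
  shows "u \<rightarrow>\<^sup>*\<^bsub>G\<^esub> v"
proof -
  let ?c = "\<lambda>u. G \<restriction> {v. u \<rightarrow>\<^sup>*\<^bsub>G\<^esub> v}"
  have c: "?c u \<in> sccs" "?c v \<in> sccs" using assms induce_reachable_is_in_sccs by auto
  have "?c u = ?c v"
  proof (rule ccontr)
    assume "?c u \<noteq> ?c v"
    then have "card {?c u, ?c v} = 2" by simp
    moreover have "card {?c u, ?c v} \<le> card sccs" using c finite_sccs by (intro card_mono) auto
    ultimately show False using assms(1) by (simp add: disconnected_def)
  qed
  then have "verts (?c u) = verts (?c v)" by simp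
  then show ?thesis using assms(3) by auto
qed

lemma propagate_connected:
  assumes "W \<subseteq> verts G" "\<not> disconnected (G \<restriction> W)" "u \<in> W" "P u" "w \<in> W"
    and "\<And>u v. u \<in> W \<Longrightarrow> v \<in> W \<Longrightarrow> u \<rightarrow>\<^bsub>G\<^esub> v \<Longrightarrow> P u \<Longrightarrow> P v"
  shows "P w"
proof -
  interpret W: graph "G \<restriction> W" by (rule graph_induce[OF assms(1)])
  have "u \<rightarrow>\<^sup>*\<^bsub>G \<restriction> W\<^esub> w" using W.not_disconnected_imp_reachable assms by simp
  then show ?thesis
    using assms(4)
  proof (induction rule: W.reachable_induct)
    case (step x y)
    then show ?case using assms(6)[of x y] by (auto simp: arcs_ends_induce_subgraph)
  qed
qed

lemma complete_induce:
  assumes "S \<subseteq> verts G" "\<And>u v. u \<in> S \<Longrightarrow> v \<in> S \<Longrightarrow> u \<noteq> v \<Longrightarrow> u \<rightarrow>\<^bsub>G\<^esub> v"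
  shows "K\<^bsub>card S\<^esub> (G \<restriction> S)"
  unfolding complete_digraph_def
  using assms graph_induce[OF assms(1)] adj_not_same by (auto simp: arcs_ends_induce_subgraph)

lemma not_clique_nonadjacent:
  assumes "\<not> clique G"
  shows "\<exists>u\<in>verts G. \<exists>v\<in>verts G. u \<noteq> v \<and> \<not> u \<rightarrow>\<^bsub>G\<^esub> v"
proof (rule ccontr)
  assume "\<not> ?thesis"
  then have "K\<^bsub>card (verts G)\<^esub> G"
    unfolding complete_digraph_def using adj_not_same adj_in_verts graph_axioms by auto
  then show False using assms by (auto simp: clique_def)
qed

text \<open>A link that is a clique with at most \<open>k\<close> vertices does not separate, but
  \<open>v\<close> is isolated once it is removed. So the link contains all vertices other than
  \<open>v\<close>, and the whole graph is a clique.\<close>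

lemma card_link_greater:
  assumes "\<not> clique G" "\<And>j. j \<le> k \<Longrightarrow> \<not> (\<exists>S. separating_clique G j S)" "v \<in> verts G"
    and link: "\<And>u w. v \<rightarrow>\<^bsub>G\<^esub> u \<Longrightarrow> v \<rightarrow>\<^bsub>G\<^esub> w \<Longrightarrow> u \<noteq> w \<Longrightarrow> u \<rightarrow>\<^bsub>G\<^esub> w"
  shows "k < card {u. v \<rightarrow>\<^bsub>G\<^esub> u}"
proof (rule ccontr)
  let ?L = "{u. v \<rightarrow>\<^bsub>G\<^esub> u}"
  have L: "?L \<subseteq> verts G" using adj_in_verts by auto
  assume "\<not> ?thesis"
  then have "\<not> separating_clique G (card ?L) ?L" using assms(2) by auto
  then have nd: "\<not> disconnected (G \<restriction> (verts G - ?L))"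
    using complete_induce[OF L] link L by (auto simp: separating_clique_def)
  have v: "v \<in> verts G - ?L" using assms(3) adj_not_same by auto
  have "w = v" if "w \<in> verts G - ?L" for w
    using propagate_connected[OF _ nd v, of "\<lambda>w. w = v" w] that by auto
  then have "u \<rightarrow>\<^bsub>G\<^esub> w" if "u \<in> verts G" "w \<in> verts G" "u \<noteq> w" for u w
    using that link[of u w] arcs_ends_symmetric[OF sym_arcs] by (cases "u = v"; cases "w = v") blast+
  then show False using not_clique_nonadjacent[OF assms(1)] by blast
qed

end

section \<open>Generators, characters and commuting powers in right-angled Artin groups\<close>

abbreviation raag_gen :: "('v, 'e) pre_digraph \<Rightarrow> 'v \<Rightarrow> 'v word set"
  where "raag_gen \<Gamma> \<equiv> pres_gen (verts \<Gamma>)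
    {([(u, True), (v, True)], [(v, True), (u, True)]) | u v. u \<rightarrow>\<^bsub>\<Gamma>\<^esub> v}"

lemma group_raag: "group (raag \<Gamma>)"
  unfolding raag_def by (rule group_presented_group)

lemma raag_gen_closed: "v \<in> verts \<Gamma> \<Longrightarrow> raag_gen \<Gamma> v \<in> carrier (raag \<Gamma>)"
  unfolding raag_def by (rule pres_gen_closed)

lemma raag_hom:
  assumes "group K" "\<gamma> \<in> verts \<Gamma> \<rightarrow> carrier K"
    and "\<And>u v. u \<in> verts \<Gamma> \<Longrightarrow> v \<in> verts \<Gamma> \<Longrightarrow> u \<rightarrow>\<^bsub>\<Gamma>\<^esub> v \<Longrightarrow> \<gamma> u \<otimes>\<^bsub>K\<^esub> \<gamma> v = \<gamma> v \<otimes>\<^bsub>K\<^esub> \<gamma> u"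
  shows "\<exists>\<theta> \<in> hom (raag \<Gamma>) K. \<forall>v\<in>verts \<Gamma>. \<theta> (raag_gen \<Gamma> v) = \<gamma> v"
proof -
  interpret K: group K by fact
  have mem: "\<gamma> u \<in> carrier K" if "u \<in> verts \<Gamma>" for u using assms(2) that by auto
  show ?thesis unfolding raag_def
    by (rule K.presented_group_hom[OF assms(2)]) (auto simp: letter_val_def mem intro: assms(3))
qed

lemma raag_gen_commute:
  assumes "u \<in> verts \<Gamma>" "v \<in> verts \<Gamma>" "u \<rightarrow>\<^bsub>\<Gamma>\<^esub> v"
  shows "raag_gen \<Gamma> u \<otimes>\<^bsub>raag \<Gamma>\<^esub> raag_gen \<Gamma> v = raag_gen \<Gamma> v \<otimes>\<^bsub>raag \<Gamma>\<^esub> raag_gen \<Gamma> u"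
proof -
  let ?R = "{([(u, True), (v, True)], [(v, True), (u, True)]) | u v. u \<rightarrow>\<^bsub>\<Gamma>\<^esub> v}"
  have w: "[(u, True)] \<in> words (verts \<Gamma>)" "[(v, True)] \<in> words (verts \<Gamma>)" using assms by auto
  have "([(u, True), (v, True)], [(v, True), (u, True)]) \<in> pres_rel (verts \<Gamma>) ?R"
    using pres_rel.relation[of "[]" "verts \<Gamma>" "[]" "[(u, True), (v, True)]" "[(v, True), (u, True)]" ?R]
      assms by auto
  then show ?thesis
    using presented_group_mult[OF w, of ?R] presented_group_mult[OF w(2,1), of ?R]
      equiv_class_eq[OF equiv_pres_rel]
    unfolding raag_def pres_gen_def by fastforce
qed

lemma raag_character:
  assumes "v \<in> verts \<Gamma>"
  shows "\<exists>\<chi> \<in> hom (raag \<Gamma>) integer_group. \<forall>u\<in>verts \<Gamma>. \<chi> (raag_gen \<Gamma> u) = (if u = v then 1 else 0)"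
  by (rule raag_hom) auto

text \<open>The integral Heisenberg group: \<open>(a, b, c)\<close> is the upper unitriangular
  matrix with \<open>a\<close> and \<open>b\<close> next to the diagonal and \<open>c\<close> in the
  corner.\<close>

definition heisenberg_group :: "(int \<times> int \<times> int) monoid"
  where "heisenberg_group = \<lparr>carrier = UNIV,
    monoid.mult = (\<lambda>(a, b, c) (a', b', c'). (a + a', b + b', c + c' + a * b')), one = (0, 0, 0)\<rparr>"

lemma group_heisenberg_group: "group heisenberg_group"
proof (rule groupI)
  fix x :: "int \<times> int \<times> int"
  obtain a b c where "x = (a, b, c)" by (cases x)
  then have "(- a, - b, a * b - c) \<otimes>\<^bsub>heisenberg_group\<^esub> x = \<one>\<^bsub>heisenberg_group\<^esub>"
    by (simp add: heisenberg_group_def)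
  then show "\<exists>y\<in>carrier heisenberg_group. y \<otimes>\<^bsub>heisenberg_group\<^esub> x = \<one>\<^bsub>heisenberg_group\<^esub>"
    by (rule bexI) (simp add: heisenberg_group_def)
qed (auto simp: heisenberg_group_def algebra_simps)

lemma heisenberg_pow:
  "(1, 0, 0) [^]\<^bsub>heisenberg_group\<^esub> (n::nat) = (int n, 0, 0)"
  "(0, 1, 0) [^]\<^bsub>heisenberg_group\<^esub> (n::nat) = (0, int n, 0)"
proof -
  interpret group heisenberg_group by (rule group_heisenberg_group)
  show "(1, 0, 0) [^]\<^bsub>heisenberg_group\<^esub> (n::nat) = (int n, 0, 0)"
    by (induction n) (simp_all, simp_all add: heisenberg_group_def)
  show "(0, 1, 0) [^]\<^bsub>heisenberg_group\<^esub> (n::nat) = (0, int n, 0)"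
    by (induction n) (simp_all, simp_all add: heisenberg_group_def)
qed

text \<open>For non-adjacent \<open>u\<close> and \<open>v\<close>, a homomorphism to the Heisenberg
  group sends them to \<open>(1, 0, 0)\<close> and \<open>(0, 1, 0)\<close> and all other generators
  to the identity. The two products of the powers then differ by \<open>m * n\<close> in the
  corner.\<close>

lemma raag_powers_commute_imp_adjacent:
  fixes m n :: nat
  assumes "graph \<Gamma>" "u \<in> verts \<Gamma>" "v \<in> verts \<Gamma>" "u \<noteq> v" "0 < m" "0 < n"
    and comm: "raag_gen \<Gamma> u [^]\<^bsub>raag \<Gamma>\<^esub> m \<otimes>\<^bsub>raag \<Gamma>\<^esub> raag_gen \<Gamma> v [^]\<^bsub>raag \<Gamma>\<^esub> n =
      raag_gen \<Gamma> v [^]\<^bsub>raag \<Gamma>\<^esub> n \<otimes>\<^bsub>raag \<Gamma>\<^esub> raag_gen \<Gamma> u [^]\<^bsub>raag \<Gamma>\<^esub> m"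
  shows "u \<rightarrow>\<^bsub>\<Gamma>\<^esub> v"
proof (rule ccontr)
  interpret graph \<Gamma> by fact
  interpret A: group "raag \<Gamma>" by (rule group_raag)
  assume nadj: "\<not> u \<rightarrow>\<^bsub>\<Gamma>\<^esub> v"
  then have nadj': "\<not> v \<rightarrow>\<^bsub>\<Gamma>\<^esub> u" using arcs_ends_symmetric[OF sym_arcs] by blast
  let ?\<gamma> = "\<lambda>w. if w = u then (1, 0, 0) else if w = v then (0, 1, 0) else (0, 0, 0 :: int)"
  have "\<exists>\<theta> \<in> hom (raag \<Gamma>) heisenberg_group. \<forall>w\<in>verts \<Gamma>. \<theta> (raag_gen \<Gamma> w) = ?\<gamma> w"
  proof (rule raag_hom[OF group_heisenberg_group])
    show "?\<gamma> x \<otimes>\<^bsub>heisenberg_group\<^esub> ?\<gamma> y = ?\<gamma> y \<otimes>\<^bsub>heisenberg_group\<^esub> ?\<gamma> x"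
      if "x \<rightarrow>\<^bsub>\<Gamma>\<^esub> y" for x y
      using that nadj nadj' by (auto simp: heisenberg_group_def)
  qed (simp add: heisenberg_group_def)
  then obtain \<theta> where \<theta>: "\<theta> \<in> hom (raag \<Gamma>) heisenberg_group"
    "\<And>w. w \<in> verts \<Gamma> \<Longrightarrow> \<theta> (raag_gen \<Gamma> w) = ?\<gamma> w" by blast
  note gens = raag_gen_closed[OF assms(2)] raag_gen_closed[OF assms(3)]
  note pow = A.hom_nat_pow'[OF \<theta>(1) group_heisenberg_group]
  have "(int m, 0, 0) \<otimes>\<^bsub>heisenberg_group\<^esub> (0, int n, 0) =
      (0, int n, 0) \<otimes>\<^bsub>heisenberg_group\<^esub> (int m, 0, 0)"
    using arg_cong[OF comm, of \<theta>] gens assms(2-4)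
    by (simp add: hom_mult[OF \<theta>(1)] pow \<theta>(2) heisenberg_pow)
  then show False using assms(5,6) by (simp add: heisenberg_group_def)
qed

section \<open>Actions of right-angled Artin groups on half-spaces\<close>

text \<open>Finite index enters through \<open>N\<close>, a common exponent for \<open>H\<close> in
  the Artin group and for its image in \<open>G\<close>.\<close>

locale raag_splitting_action = splitting_action G V HS act C + \<Gamma>: graph \<Gamma>
  for G :: "('g, 'm) monoid_scheme" (structure) and V :: "'p set" and HS and act (infixr \<open>\<odot>\<close> 72)
    and C and \<Gamma> :: "('v, 'e) pre_digraph" +
  fixes H :: "'v word set set" and \<psi> :: "'v word set \<Rightarrow> 'g" and N k :: nat
  assumes not_clique: "\<not> clique \<Gamma>"
    and no_separating: "j \<le> k \<Longrightarrow> \<not> (\<exists>S. separating_clique \<Gamma> j S)"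
    and C: "subgroup C G"
    and C_iso: "G\<lparr>carrier := C\<rparr> \<cong> product_group {..<k} (\<lambda>_. integer_group)"
    and H: "subgroup H (raag \<Gamma>)"
    and \<psi>: "\<psi> \<in> hom (raag \<Gamma>\<lparr>carrier := H\<rparr>) G" "inj_on \<psi> H"
    and N_pos: "0 < N"
    and pow_in_H: "g \<in> carrier (raag \<Gamma>) \<Longrightarrow> g [^]\<^bsub>raag \<Gamma>\<^esub> N \<in> H"
    and pow_in_image: "z \<in> carrier G \<Longrightarrow> z [^] N \<in> \<psi> ` H"
begin

abbreviation A where "A \<equiv> raag \<Gamma>"

abbreviation gen where "gen \<equiv> raag_gen \<Gamma>"

sublocale A: group A by (rule group_raag)

lemma gen_closed [simp, intro]: "v \<in> verts \<Gamma> \<Longrightarrow> gen v \<in> carrier A"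
  by (rule raag_gen_closed)

sublocale H: group "A\<lparr>carrier := H\<rparr>"
  by (rule subgroup.subgroup_is_group[OF H group_raag])

lemma H_carrier: "a \<in> H \<Longrightarrow> a \<in> carrier A"
  by (rule subgroup.mem_carrier[OF H])

lemma \<psi>_closed [simp, intro]: "a \<in> H \<Longrightarrow> \<psi> a \<in> carrier G"
  using \<psi>(1) by (auto simp: hom_def)

lemma \<psi>_mult: "a \<in> H \<Longrightarrow> b \<in> H \<Longrightarrow> \<psi> (a \<otimes>\<^bsub>A\<^esub> b) = \<psi> a \<otimes> \<psi> b"
  using hom_mult[OF \<psi>(1)] by simp

lemma H_mult: "a \<in> H \<Longrightarrow> b \<in> H \<Longrightarrow> a \<otimes>\<^bsub>A\<^esub> b \<in> H"
  by (rule subgroup.m_closed[OF H])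

lemma H_inv: "a \<in> H \<Longrightarrow> inv\<^bsub>A\<^esub> a \<in> H"
  by (rule subgroup.m_inv_closed[OF H])

lemma \<psi>_inv: "a \<in> H \<Longrightarrow> \<psi> (inv\<^bsub>A\<^esub> a) = inv (\<psi> a)"
  using group_hom.hom_inv[of "A\<lparr>carrier := H\<rparr>" G \<psi> a] \<psi>(1) H.is_group is_group
    A.m_inv_consistent[OF H] by (simp add: group_hom_def group_hom_axioms_def)

lemma H_pow: "a \<in> H \<Longrightarrow> a [^]\<^bsub>A\<^esub> (n::nat) \<in> H"
  by (induction n) (auto simp: H_mult subgroup.one_closed[OF H])

lemma H_int_pow: "a \<in> H \<Longrightarrow> a [^]\<^bsub>A\<^esub> (n::int) \<in> H"
  using H.int_pow_closed[of a n] A.int_pow_consistent[OF H, of a n] by simp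

lemma \<psi>_one: "\<psi> \<one>\<^bsub>A\<^esub> = \<one>"
  using hom_one[OF \<psi>(1) H.is_group is_group] by simp

lemma \<psi>_pow: "a \<in> H \<Longrightarrow> \<psi> (a [^]\<^bsub>A\<^esub> (n::nat)) = \<psi> a [^] n"
  by (induction n) (auto simp: \<psi>_mult \<psi>_one H_pow)

lemma \<psi>_int_pow: "a \<in> H \<Longrightarrow> \<psi> (a [^]\<^bsub>A\<^esub> (n::int)) = \<psi> a [^] n"
  using hom_int_pow[OF \<psi>(1) _ H.is_group is_group, of a n] A.int_pow_consistent[OF H, of a n] by simp

lemma \<psi>_commute:
  assumes "a \<in> H" "b \<in> H"
  shows "\<psi> a \<otimes> \<psi> b = \<psi> b \<otimes> \<psi> a \<longleftrightarrow> a \<otimes>\<^bsub>A\<^esub> b = b \<otimes>\<^bsub>A\<^esub> a"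
  using assms inj_onD[OF \<psi>(2), of "a \<otimes>\<^bsub>A\<^esub> b" "b \<otimes>\<^bsub>A\<^esub> a"] by (auto simp: \<psi>_mult[symmetric] H_mult)

text \<open>Conjugation by \<open>x\<close> carries the stabilizer into \<open>C\<close>, and the
  \<open>\<theta> i\<close> are the coordinates of an isomorphism from \<open>C\<close> to Z^k.
  Separate coordinates are the form used by \<open>diagonal_characters_card_le\<close>.\<close>

lemma stab_embedding:
  assumes "h \<in> HS"
  shows "\<exists>\<theta> :: nat \<Rightarrow> 'g \<Rightarrow> int. (\<forall>i<k. \<theta> i \<in> hom (G\<lparr>carrier := stab h\<rparr>) integer_group) \<and>
    (\<forall>a\<in>stab h. (\<forall>i<k. \<theta> i a = 0) \<longrightarrow> a = \<one>)"
proof -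
  let ?Z = "product_group {..<k} (\<lambda>_. integer_group)"
  obtain x where x: "x \<in> carrier G" "\<And>g. g \<in> stab h \<Longrightarrow> inv x \<otimes> g \<otimes> x \<in> C"
    using stab_conj[OF assms] by blast
  obtain \<iota> where \<iota>: "\<iota> \<in> iso (G\<lparr>carrier := C\<rparr>) ?Z" using C_iso by (auto simp: is_iso_def)
  then have hom: "\<iota> \<in> hom (G\<lparr>carrier := C\<rparr>) ?Z" and inj: "inj_on \<iota> C"
    by (auto simp: iso_def bij_betw_def)
  interpret C: group "G\<lparr>carrier := C\<rparr>" by (rule subgroup.subgroup_is_group[OF C is_group])
  let ?\<kappa> = "\<lambda>g. inv x \<otimes> g \<otimes> x"
  have stab_carrier: "g \<in> carrier G" if "g \<in> stab h" for g using that by (simp add: stab_def)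
  have \<kappa>_mult: "?\<kappa> (g \<otimes> g') = ?\<kappa> g \<otimes> ?\<kappa> g'" if "g \<in> carrier G" "g' \<in> carrier G" for g g'
  proof -
    have "x \<otimes> (inv x \<otimes> (g' \<otimes> x)) = g' \<otimes> x" using x that by (simp add: m_assoc[symmetric])
    then show ?thesis using x that by (simp add: m_assoc)
  qed
  let ?\<theta> = "\<lambda>i g. \<iota> (?\<kappa> g) i"
  have "?\<theta> i \<in> hom (G\<lparr>carrier := stab h\<rparr>) integer_group" if "i < k" for i
  proof (rule homI)
    fix g g' assume "g \<in> carrier (G\<lparr>carrier := stab h\<rparr>)" "g' \<in> carrier (G\<lparr>carrier := stab h\<rparr>)"
    then have "\<iota> (?\<kappa> (g \<otimes> g')) = \<iota> (?\<kappa> g) \<otimes>\<^bsub>?Z\<^esub> \<iota> (?\<kappa> g')"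
      using hom_mult[OF hom, of "?\<kappa> g" "?\<kappa> g'"] x(2) stab_carrier by (simp add: \<kappa>_mult)
    then show "?\<theta> i (g \<otimes>\<^bsub>G\<lparr>carrier := stab h\<rparr>\<^esub> g') = ?\<theta> i g \<otimes>\<^bsub>integer_group\<^esub> ?\<theta> i g'"
      using that by simp
  qed simp
  moreover have "a = \<one>" if a: "a \<in> stab h" "\<And>i. i < k \<Longrightarrow> ?\<theta> i a = 0" for a
  proof -
    have "\<iota> (?\<kappa> a) \<in> carrier ?Z" using hom x(2)[OF a(1)] by (auto simp: hom_def)
    \<comment> \<open>Elements of the product group are extensional functions, so they are
      determined by their coordinates below \<open>k\<close>.\<close>
    then have "\<iota> (?\<kappa> a) = (\<lambda>i\<in>{..<k}. 0)" using a(2) by (auto simp: PiE_def extensional_def)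
    also have "\<dots> = \<iota> \<one>"
      using hom_one[OF hom C.is_group] by simp
    finally have "?\<kappa> a = \<one>"
      using inj_onD[OF inj] x(2)[OF a(1)] subgroup.one_closed[OF C] by blast
    then have "a = x \<otimes> \<one> \<otimes> inv x"
      using x(1) stab_carrier[OF a(1)] by (metis inv_closed inv_inv inv_solve_left inv_solve_right m_assoc m_closed one_closed)
    then show ?thesis using x(1) by simp
  qed
  ultimately show ?thesis by (intro exI[of _ ?\<theta>]) auto
qed

text \<open>All coordinates from \<open>stab_embedding\<close> vanish on
  \<open>inv (b \<otimes> a) \<otimes> (a \<otimes> b)\<close>.\<close>

lemma stab_commute:
  assumes "h \<in> HS" "a \<in> stab h" "b \<in> stab h"
  shows "a \<otimes> b = b \<otimes> a"
proof -
  obtain \<theta> :: "nat \<Rightarrow> 'g \<Rightarrow> int" where \<theta>: "\<And>i. i < k \<Longrightarrow> \<theta> i \<in> hom (G\<lparr>carrier := stab h\<rparr>) integer_group"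
    "\<And>a. a \<in> stab h \<Longrightarrow> (\<And>i. i < k \<Longrightarrow> \<theta> i a = 0) \<Longrightarrow> a = \<one>"
    using stab_embedding[OF assms(1)] by blast
  note S = subgroup_stab[OF assms(1)]
  have car: "a \<in> carrier G" "b \<in> carrier G" using assms by (auto simp: stab_def)
  have mult: "\<theta> i (x \<otimes> y) = \<theta> i x + \<theta> i y" if "i < k" "x \<in> stab h" "y \<in> stab h" for i x y
    using hom_mult[OF \<theta>(1)[OF that(1)], of x y] that by simp
  have ab: "a \<otimes> b \<in> stab h" "b \<otimes> a \<in> stab h" using assms subgroup.m_closed[OF S] by auto
  then have inv: "inv (b \<otimes> a) \<in> stab h" using subgroup.m_inv_closed[OF S] by blast
  have "\<theta> i (inv (b \<otimes> a) \<otimes> (a \<otimes> b)) = 0" if "i < k" for i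
  proof -
    have "\<theta> i (inv (b \<otimes> a) \<otimes> (a \<otimes> b)) = \<theta> i (inv (b \<otimes> a) \<otimes> (b \<otimes> a))"
      using that assms ab inv by (simp add: mult)
    also have "\<dots> = \<theta> i \<one>" using car by simp
    also have "\<dots> = 0" using mult[OF that, of \<one> \<one>] subgroup.one_closed[OF S] by simp
    finally show ?thesis .
  qed
  then have "inv (b \<otimes> a) \<otimes> (a \<otimes> b) = \<one>"
    using \<theta>(2) inv ab subgroup.m_closed[OF S] by blast
  then have "inv (a \<otimes> b) = inv (b \<otimes> a)" using car by (intro inv_equality) auto
  then show ?thesis using car by (metis inv_inv m_closed)
qed

text \<open>This is the exponent sum of the generator \<open>v\<close>.\<close>

definition char :: "'v \<Rightarrow> 'v word set \<Rightarrow> int"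
  where "char v = (SOME \<chi>. \<chi> \<in> hom A integer_group \<and>
    (\<forall>u\<in>verts \<Gamma>. \<chi> (gen u) = (if u = v then 1 else 0)))"

lemma char:
  assumes "v \<in> verts \<Gamma>"
  shows "char v \<in> hom A integer_group"
    and "u \<in> verts \<Gamma> \<Longrightarrow> char v (gen u) = (if u = v then 1 else 0)"
proof -
  have "char v \<in> hom A integer_group \<and> (\<forall>u\<in>verts \<Gamma>. char v (gen u) = (if u = v then 1 else 0))"
    unfolding char_def
    by (rule someI_ex[of "\<lambda>\<chi>. \<chi> \<in> hom A integer_group \<and> (\<forall>u\<in>verts \<Gamma>. \<chi> (gen u) = (if u = v then 1 else 0))"])
      (use raag_character[OF assms] in blast)
  then show "char v \<in> hom A integer_group"
    and "u \<in> verts \<Gamma> \<Longrightarrow> char v (gen u) = (if u = v then 1 else 0)" by auto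
qed

text \<open>The inverse of \<open>\<psi>\<close> carries the exponent sums over to the part of
  \<open>stab h\<close> inside the image of \<open>H\<close>. There
  \<open>diagonal_characters_card_le\<close> compares them with the embedding of
  \<open>stab h\<close> in Z^k.\<close>

lemma card_le_rank:
  assumes "h \<in> HS" "F \<subseteq> verts \<Gamma>"
    and s: "\<And>u. u \<in> F \<Longrightarrow> s u \<in> H" "\<And>u. u \<in> F \<Longrightarrow> \<psi> (s u) \<in> stab h"
    and diag: "\<And>u v. u \<in> F \<Longrightarrow> v \<in> F \<Longrightarrow> char u (s v) = 0 \<longleftrightarrow> u \<noteq> v"
  shows "card F \<le> k"
proof -
  obtain \<theta> :: "nat \<Rightarrow> 'g \<Rightarrow> int" where \<theta>: "\<And>i. i < k \<Longrightarrow> \<theta> i \<in> hom (G\<lparr>carrier := stab h\<rparr>) integer_group"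
    "\<And>a. a \<in> stab h \<Longrightarrow> (\<And>i. i < k \<Longrightarrow> \<theta> i a = 0) \<Longrightarrow> a = \<one>"
    using stab_embedding[OF assms(1)] by blast
  note S = subgroup_stab[OF assms(1)]
  have im: "subgroup (\<psi> ` H) G"
    using group_hom.img_is_subgroup[of "A\<lparr>carrier := H\<rparr>" G \<psi>] \<psi>(1) H.is_group is_group
    by (simp add: group_hom_def group_hom_axioms_def)
  let ?K = "stab h \<inter> \<psi> ` H"
  let ?inv = "inv_into H \<psi>"
  have inv: "?inv (\<psi> a) = a" if "a \<in> H" for a using that \<psi>(2) by simp
  show ?thesis
  proof (rule diagonal_characters_card_le[where \<theta> = \<theta> and K = ?K and \<chi> = "\<lambda>v b. char v (?inv b)"
        and s = "\<lambda>v. \<psi> (s v)"])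
    show "finite F" using assms(2) by (rule finite_subset) simp
    show "subgroup ?K G" using S im by (rule subgroups_Inter_pair)
    show "\<theta> i \<in> hom (G\<lparr>carrier := ?K\<rparr>) integer_group" if "i < k" for i
      using \<theta>(1)[OF that] by (auto simp: hom_def)
    show "(\<lambda>b. char v (?inv b)) \<in> hom (G\<lparr>carrier := ?K\<rparr>) integer_group" if "v \<in> F" for v
    proof (rule homI)
      fix b c assume "b \<in> carrier (G\<lparr>carrier := ?K\<rparr>)" "c \<in> carrier (G\<lparr>carrier := ?K\<rparr>)"
      then obtain b' c' where bc: "b' \<in> H" "c' \<in> H" "b = \<psi> b'" "c = \<psi> c'" by auto
      have "v \<in> verts \<Gamma>" using that assms(2) by auto
      then have "char v (b' \<otimes>\<^bsub>A\<^esub> c') = char v b' + char v c'"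
        using hom_mult[OF char(1)] bc H_carrier by simp
      then show "char v (?inv (b \<otimes>\<^bsub>G\<lparr>carrier := ?K\<rparr>\<^esub> c)) =
          char v (?inv b) \<otimes>\<^bsub>integer_group\<^esub> char v (?inv c)"
        using bc inv H_mult by (simp add: \<psi>_mult[symmetric])
    qed simp
  qed (use \<theta>(2) s diag inv in auto)
qed

section \<open>Conjugates of powers of generators and their action\<close>

definition elt :: "'v word set \<Rightarrow> 'v \<Rightarrow> 'v word set"
  where "elt g v = g \<otimes>\<^bsub>A\<^esub> gen v [^]\<^bsub>A\<^esub> N \<otimes>\<^bsub>A\<^esub> inv\<^bsub>A\<^esub> g"

text \<open>The element is also the \<open>N\<close>-th power of a conjugate of
  \<open>gen v\<close>, and all \<open>N\<close>-th powers lie in \<open>H\<close>.\<close>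

lemma elt_H:
  assumes "g \<in> carrier A" "v \<in> verts \<Gamma>"
  shows "elt g v \<in> H"
  using pow_in_H[of "g \<otimes>\<^bsub>A\<^esub> gen v \<otimes>\<^bsub>A\<^esub> inv\<^bsub>A\<^esub> g"] assms by (simp add: elt_def A.conj_nat_pow)

lemma elt_carrier: "g \<in> carrier A \<Longrightarrow> v \<in> verts \<Gamma> \<Longrightarrow> elt g v \<in> carrier A"
  by (simp add: elt_def)

definition X :: "'v word set \<Rightarrow> 'v \<Rightarrow> 'g"
  where "X g v = \<psi> (elt g v)"

lemma X_closed [simp, intro]: "g \<in> carrier A \<Longrightarrow> v \<in> verts \<Gamma> \<Longrightarrow> X g v \<in> carrier G"
  by (simp add: X_def elt_H)

lemma gen_pow_commute:
  assumes "u \<in> verts \<Gamma>" "v \<in> verts \<Gamma>" "u = v \<or> u \<rightarrow>\<^bsub>\<Gamma>\<^esub> v"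
  shows "gen u [^]\<^bsub>A\<^esub> (m::nat) \<otimes>\<^bsub>A\<^esub> gen v = gen v \<otimes>\<^bsub>A\<^esub> gen u [^]\<^bsub>A\<^esub> m"
  using assms raag_gen_commute[of u \<Gamma> v] by (intro A.group_commutes_pow) auto

lemma X_commute:
  assumes "g \<in> carrier A" "u \<in> verts \<Gamma>" "v \<in> verts \<Gamma>" "u = v \<or> u \<rightarrow>\<^bsub>\<Gamma>\<^esub> v"
  shows "X g u \<otimes> X g v = X g v \<otimes> X g u"
proof -
  have "gen u [^]\<^bsub>A\<^esub> N \<otimes>\<^bsub>A\<^esub> gen v [^]\<^bsub>A\<^esub> N = gen v [^]\<^bsub>A\<^esub> N \<otimes>\<^bsub>A\<^esub> gen u [^]\<^bsub>A\<^esub> N"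
    using A.group_commutes_pow[OF gen_pow_commute[OF assms(2-4), of N, symmetric], of N] assms by simp
  then show ?thesis
    unfolding X_def using assms by (simp add: \<psi>_commute elt_H) (simp add: elt_def A.conj_commute_iff)
qed

text \<open>Injectivity of \<open>\<psi>\<close> and cancellation of the conjugation by
  \<open>g\<close> reduce this to powers of generators.\<close>

lemma X_powers_commute_imp_adjacent:
  fixes c d :: nat
  assumes "g \<in> carrier A" "u \<in> verts \<Gamma>" "v \<in> verts \<Gamma>" "u \<noteq> v" "0 < c" "0 < d"
    and "X g u [^] c \<otimes> X g v [^] d = X g v [^] d \<otimes> X g u [^] c"
  shows "u \<rightarrow>\<^bsub>\<Gamma>\<^esub> v"
proof -
  have "elt g u [^]\<^bsub>A\<^esub> c \<otimes>\<^bsub>A\<^esub> elt g v [^]\<^bsub>A\<^esub> d = elt g v [^]\<^bsub>A\<^esub> d \<otimes>\<^bsub>A\<^esub> elt g u [^]\<^bsub>A\<^esub> c"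
    using assms by (simp add: X_def \<psi>_pow[symmetric] elt_H \<psi>_commute H_pow)
  then have "gen u [^]\<^bsub>A\<^esub> (N * c) \<otimes>\<^bsub>A\<^esub> gen v [^]\<^bsub>A\<^esub> (N * d) = gen v [^]\<^bsub>A\<^esub> (N * d) \<otimes>\<^bsub>A\<^esub> gen u [^]\<^bsub>A\<^esub> (N * c)"
    using assms(1-3) by (simp add: elt_def A.conj_nat_pow A.nat_pow_pow A.conj_commute_iff)
  then show ?thesis
    using assms N_pos by (intro raag_powers_commute_imp_adjacent[OF \<Gamma>.graph_axioms]) auto
qed

lemma char_elt:
  assumes "g \<in> carrier A" "u \<in> verts \<Gamma>" "w \<in> verts \<Gamma>"
  shows "char w (elt g u) = (if u = w then int N else 0)"
proof -
  note \<chi> = char(1)[OF assms(3)]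
  have "char w (inv\<^bsub>A\<^esub> g) = - char w g"
    using group_hom.hom_inv[of A integer_group "char w" g] \<chi> assms(1) A.is_group
    by (simp add: group_hom_def group_hom_axioms_def)
  then show ?thesis
    using assms char(2)[OF assms(3,2)]
    by (simp add: elt_def hom_mult[OF \<chi>] A.hom_nat_pow'[OF \<chi> group_integer_group])
qed

text \<open>The empty set would lie in every translate of a half-space, against
  \<open>descending_escapes\<close>.\<close>

lemma HS_nonempty: "h \<in> HS \<Longrightarrow> h \<noteq> {}"
  using hyperbolic descending_escapes by blast

text \<open>If some \<open>X g v\<close> is hyperbolic, then the link of \<open>v\<close> is a clique with at most \<open>k\<close> vertices:
  the generators in the link act on the axis of \<open>X g v\<close> by translations, so suitable powers of them
  agree up to powers of \<open>X g v\<close> with elements of the abelian group \<open>stab h\<close>.\<close>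

lemma X_elliptic:
  assumes g: "g \<in> carrier A" and v: "v \<in> verts \<Gamma>" and h: "h \<in> HS"
  shows "\<not> X g v \<odot> h \<subset> h"
proof
  assume hyp: "X g v \<odot> h \<subset> h"
  let ?x = "X g v" and ?L = "{u. v \<rightarrow>\<^bsub>\<Gamma>\<^esub> u}"
  have x: "?x \<in> carrier G" using g v by simp
  have L: "u \<in> verts \<Gamma>" if "u \<in> ?L" for u using that \<Gamma>.adj_in_verts by auto
  have comm: "?x \<otimes> X g u = X g u \<otimes> ?x" if "u \<in> ?L" for u
    using X_commute[OF g v L[OF that]] that by simp
  have "\<exists>a c. 0 < c \<and> ?x [^] (a::int) \<otimes> X g u [^] (c::nat) \<in> stab h" if "u \<in> ?L" for u
    using hyperbolic_centralizer_stab[OF x h hyp _ comm[OF that]] g L[OF that] by simp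
  then obtain a :: "'v \<Rightarrow> int" and c :: "'v \<Rightarrow> nat" where
    ac: "\<And>u. u \<in> ?L \<Longrightarrow> 0 < c u \<and> ?x [^] a u \<otimes> X g u [^] c u \<in> stab h" by metis
  have "u \<rightarrow>\<^bsub>\<Gamma>\<^esub> w" if u: "v \<rightarrow>\<^bsub>\<Gamma>\<^esub> u" and w: "v \<rightarrow>\<^bsub>\<Gamma>\<^esub> w" and "u \<noteq> w" for u w
  proof -
    let ?y = "X g u [^] c u" and ?z = "X g w [^] c w"
    let ?p = "?x [^] a u" and ?q = "?x [^] a w"
    have yz: "?y \<in> carrier G" "?z \<in> carrier G" "?p \<in> carrier G" "?q \<in> carrier G"
      using g L u w x by auto
    have xy: "y [^] n \<otimes> ?x [^] b = ?x [^] b \<otimes> y [^] n"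
      if "y \<in> carrier G" "?x \<otimes> y = y \<otimes> ?x" for y and n :: nat and b :: int
      using that x commute_int_pow[of ?x "y [^] n" b] group_commutes_pow[OF that(2)[symmetric] that(1) x, of n]
      by simp
    have yq: "?y \<otimes> ?q = ?q \<otimes> ?y" and zp: "?z \<otimes> ?p = ?p \<otimes> ?z"
      using xy comm u w g L by simp_all
    have pq: "?p \<otimes> ?q = ?q \<otimes> ?p"
      using int_pow_mult[OF x, of "a u" "a w"] int_pow_mult[OF x, of "a w" "a u"] by (simp add: add.commute)
    \<comment> \<open>\<open>?p\<close> and \<open>?q\<close> are powers of \<open>?x\<close>, so
      they can be moved to the front and cancelled from the commutation of
      \<open>?p \<otimes> ?y\<close> with \<open>?q \<otimes> ?z\<close>, which both lie in
      \<open>stab h\<close>.\<close>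
    have "(?p \<otimes> ?q) \<otimes> (?y \<otimes> ?z) = (?p \<otimes> ?y) \<otimes> (?q \<otimes> ?z)"
      using yq yz by (metis m_assoc m_closed)
    also have "\<dots> = (?q \<otimes> ?z) \<otimes> (?p \<otimes> ?y)" using stab_commute[OF h] ac u w by simp
    also have "\<dots> = (?p \<otimes> ?q) \<otimes> (?z \<otimes> ?y)" using zp pq yz by (metis m_assoc m_closed)
    finally have "?y \<otimes> ?z = ?z \<otimes> ?y" using yz by simp
    then show ?thesis
      using X_powers_commute_imp_adjacent[OF g _ _ \<open>u \<noteq> w\<close>, of "c u" "c w"] L u w ac[of u] ac[of w]
      by simp
  qed
  then have "k < card ?L"
    using \<Gamma>.card_link_greater[OF not_clique no_separating v] by blast
  moreover have "card ?L \<le> k"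
  proof (rule card_le_rank[OF h])
    let ?s = "\<lambda>u. elt g v [^]\<^bsub>A\<^esub> a u \<otimes>\<^bsub>A\<^esub> elt g u [^]\<^bsub>A\<^esub> c u"
    show "?L \<subseteq> verts \<Gamma>" using L by blast
    show sH: "?s u \<in> H" if "u \<in> ?L" for u
      using that g v L by (intro H_mult H_int_pow H_pow elt_H) auto
    show "\<psi> (?s u) \<in> stab h" if "u \<in> ?L" for u
      using ac[OF that] that g v L
      by (simp add: \<psi>_mult H_int_pow H_pow elt_H \<psi>_int_pow \<psi>_pow X_def)
    \<comment> \<open>The power of \<open>elt g v\<close> is invisible to \<open>char u\<close>,
      because \<open>u\<close> differs from \<open>v\<close>.\<close>
    show "char u (?s w) = 0 \<longleftrightarrow> u \<noteq> w" if "u \<in> ?L" "w \<in> ?L" for u w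
    proof -
      note \<chi> = char(1)[OF L[OF that(1)]]
      have "u \<noteq> v" using that(1) \<Gamma>.adj_not_same by auto
      have "char u (?s w) = a w * char u (elt g v) + int (c w) * char u (elt g w)"
        using that L g v hom_int_pow[OF \<chi> _ A.is_group group_integer_group, of "elt g v" "a w"]
        by (simp add: hom_mult[OF \<chi>] A.hom_nat_pow'[OF \<chi> group_integer_group] elt_carrier)
      also have "\<dots> = (if w = u then int (c w) * int N else 0)"
        using that L g v \<open>u \<noteq> v\<close> by (simp add: char_elt)
      finally show ?thesis using ac[OF that(2)] N_pos by auto
    qed
  qed
  ultimately show False by simp
qed

section \<open>The side of an edge on which the fixed trees lie\<close>

definition fixing :: "'v word set \<Rightarrow> 'p set \<Rightarrow> 'v set"
  where "fixing g h = {v \<in> verts \<Gamma>. X g v \<in> stab h}"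

lemma fixing_adjacent:
  assumes "g \<in> carrier A" "h \<in> HS" "u \<in> fixing g h" "v \<in> fixing g h" "u \<noteq> v"
  shows "u \<rightarrow>\<^bsub>\<Gamma>\<^esub> v"
  using assms stab_commute[OF assms(2), of "X g u" "X g v"]
  by (intro X_powers_commute_imp_adjacent[where g = g and c = 1 and d = 1]) (auto simp: fixing_def)

lemma card_fixing:
  assumes "g \<in> carrier A" "h \<in> HS"
  shows "card (fixing g h) \<le> k"
  using assms N_pos
  by (intro card_le_rank[OF assms(2), where s = "elt g"]) (auto simp: fixing_def elt_H char_elt X_def)

lemma fixing_connected:
  assumes "g \<in> carrier A" "h \<in> HS"
  shows "\<not> disconnected (\<Gamma> \<restriction> (verts \<Gamma> - fixing g h))"
proof -
  have sub: "fixing g h \<subseteq> verts \<Gamma>" by (auto simp: fixing_def)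
  then have "K\<^bsub>card (fixing g h)\<^esub> (\<Gamma> \<restriction> fixing g h)"
    using fixing_adjacent[OF assms] by (intro \<Gamma>.complete_induce)
  then show ?thesis
    using no_separating[OF card_fixing[OF assms]] sub unfolding separating_clique_def by blast
qed

text \<open>If \<open>fixing g h\<close> contained the star of \<open>v\<close>, the link of
  \<open>v\<close> would be a clique, with more than \<open>k\<close> vertices by
  \<open>card_link_greater\<close> and at most \<open>k\<close> by
  \<open>card_fixing\<close>.\<close>

lemma star_not_fixing:
  assumes "g \<in> carrier A" "h \<in> HS" "v \<in> verts \<Gamma>"
  shows "\<exists>w\<in>verts \<Gamma>. (v = w \<or> v \<rightarrow>\<^bsub>\<Gamma>\<^esub> w) \<and> w \<notin> fixing g h"
proof (rule ccontr)
  let ?L = "{u. v \<rightarrow>\<^bsub>\<Gamma>\<^esub> u}"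
  assume "\<not> ?thesis"
  then have L: "?L \<subseteq> fixing g h" using \<Gamma>.adj_in_verts by auto
  then have "k < card ?L"
    using \<Gamma>.card_link_greater[OF not_clique no_separating assms(3)] fixing_adjacent[OF assms(1,2)] by blast
  moreover have "finite (fixing g h)" by (simp add: fixing_def)
  ultimately show False using card_mono[OF _ L] card_fixing[OF assms(1,2)] by simp
qed

text \<open>By \<open>outs_all\<close> a single such vertex decides for all vertices outside of
  \<open>fixing g h\<close>.\<close>

definition outs :: "'v word set \<Rightarrow> 'p set \<Rightarrow> bool"
  where "outs g h \<longleftrightarrow> (\<exists>v\<in>verts \<Gamma>. out (X g v) h)"

text \<open>Adjacent vertices give commuting elements, whose fixed trees the edge does not separate.
  So the side propagates through the graph without \<open>fixing g h\<close>, which is not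
  disconnected by \<open>fixing_connected\<close>.\<close>

lemma outs_all:
  assumes g: "g \<in> carrier A" and h: "h \<in> HS" and "outs g h" "v \<in> verts \<Gamma>" "v \<notin> fixing g h"
  shows "out (X g v) h"
proof -
  obtain u where u: "u \<in> verts \<Gamma>" "out (X g u) h" using assms by (auto simp: outs_def)
  have "u \<notin> fixing g h"
  proof
    assume "u \<in> fixing g h"
    then have "h \<subseteq> V - h" using u by (auto simp: fixing_def stab_def out_def)
    then show False using HS_nonempty[OF h] by auto
  qed
  then have u': "u \<in> verts \<Gamma> - fixing g h" using u by simp
  have v: "v \<in> verts \<Gamma> - fixing g h" using assms by simp
  show ?thesis
  proof (rule \<Gamma>.propagate_connected[where P = "\<lambda>v. out (X g v) h", OF _ fixing_connected[OF g h] u' u(2) v])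
    fix x y assume xy: "x \<in> verts \<Gamma> - fixing g h" "y \<in> verts \<Gamma> - fixing g h" "x \<rightarrow>\<^bsub>\<Gamma>\<^esub> y" "out (X g x) h"
    then have "\<not> out (X g y) (V - h)"
      using g h X_commute[OF g, of x y] by (intro not_out_compl_of_commute[of "X g x"]) auto
    moreover have "X g y \<odot> h \<noteq> h" using xy g by (auto simp: fixing_def stab_def)
    ultimately show "out (X g y) h"
      using elliptic_trichotomy[OF _ h X_elliptic[OF g]] xy g by blast
  qed auto
qed

text \<open>\<open>star_not_fixing\<close> supplies an element that moves \<open>h\<close>, and its
  fixed tree lies on one of the two sides.\<close>

lemma outs_total:
  assumes g: "g \<in> carrier A" and h: "h \<in> HS"
  shows "outs g h \<or> outs g (V - h)"
proof -
  obtain v where "v \<in> verts \<Gamma>" using \<Gamma>.not_clique_nonadjacent[OF not_clique] by blast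
  then obtain w where w: "w \<in> verts \<Gamma>" "w \<notin> fixing g h" using star_not_fixing[OF g h] by blast
  then have "X g w \<odot> h \<noteq> h" using g by (auto simp: fixing_def stab_def)
  then show ?thesis
    using elliptic_trichotomy[OF _ h X_elliptic[OF g]] w g unfolding outs_def by blast
qed

lemma X_mult_gen:
  assumes g: "g \<in> carrier A" and v: "v \<in> verts \<Gamma>" and w: "w \<in> verts \<Gamma>" "v = w \<or> v \<rightarrow>\<^bsub>\<Gamma>\<^esub> w"
    and x: "x = gen v \<or> x = inv\<^bsub>A\<^esub> gen v"
  shows "X (g \<otimes>\<^bsub>A\<^esub> x) w = X g w"
proof -
  let ?w = "gen w [^]\<^bsub>A\<^esub> N"
  have x': "x \<in> carrier A" using x v by auto
  have "gen v \<otimes>\<^bsub>A\<^esub> ?w = ?w \<otimes>\<^bsub>A\<^esub> gen v"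
    using w(2) arcs_ends_symmetric[OF \<Gamma>.sym_arcs, of v w]
    by (intro gen_pow_commute[OF w(1) v, symmetric]) auto
  then have xw: "x \<otimes>\<^bsub>A\<^esub> ?w = ?w \<otimes>\<^bsub>A\<^esub> x" using x v w A.commute_inv[of "gen v" ?w] by auto
  have "x \<otimes>\<^bsub>A\<^esub> ?w \<otimes>\<^bsub>A\<^esub> inv\<^bsub>A\<^esub> x = ?w" unfolding xw using x' w by (simp add: A.m_assoc)
  then have "g \<otimes>\<^bsub>A\<^esub> (x \<otimes>\<^bsub>A\<^esub> ?w \<otimes>\<^bsub>A\<^esub> inv\<^bsub>A\<^esub> x) \<otimes>\<^bsub>A\<^esub> inv\<^bsub>A\<^esub> g = elt g w" by (simp add: elt_def)
  then have "elt (g \<otimes>\<^bsub>A\<^esub> x) w = elt g w"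
    using g x' w by (simp add: elt_def A.inv_mult_group A.m_assoc)
  then show ?thesis by (simp add: X_def)
qed

text \<open>The families of \<open>g\<close> and of its product with \<open>x\<close> agree on the
  star of \<open>v\<close> by \<open>X_mult_gen\<close>, and by \<open>star_not_fixing\<close> this
  star contains a vertex that detects the side.\<close>

lemma outs_mult_gen:
  assumes g: "g \<in> carrier A" and h: "h \<in> HS" and o: "outs g h" and v: "v \<in> verts \<Gamma>"
    and x: "x = gen v \<or> x = inv\<^bsub>A\<^esub> gen v"
  shows "outs (g \<otimes>\<^bsub>A\<^esub> x) h"
proof -
  obtain w where w: "w \<in> verts \<Gamma>" "v = w \<or> v \<rightarrow>\<^bsub>\<Gamma>\<^esub> w" "w \<notin> fixing g h"
    using star_not_fixing[OF g h v] by blast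
  then have "out (X (g \<otimes>\<^bsub>A\<^esub> x) w) h"
    using outs_all[OF g h o w(1,3)] X_mult_gen[OF g v w(1,2) x] by simp
  then show ?thesis using w(1) unfolding outs_def by blast
qed

lemma outs_mult:
  assumes g: "g \<in> carrier A" and h: "h \<in> HS" and o: "outs g h" and "x \<in> carrier A"
  shows "outs (g \<otimes>\<^bsub>A\<^esub> x) h"
proof -
  \<comment> \<open>Generators are split off on the left of \<open>x\<close> and absorbed into
    \<open>g\<close>, so \<open>g\<close> stays universally quantified in the induction.\<close>
  have step: "\<forall>g\<in>carrier A. outs g h \<longrightarrow> outs (g \<otimes>\<^bsub>A\<^esub> (y \<otimes>\<^bsub>A\<^esub> P)) h"
    if "v \<in> verts \<Gamma>" "y = gen v \<or> y = inv\<^bsub>A\<^esub> gen v" "P \<in> carrier A"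
      "\<forall>g\<in>carrier A. outs g h \<longrightarrow> outs (g \<otimes>\<^bsub>A\<^esub> P) h" for v y P
  proof (intro ballI impI)
    fix g assume g: "g \<in> carrier A" "outs g h"
    have y: "y \<in> carrier A" using that by auto
    have "outs (g \<otimes>\<^bsub>A\<^esub> y) h" by (rule outs_mult_gen[OF g(1) h g(2) that(1,2)])
    then have "outs (g \<otimes>\<^bsub>A\<^esub> y \<otimes>\<^bsub>A\<^esub> P) h" using that(4) g y by simp
    then show "outs (g \<otimes>\<^bsub>A\<^esub> (y \<otimes>\<^bsub>A\<^esub> P)) h" using A.m_assoc[OF g(1) y that(3)] by simp
  qed
  have "\<forall>g\<in>carrier A. outs g h \<longrightarrow> outs (g \<otimes>\<^bsub>A\<^esub> x) h"
    using \<open>x \<in> carrier A\<close> unfolding raag_def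
  proof (induction rule: presented_group_induct)
    case one
    then show ?case using A.r_one unfolding raag_def by simp
  qed (use step in \<open>auto simp: raag_def\<close>)
  then show ?thesis using g o by blast
qed

text \<open>Conjugation by \<open>\<psi> a\<close> turns the family of the identity into the family
  of \<open>a\<close>, and \<open>outs_mult\<close> leads back from \<open>a\<close> to the
  identity.\<close>

lemma outs_act:
  assumes h: "h \<in> HS" and o: "outs \<one>\<^bsub>A\<^esub> h" and a: "a \<in> H"
  shows "outs \<one>\<^bsub>A\<^esub> (\<psi> a \<odot> h)"
proof -
  have a': "a \<in> carrier A" by (rule H_carrier[OF a])
  obtain v where v: "v \<in> verts \<Gamma>" "out (X \<one>\<^bsub>A\<^esub> v) h" using o by (auto simp: outs_def)
  have "\<psi> a \<otimes> X \<one>\<^bsub>A\<^esub> v \<otimes> inv (\<psi> a) = \<psi> (a \<otimes>\<^bsub>A\<^esub> elt \<one>\<^bsub>A\<^esub> v \<otimes>\<^bsub>A\<^esub> inv\<^bsub>A\<^esub> a)"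
    using a v elt_H[of "\<one>\<^bsub>A\<^esub>" v] by (simp add: \<psi>_mult \<psi>_inv H_mult H_inv X_def)
  also have "\<dots> = X a v" using a' v by (simp add: X_def elt_def)
  finally have "out (X a v) (\<psi> a \<odot> h)"
    using out_act[OF \<psi>_closed[OF a] _ h v(2)] v(1) by simp
  then have "outs a (\<psi> a \<odot> h)" using v(1) by (auto simp: outs_def)
  then have "outs (a \<otimes>\<^bsub>A\<^esub> inv\<^bsub>A\<^esub> a) (\<psi> a \<odot> h)"
    using a a' h by (intro outs_mult) (auto simp: act_closed)
  then show ?thesis using a' by simp
qed

text \<open>The half-spaces \<open>h\<close> with \<open>outs \<one> h\<close> form a vertex or an end of the tree fixed by \<open>\<psi> ` H\<close>. It is
  not a vertex since \<open>\<psi> ` H\<close> contains a hyperbolic element, and it is not an end since half-spaces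
  deep towards the end are fixed by \<open>X \<one> v\<close> for all \<open>v\<close>.\<close>

lemma contradiction: False
proof -
  obtain z h\<^sub>0 where z: "z \<in> carrier G" and h\<^sub>0: "h\<^sub>0 \<in> HS" "z \<odot> h\<^sub>0 \<subset> h\<^sub>0" using hyperbolic by blast
  obtain b where b: "b \<in> H" "z [^] N = \<psi> b" using pow_in_image[OF z] by blast
  have bh: "\<psi> b \<odot> h\<^sub>0 \<subset> h\<^sub>0"
    using pow_strict_antimono[OF z h\<^sub>0 N_pos] b h\<^sub>0 by (simp add: act_one)
  \<comment> \<open>\<open>\<psi> b\<close> shrinks \<open>h\<^sub>0\<close> and enlarges its
    complement. Whichever of the two satisfies \<open>outs\<close> is thus enlarged by
    \<open>\<psi> b\<close> or by its inverse.\<close>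
  have "\<exists>a\<in>H. \<exists>h\<in>HS. h \<subset> \<psi> a \<odot> h \<and> outs \<one>\<^bsub>A\<^esub> h"
    using outs_total[OF A.one_closed h\<^sub>0(1)]
  proof
    assume "outs \<one>\<^bsub>A\<^esub> h\<^sub>0"
    moreover have "h\<^sub>0 \<subset> \<psi> (inv\<^bsub>A\<^esub> b) \<odot> h\<^sub>0"
      using bh b(1) h\<^sub>0(1) act_inv_psubset[of "inv (\<psi> b)" h\<^sub>0 h\<^sub>0] by (simp add: \<psi>_inv)
    ultimately show ?thesis using H_inv[OF b(1)] h\<^sub>0(1) by blast
  next
    assume "outs \<one>\<^bsub>A\<^esub> (V - h\<^sub>0)"
    moreover have "V - h\<^sub>0 \<subset> \<psi> b \<odot> (V - h\<^sub>0)"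
      using bh b(1) h\<^sub>0(1) subset[OF h\<^sub>0(1)] by (auto simp: act_compl)
    ultimately show ?thesis using b(1) compl[OF h\<^sub>0(1)] by blast
  qed
  then obtain a h where a: "a \<in> H" and h: "h \<in> HS" "h \<subset> \<psi> a \<odot> h" and o: "outs \<one>\<^bsub>A\<^esub> h" by blast
  let ?y = "\<psi> a"
  let ?h = "\<lambda>n::nat. ?y [^] n \<odot> h"
  have y: "?y \<in> carrier G" using a by simp
  have hn: "?h n \<in> HS" for n using y h by (simp add: act_closed)
  have outs_n: "outs \<one>\<^bsub>A\<^esub> (?h n)" for n
    using outs_act[OF h(1) o H_pow[OF a, of n]] a by (simp add: \<psi>_pow)
  have mono: "?h m \<subseteq> ?h n" if "m \<le> n" for m n
  proof -
    have "?y \<odot> (V - h) \<subset> V - h"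
      using y h subset[OF act_closed[OF y h(1)]] by (auto simp: act_compl)
    then have "?y [^] n \<odot> (V - h) \<subseteq> ?y [^] m \<odot> (V - h)"
      using pow_antimono[OF y compl[OF h(1)] _ that] by blast
    then show ?thesis using y h(1) hn by (simp add: act_compl compl_subset_compl)
  qed
  \<comment> \<open>Otherwise all the growing half-spaces \<open>?h n\<close> would stay inside the
    complement of the translate of \<open>h\<close> by \<open>X \<one> v\<close>.\<close>
  have escape: "\<exists>n. \<not> out (X \<one>\<^bsub>A\<^esub> v) (?h n)" if v: "v \<in> verts \<Gamma>" for v
  proof (rule ccontr)
    let ?x = "X \<one>\<^bsub>A\<^esub> v"
    assume "\<not> ?thesis"
    then have all: "?x \<odot> ?h n \<subseteq> V - ?h n" for n by (simp add: out_def)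
    have x: "?x \<in> carrier G" using v by simp
    have "?h n \<subseteq> V - ?x \<odot> h" for n
    proof -
      have "?x \<odot> h \<subseteq> ?x \<odot> ?h n"
        using mono[of 0 n] x h hn by (intro act_mono) (auto simp: act_one)
      then have "?x \<odot> h \<subseteq> V - ?h n" using all[of n] by blast
      then show ?thesis using subset_compl_swap[OF act_closed[OF x h(1)] hn] by blast
    qed
    then show False
      using ascending_escapes[OF y h compl[OF act_closed[OF x h(1)]]] by blast
  qed
  obtain u v where uv: "u \<in> verts \<Gamma>" "v \<in> verts \<Gamma>" "u \<noteq> v" "\<not> u \<rightarrow>\<^bsub>\<Gamma>\<^esub> v"
    using \<Gamma>.not_clique_nonadjacent[OF not_clique] by blast
  obtain m n where mn: "\<not> out (X \<one>\<^bsub>A\<^esub> u) (?h m)" "\<not> out (X \<one>\<^bsub>A\<^esub> v) (?h n)"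
    using escape uv by blast
  \<comment> \<open>\<open>out\<close> passes to smaller half-spaces, so once it fails it fails at
    every later stage, and \<open>outs_all\<close> then puts the vertex into \<open>fixing\<close>.
    The non-adjacent \<open>u\<close> and \<open>v\<close> cannot both be there.\<close>
  have "w \<in> fixing \<one>\<^bsub>A\<^esub> (?h (max m n))"
    if "w \<in> verts \<Gamma>" "\<not> out (X \<one>\<^bsub>A\<^esub> w) (?h l)" "l \<le> max m n" for w l
    using outs_all[OF A.one_closed hn outs_n that(1), of "max m n"] that
      out_mono[OF _ hn hn mono[OF that(3)], of "X \<one>\<^bsub>A\<^esub> w"] by auto
  then have "u \<in> fixing \<one>\<^bsub>A\<^esub> (?h (max m n))" "v \<in> fixing \<one>\<^bsub>A\<^esub> (?h (max m n))"
    using mn uv by auto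
  then show False using fixing_adjacent[OF A.one_closed hn] uv by blast
qed

end

lemma (in splitting_action) not_commensurable_raag:
  assumes "graph \<Gamma>" "\<not> clique \<Gamma>" "\<And>j. j \<le> k \<Longrightarrow> \<not> (\<exists>S. separating_clique \<Gamma> j S)"
    and "subgroup C G" "G\<lparr>carrier := C\<rparr> \<cong> product_group {..<k} (\<lambda>_. integer_group)"
  shows "\<not> commensurable (raag \<Gamma>) G"
proof
  interpret A: group "raag \<Gamma>" by (rule group_raag)
  assume "commensurable (raag \<Gamma>) G"
  then obtain H H' \<psi> where H: "finite_index_subgroup H (raag \<Gamma>)" and H': "finite_index_subgroup H' G"
    and \<psi>: "\<psi> \<in> iso (raag \<Gamma>\<lparr>carrier := H\<rparr>) (G\<lparr>carrier := H'\<rparr>)"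
    unfolding commensurable_def is_iso_def by blast
  obtain M where M: "0 < M" "\<And>g. g \<in> carrier (raag \<Gamma>) \<Longrightarrow> g [^]\<^bsub>raag \<Gamma>\<^esub> (M::nat) \<in> H"
    using A.finite_index_power[OF H] by blast
  obtain M' where M': "0 < M'" "\<And>g. g \<in> carrier G \<Longrightarrow> g [^] (M'::nat) \<in> H'"
    using finite_index_power[OF H'] by blast
  have sub: "subgroup H (raag \<Gamma>)" "subgroup H' G"
    using H H' by (auto simp: finite_index_subgroup_def)
  have \<psi>': "\<psi> \<in> hom (raag \<Gamma>\<lparr>carrier := H\<rparr>) G" "inj_on \<psi> H" "\<psi> ` H = H'"
    using \<psi> subgroup.subset[OF sub(2)] by (auto simp: iso_def hom_def bij_betw_def)
  \<comment> \<open>The product of the two exponents serves both finite index subgroups at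
    once.\<close>
  have "raag_splitting_action G V HS act C \<Gamma> H \<psi> (M * M') k"
  proof (intro raag_splitting_action.intro raag_splitting_action_axioms.intro)
    show "splitting_action G V HS act C" by (rule splitting_action_axioms)
    show "g [^]\<^bsub>raag \<Gamma>\<^esub> (M * M') \<in> H" if "g \<in> carrier (raag \<Gamma>)" for g
      using M(2)[of "g [^]\<^bsub>raag \<Gamma>\<^esub> M'"] that by (simp add: A.nat_pow_pow mult.commute)
    show "z [^] (M * M') \<in> \<psi> ` H" if "z \<in> carrier G" for z
      using M'(2)[of "z [^] M"] that \<psi>'(3) by (simp add: nat_pow_pow)
  qed (use assms sub(1) \<psi>'(1,2) M(1) M'(1) in simp_all)
  then show False by (rule raag_splitting_action.contradiction)
qed

theorem theorem3p5:
  fixes n :: nat and \<Gamma> :: "('v, 'e) pre_digraph" and G :: "('g, 'm) monoid_scheme"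
  assumes "graph \<Gamma>"
    and "\<not> clique \<Gamma>"
    and "\<forall>k\<le>n. \<not> (\<exists>S. separating_clique \<Gamma> k S)"
    and "group G"
  shows "\<forall>k\<le>n. splits_nontrivially_over_Z_power G k \<longrightarrow> \<not> commensurable (raag \<Gamma>) G"
proof (intro allI impI)
  fix k assume "k \<le> n" and "splits_nontrivially_over_Z_power G k"
  then obtain C where C: "subgroup C G" "G\<lparr>carrier := C\<rparr> \<cong> product_group {..<k} (\<lambda>_. integer_group)"
    and split: "splits_nontrivially_over G C"
    by (auto simp: splits_nontrivially_over_Z_power_def)
  have sep: "\<not> (\<exists>S. separating_clique \<Gamma> j S)" if "j \<le> k" for j
    using assms(3) \<open>k \<le> n\<close> that by auto
  interpret group G by fact
  from split show "\<not> commensurable (raag \<Gamma>) G"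
    unfolding splits_nontrivially_over_def
  proof (elim disjE exE conjE)
    fix A B assume "amalgam_decomposition G A B C" "carrier G \<noteq> A" "carrier G \<noteq> B"
    then obtain V :: "('g \<times> bool) set" and HS act where "splitting_action G V HS act C"
      using amalgam_splitting_action by blast
    then show ?thesis by (rule splitting_action.not_commensurable_raag[OF _ assms(1,2) sep C])
  next
    fix A assume "hnn_decomposition G A C"
    then obtain V :: "'g set" and HS act where "splitting_action G V HS act C"
      using hnn_splitting_action by blast
    then show ?thesis by (rule splitting_action.not_commensurable_raag[OF _ assms(1,2) sep C])
  qed
qed

end
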